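(* The solutions $Y^\epsilon$ do not satisfy the full (strong) large deviation principle in $(\mathbb{D},d)$ with rate function $\tilde I$ and speed $\log(1/\epsilon)$; that is, it is not true that the upper bound $$\limsup_{\epsilon\to0}\frac{\log\mathbb{P}(Y^\epsilon\in K)}{\log(1/\epsilon)}\le-\inf_{x\in K}\tilde I(x)$$ holds for all closed sets $K\subset\mathbb{D}$.
   Context: Skorokhod space: $\mathbb{D}=\mathbb{D}([0,1])$ is the space of real-valued right-continuous functions with left limits on $[0,1]$, with the Skorokhod $J_1$ metric $d(x,y)=\inf_{\lambda\in\Lambda}\|\lambda-e\|\vee\|x\circ\lambda-y\|$, where $\Lambda$ is the set of increasing homeomorphisms of $[0,1]$ onto itself, $e$ is the identity and $\|\cdot\|$ is the uniform norm. Closed is with respect to $d$. Noise and SDE: $\alpha,\beta>1$ are constants and $\nu$ is a L\'evy measure on $\mathbb{R}\setminus\{0\}$ with $\nu([x,\infty))=L_+(x)x^{-\alpha}$ and $\nu((-\infty,-x])=L_-(x)x^{-\beta}$ for all $x>0$, where $L_\pm>0$ are slowly varying: $\lim_{u\to\infty}L_\pm(\lambda u)/L_\pm(u)=1$ for every $\lambda>0$. For $\epsilon>0$, $\epsilon L^\epsilon_t=\sqrt\epsilon B_t+\epsilon\int_0^t\int_{\mathbb{R}\setminus\{0\}}z\,\widetilde N^{1/\epsilon}(ds,dz)$, where $B$ is a standard Brownian motion and $\widetilde N^{1/\epsilon}$ is a compensated Poisson random measure, independent of $B$, with compensator $\epsilon^{-1}ds\otimes\nu$, all defined on a complete probability space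 $(\Omega,\mathcal F,\mathbb{P})$. The function $b:\mathbb{R}\to\mathbb{R}$ is bounded and Lipschitz continuous, and $Y^\epsilon=(Y^\epsilon_t)_{t\in[0,1]}$ is the pathwise unique solution of $dY^\epsilon_t=b(Y^\epsilon_t)\,dt+\epsilon\,dL^\epsilon_t$, $t\in(0,1]$, $Y^\epsilon_0=0$. Solution map: $F:\mathbb{D}\to\mathbb{D}$ sends $g$ to the unique $f=F(g)\in\mathbb{D}$ with $f(t)=\int_0^t b(f(s))\,ds+g(t)$ for $t\in[0,1]$. Rate function: $\tilde I:\mathbb{D}\to[0,\infty]$ is defined by $\tilde I(\xi)=(\alpha-1)\mathcal D_+(\xi)+(\beta-1)\mathcal D_-(\xi)$ if $\xi=F(\eta)$ for a step function $\eta$ (finitely many jumps) with $\eta(0)=0$, and $\tilde I(\xi)=\infty$ otherwise, where $\mathcal D_+(\xi)$ and $\mathcal D_-(\xi)$ count the upward and downward jumps of $\xi$. Convention: $\inf\emptyset=\infty$, $\log 0=-\infty$. *)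

theory Defs
  imports "HOL-Probability.Probability"
begin

section \<open>The Skorokhod space\<close>

text \<open>Paths are functions on the reals that are \<^const>\<open>undefined\<close> off the unit interval, so that
  equality of paths is equality on the unit interval.\<close>

definition skorokhod_space :: "(real \<Rightarrow> real) set" where
  "skorokhod_space = {f \<in> extensional {0..1}.
     (\<forall>t\<in>{0..<1}. (f \<longlongrightarrow> f t) (at_right t)) \<and>
     (\<forall>t\<in>{0<..1}. \<exists>l. (f \<longlongrightarrow> l) (at_left t))}"

definition time_changes :: "(real \<Rightarrow> real) set" where
  "time_changes = {\<theta>. strict_mono_on {0..1} \<theta> \<and> (\<exists>\<mu>. homeomorphism {0..1} {0..1} \<theta> \<mu>)}"

definition time_change_cost :: "(real \<Rightarrow> real) \<Rightarrow> (real \<Rightarrow> real) \<Rightarrow> (real \<Rightarrow> real) \<Rightarrow> real" where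
  "time_change_cost x y \<theta> =
     max (SUP t\<in>{0..1}. \<bar>\<theta> t - t\<bar>) (SUP t\<in>{0..1}. \<bar>x (\<theta> t) - y t\<bar>)"

text \<open>The value 0 off the space only serves the locale \<^locale>\<open>Metric_space\<close>, which asks for
  nonnegativity and symmetry without a membership guard.\<close>

definition skorokhod_dist :: "(real \<Rightarrow> real) \<Rightarrow> (real \<Rightarrow> real) \<Rightarrow> real" where
  "skorokhod_dist x y =
     (if x \<in> skorokhod_space \<and> y \<in> skorokhod_space
      then INF \<theta>\<in>time_changes. time_change_cost x y \<theta> else 0)"

definition skorokhod_topology :: "(real \<Rightarrow> real) topology" where
  "skorokhod_topology = Metric_space.mtopology skorokhod_space skorokhod_dist"

lemma skorokhod_bounded:
  assumes "f \<in> skorokhod_space"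
  shows "bounded (f ` {0..1})"
proof -
  define P where "P u v \<longleftrightarrow> bounded (f ` ({u..v} \<inter> {0..1}))" for u v :: real
  have "0 \<le> (1::real)" by simp
  then have "P 0 1"
  proof (induction rule: Bolzano)
    case (trans a b c)
    have "f ` ({a..c} \<inter> {0..1}) \<subseteq> f ` ({a..b} \<inter> {0..1}) \<union> f ` ({b..c} \<inter> {0..1})"
      unfolding image_Un[symmetric] by (intro image_mono) auto
    with trans show ?case
      unfolding P_def by (meson bounded_Un bounded_subset)
  next
    case (local t)
    have right: "\<exists>e>0. bounded (f ` ({t<..<t+e} \<inter> {0..1}))"
    proof (cases "t < 1")
      case True
      with local assms have "(f \<longlongrightarrow> f t) (at_right t)"
        by (auto simp: skorokhod_space_def)
      then have "eventually (\<lambda>s. dist (f s) (f t) < 1) (at_right t)"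
        by (simp add: tendstoD)
      then obtain b where b: "b > t" "\<And>s. t < s \<Longrightarrow> s < b \<Longrightarrow> dist (f s) (f t) < 1"
        by (auto simp: eventually_at_right_field)
      have "f ` ({t<..<t+(b-t)} \<inter> {0..1}) \<subseteq> ball (f t) 1"
        using b by (auto simp: dist_commute)
      with b(1) show ?thesis
        by (intro exI[of _ "b - t"]) (simp add: bounded_subset[OF bounded_ball])
    next
      case False
      then have "{t<..<t+1} \<inter> {0..1} = {}" by auto
      then show ?thesis by (intro exI[of _ 1]) (metis bounded_empty image_empty zero_less_one)
    qed
    have left: "\<exists>e>0. bounded (f ` ({t-e<..<t} \<inter> {0..1}))"
    proof (cases "0 < t")
      case True
      with local have "t \<in> {0<..1}" by auto
      with assms obtain l where "(f \<longlongrightarrow> l) (at_left t)"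
        unfolding skorokhod_space_def by blast
      then have "eventually (\<lambda>s. dist (f s) l < 1) (at_left t)"
        by (simp add: tendstoD)
      then obtain b where b: "b < t" "\<And>s. b < s \<Longrightarrow> s < t \<Longrightarrow> dist (f s) l < 1"
        by (auto simp: eventually_at_left_field)
      have "f ` ({t-(t-b)<..<t} \<inter> {0..1}) \<subseteq> ball l 1"
        using b by (auto simp: dist_commute)
      with b(1) show ?thesis
        by (intro exI[of _ "t - b"]) (simp add: bounded_subset[OF bounded_ball])
    next
      case False
      then have "{t-1<..<t} \<inter> {0..1} = {}" by auto
      then show ?thesis by (intro exI[of _ 1]) (metis bounded_empty image_empty zero_less_one)
    qed
    from right obtain e1 where e1: "e1 > 0" "bounded (f ` ({t<..<t+e1} \<inter> {0..1}))" by auto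
    from left obtain e2 where e2: "e2 > 0" "bounded (f ` ({t-e2<..<t} \<inter> {0..1}))" by auto
    have "P u v" if "u \<le> t \<and> t \<le> v \<and> v - u < min e1 e2" for u v
    proof -
      have "{u..v} \<subseteq> {t-e2<..<t} \<union> {t} \<union> {t<..<t+e1}"
        using that by auto
      then have "f ` ({u..v} \<inter> {0..1}) \<subseteq>
          f ` ({t-e2<..<t} \<inter> {0..1}) \<union> {f t} \<union> f ` ({t<..<t+e1} \<inter> {0..1})"
        by blast
      then show ?thesis
        unfolding P_def using e1(2) e2(2) by (elim bounded_subset[rotated]) simp
    qed
    then show ?case
      using e1(1) e2(1) by (intro exI[of _ "min e1 e2"]) auto
  qed
  then show ?thesis by (simp add: P_def)
qed

lemma time_changes_range:
  assumes "\<theta> \<in> time_changes" "t \<in> {0..1}"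
  shows "\<theta> t \<in> {0..1}"
  using assms unfolding time_changes_def homeomorphism_def by blast

lemma time_changes_id: "(\<lambda>t. t) \<in> time_changes"
  unfolding time_changes_def
  by (auto simp: strict_mono_on_def intro!: exI[of _ "\<lambda>t. t"] homeomorphismI)

lemma time_changes_comp:
  assumes "\<theta> \<in> time_changes" "\<mu> \<in> time_changes"
  shows "\<theta> \<circ> \<mu> \<in> time_changes"
proof -
  obtain \<theta>' \<mu>' where h: "homeomorphism {0..1} {0..1} \<theta> \<theta>'" "homeomorphism {0..1} {0..1} \<mu> \<mu>'"
    using assms by (auto simp: time_changes_def)
  have "strict_mono_on {0..1} (\<theta> \<circ> \<mu>)"
    using assms time_changes_range[OF assms(2)]
    unfolding time_changes_def strict_mono_on_def by auto
  with homeomorphism_compose[OF h(2,1)] show ?thesis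
    unfolding time_changes_def by blast
qed

lemma time_changes_inverse:
  assumes "\<theta> \<in> time_changes"
  obtains \<mu> where "\<mu> \<in> time_changes" "\<And>t. t \<in> {0..1} \<Longrightarrow> \<mu> (\<theta> t) = t"
    "\<And>t. t \<in> {0..1} \<Longrightarrow> \<theta> (\<mu> t) = t"
proof -
  obtain \<mu> where h: "homeomorphism {0..1} {0..1} \<theta> \<mu>" and sm: "strict_mono_on {0..1} \<theta>"
    using assms by (auto simp: time_changes_def)
  have inv: "\<mu> (\<theta> t) = t" "\<theta> (\<mu> t) = t" "\<mu> t \<in> {0..1}" if "t \<in> {0..1}" for t
    using h that unfolding homeomorphism_def by blast+
  have "strict_mono_on {0..1} \<mu>"
  proof (rule strict_mono_onI)
    fix r s :: real assume rs: "r \<in> {0..1}" "s \<in> {0..1}" "r < s"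
    show "\<mu> r < \<mu> s"
    proof (rule ccontr)
      assume "\<not> \<mu> r < \<mu> s"
      then consider "\<mu> s < \<mu> r" | "\<mu> s = \<mu> r" by linarith
      then have "\<theta> (\<mu> s) \<le> \<theta> (\<mu> r)"
        by cases (use strict_mono_onD[OF sm inv(3)[OF rs(2)] inv(3)[OF rs(1)]] in auto)
      with inv rs show False by simp
    qed
  qed
  with homeomorphism_sym[THEN iffD1, OF h] have "\<mu> \<in> time_changes"
    unfolding time_changes_def by blast
  with inv show thesis using that by blast
qed

lemma time_change_cost_le_iff:
  assumes "x \<in> skorokhod_space" "y \<in> skorokhod_space" "\<theta> \<in> time_changes"
  shows "time_change_cost x y \<theta> \<le> c \<longleftrightarrow>
    (\<forall>t\<in>{0..1}. \<bar>\<theta> t - t\<bar> \<le> c \<and> \<bar>x (\<theta> t) - y t\<bar> \<le> c)"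
proof -
  obtain C where C: "\<And>t. t \<in> {0..1} \<Longrightarrow> \<bar>x t\<bar> \<le> C"
    using skorokhod_bounded[OF assms(1)] unfolding bounded_iff by (metis image_eqI real_norm_def)
  obtain C' where C': "\<And>t. t \<in> {0..1} \<Longrightarrow> \<bar>y t\<bar> \<le> C'"
    using skorokhod_bounded[OF assms(2)] unfolding bounded_iff by (metis image_eqI real_norm_def)
  note r = time_changes_range[OF assms(3)]
  have "bdd_above ((\<lambda>t. \<bar>\<theta> t - t\<bar>) ` {0..1})"
  proof (rule bdd_aboveI2)
    show "\<bar>\<theta> t - t\<bar> \<le> 1" if "t \<in> {0..1}" for t using r[OF that] that by auto
  qed
  moreover have "bdd_above ((\<lambda>t. \<bar>x (\<theta> t) - y t\<bar>) ` {0..1})"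
  proof (rule bdd_aboveI2)
    show "\<bar>x (\<theta> t) - y t\<bar> \<le> C + C'" if "t \<in> {0..1}" for t
      using C[OF r[OF that]] C'[OF that] by linarith
  qed
  ultimately show ?thesis
    by (auto simp: time_change_cost_def cSUP_le_iff)
qed

lemma time_change_cost_nonneg:
  assumes "x \<in> skorokhod_space" "y \<in> skorokhod_space" "\<theta> \<in> time_changes"
  shows "0 \<le> time_change_cost x y \<theta>"
  using time_change_cost_le_iff[OF assms, of "time_change_cost x y \<theta>"]
  by (auto dest!: bspec[of _ _ 0])

lemma skorokhod_dist_le:
  assumes "x \<in> skorokhod_space" "y \<in> skorokhod_space" "\<theta> \<in> time_changes"
    "\<And>t. t \<in> {0..1} \<Longrightarrow> \<bar>\<theta> t - t\<bar> \<le> c" "\<And>t. t \<in> {0..1} \<Longrightarrow> \<bar>x (\<theta> t) - y t\<bar> \<le> c"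
  shows "skorokhod_dist x y \<le> c"
proof -
  have "(INF \<theta>\<in>time_changes. time_change_cost x y \<theta>) \<le> time_change_cost x y \<theta>"
    by (rule cINF_lower[OF _ assms(3)])
       (auto intro!: bdd_belowI2[of _ 0] time_change_cost_nonneg assms)
  also have "\<dots> \<le> c"
    using time_change_cost_le_iff[OF assms(1-3)] assms(4,5) by blast
  finally show ?thesis using assms(1,2) by (simp add: skorokhod_dist_def)
qed

lemma skorokhod_dist_lessE:
  assumes "x \<in> skorokhod_space" "y \<in> skorokhod_space" "skorokhod_dist x y < c"
  obtains \<theta> where "\<theta> \<in> time_changes"
    "\<And>t. t \<in> {0..1} \<Longrightarrow> \<bar>\<theta> t - t\<bar> < c" "\<And>t. t \<in> {0..1} \<Longrightarrow> \<bar>x (\<theta> t) - y t\<bar> < c"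
proof -
  have "\<exists>\<theta>\<in>time_changes. time_change_cost x y \<theta> < c"
    using assms time_changes_id
    by (subst (asm) skorokhod_dist_def, simp, subst (asm) cINF_less_iff)
       (auto intro!: bdd_belowI2[of _ 0] time_change_cost_nonneg)
  then obtain \<theta> where \<theta>: "\<theta> \<in> time_changes" "time_change_cost x y \<theta> < c" by blast
  have "\<bar>\<theta> t - t\<bar> < c \<and> \<bar>x (\<theta> t) - y t\<bar> < c" if "t \<in> {0..1}" for t
    using time_change_cost_le_iff[OF assms(1,2) \<theta>(1), of "time_change_cost x y \<theta>"] \<theta>(2) that
    by fastforce
  with \<theta>(1) show thesis using that by blast
qed

lemma skorokhod_dist_zero_imp_eq:
  assumes x: "x \<in> skorokhod_space" and y: "y \<in> skorokhod_space" and d: "skorokhod_dist x y = 0"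
  shows "x = y"
proof (rule extensionalityI[where A = "{0..1}"])
  show "x \<in> extensional {0..1}" "y \<in> extensional {0..1}"
    using x y by (auto simp: skorokhod_space_def)
  fix t :: real assume t: "t \<in> {0..1}"
  show "x t = y t"
  proof (cases "t = 1")
    case True
    have "\<bar>x 1 - y 1\<bar> \<le> e" if e: "0 < e" for e
    proof -
      obtain \<theta> where \<theta>: "\<theta> \<in> time_changes" "\<And>t. t \<in> {0..1} \<Longrightarrow> \<bar>x (\<theta> t) - y t\<bar> < e"
        using skorokhod_dist_lessE[OF x y, of e] d e by metis
      obtain \<mu> where \<mu>: "\<mu> \<in> time_changes" "\<And>t. t \<in> {0..1} \<Longrightarrow> \<theta> (\<mu> t) = t"
        using time_changes_inverse[OF \<theta>(1)] by metis
      have "\<theta> 1 = 1"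
      proof (rule ccontr)
        assume "\<theta> 1 \<noteq> 1"
        with time_changes_range[OF \<theta>(1), of 1] have "\<theta> 1 < 1" by auto
        moreover have "\<mu> 1 \<in> {0..1}" "\<theta> (\<mu> 1) = 1"
          using \<mu> time_changes_range[OF \<mu>(1)] by auto
        ultimately show False
          using \<theta>(1) unfolding time_changes_def strict_mono_on_def
          by (metis (no_types, lifting) atLeastAtMost_iff mem_Collect_eq less_eq_real_def
              not_less_iff_gr_or_eq order_refl zero_le_one)
      qed
      with \<theta>(2)[of 1] show ?thesis by auto
    qed
    then have "\<bar>x 1 - y 1\<bar> \<le> 0" by (rule field_le_epsilon[of _ 0, simplified])
    with True show ?thesis by auto
  next
    case False
    with t have t': "t \<in> {0..<1}" by auto
    have "\<bar>x t - y t\<bar> \<le> e" if e: "0 < e" for e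
    proof -
      have "e / 3 > 0" using e by simp
      have "(x \<longlongrightarrow> x t) (at_right t)" "(y \<longlongrightarrow> y t) (at_right t)"
        using x y t' by (auto simp: skorokhod_space_def)
      then have "eventually (\<lambda>s. dist (x s) (x t) < e/3 \<and> dist (y s) (y t) < e/3) (at_right t)"
        using \<open>e / 3 > 0\<close> by (intro eventually_conj tendstoD)
      then obtain c where c: "c > t"
        "\<And>s. t < s \<Longrightarrow> s < c \<Longrightarrow> dist (x s) (x t) < e/3 \<and> dist (y s) (y t) < e/3"
        by (auto simp: eventually_at_right_field)
      define h where "h = min c 1 - t"
      have h: "h > 0" "t + h \<le> c" "t + h \<le> 1" using c t' by (auto simp: h_def)
      define s where "s = t + h / 2"
      have s: "s \<in> {0..1}" "t < s" "s < c" "s - h/2 = t" "s + h/2 = t + h"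
        using h t' by (auto simp: s_def)
      obtain \<theta> where \<theta>: "\<theta> \<in> time_changes"
        "\<And>t. t \<in> {0..1} \<Longrightarrow> \<bar>\<theta> t - t\<bar> < min (e/3) (h/2)"
        "\<And>t. t \<in> {0..1} \<Longrightarrow> \<bar>x (\<theta> t) - y t\<bar> < min (e/3) (h/2)"
        using skorokhod_dist_lessE[OF x y, of "min (e/3) (h/2)"] d \<open>e / 3 > 0\<close> h(1)
        by (metis half_gt_zero min_less_iff_conj)
      have "t < \<theta> s" "\<theta> s < c" using \<theta>(2)[OF s(1)] s h by linarith+
      then have "\<bar>x (\<theta> s) - x t\<bar> < e/3" "\<bar>y s - y t\<bar> < e/3"
        using c(2)[of s] c(2)[of "\<theta> s"] s by (auto simp: dist_real_def)
      with \<theta>(3)[OF s(1)] show ?thesis by linarith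
    qed
    then have "\<bar>x t - y t\<bar> \<le> 0" by (rule field_le_epsilon[of _ 0, simplified])
    then show ?thesis by auto
  qed
qed

theorem Metric_space_skorokhod: "Metric_space skorokhod_space skorokhod_dist"
proof
  show nonneg: "0 \<le> skorokhod_dist x y" for x y
    unfolding skorokhod_dist_def
    using time_changes_id time_change_cost_nonneg by (auto intro!: cINF_greatest)
  have le: "skorokhod_dist y x \<le> skorokhod_dist x y"
    if xy: "x \<in> skorokhod_space" "y \<in> skorokhod_space" for x y
  proof (rule dense_ge)
    fix c assume "skorokhod_dist x y < c"
    then obtain \<theta> where \<theta>: "\<theta> \<in> time_changes"
      "\<And>t. t \<in> {0..1} \<Longrightarrow> \<bar>\<theta> t - t\<bar> < c" "\<And>t. t \<in> {0..1} \<Longrightarrow> \<bar>x (\<theta> t) - y t\<bar> < c"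
      using skorokhod_dist_lessE[OF xy] by metis
    obtain \<mu> where \<mu>: "\<mu> \<in> time_changes" "\<And>t. t \<in> {0..1} \<Longrightarrow> \<theta> (\<mu> t) = t"
      using time_changes_inverse[OF \<theta>(1)] by metis
    show "skorokhod_dist y x \<le> c"
    proof (rule skorokhod_dist_le[OF xy(2,1) \<mu>(1)])
      fix t :: real assume t: "t \<in> {0..1}"
      show "\<bar>\<mu> t - t\<bar> \<le> c" "\<bar>y (\<mu> t) - x t\<bar> \<le> c"
        using \<theta>(2,3)[OF time_changes_range[OF \<mu>(1) t]] \<mu>(2)[OF t] by auto
    qed
  qed
  show "skorokhod_dist x y = skorokhod_dist y x" for x y
    using le[of x y] le[of y x] by (force simp: skorokhod_dist_def)
  show "skorokhod_dist x y = 0 \<longleftrightarrow> x = y"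
    if xy: "x \<in> skorokhod_space" "y \<in> skorokhod_space" for x y
  proof
    assume "x = y"
    then have "skorokhod_dist x y \<le> 0"
      using xy time_changes_id by (intro skorokhod_dist_le[of x y "\<lambda>t. t"]) auto
    with nonneg[of x y] show "skorokhod_dist x y = 0" by simp
  qed (rule skorokhod_dist_zero_imp_eq[OF xy])
  show "skorokhod_dist x z \<le> skorokhod_dist x y + skorokhod_dist y z"
    if xyz: "x \<in> skorokhod_space" "y \<in> skorokhod_space" "z \<in> skorokhod_space" for x y z
  proof (rule field_le_epsilon)
    fix e :: real assume e: "0 < e"
    obtain \<theta> where \<theta>: "\<theta> \<in> time_changes"
      "\<And>t. t \<in> {0..1} \<Longrightarrow> \<bar>\<theta> t - t\<bar> < skorokhod_dist x y + e/2"
      "\<And>t. t \<in> {0..1} \<Longrightarrow> \<bar>x (\<theta> t) - y t\<bar> < skorokhod_dist x y + e/2"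
      using skorokhod_dist_lessE[OF xyz(1,2), of "skorokhod_dist x y + e/2"] e
      by (metis half_gt_zero less_add_same_cancel1)
    obtain \<mu> where \<mu>: "\<mu> \<in> time_changes"
      "\<And>t. t \<in> {0..1} \<Longrightarrow> \<bar>\<mu> t - t\<bar> < skorokhod_dist y z + e/2"
      "\<And>t. t \<in> {0..1} \<Longrightarrow> \<bar>y (\<mu> t) - z t\<bar> < skorokhod_dist y z + e/2"
      using skorokhod_dist_lessE[OF xyz(2,3), of "skorokhod_dist y z + e/2"] e
      by (metis half_gt_zero less_add_same_cancel1)
    show "skorokhod_dist x z \<le> skorokhod_dist x y + skorokhod_dist y z + e"
    proof (rule skorokhod_dist_le[OF xyz(1,3) time_changes_comp[OF \<theta>(1) \<mu>(1)]])
      fix t :: real assume t: "t \<in> {0..1}"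
      note A = \<theta>(2,3)[OF time_changes_range[OF \<mu>(1) t]] \<mu>(2,3)[OF t]
      show "\<bar>(\<theta> \<circ> \<mu>) t - t\<bar> \<le> skorokhod_dist x y + skorokhod_dist y z + e"
        using A by (simp add: o_def)
      show "\<bar>x ((\<theta> \<circ> \<mu>) t) - z t\<bar> \<le> skorokhod_dist x y + skorokhod_dist y z + e"
        using A by (simp add: o_def)
    qed
  qed
qed


section \<open>The driving noise\<close>

definition slowly_varying :: "(real \<Rightarrow> real) \<Rightarrow> bool" where
  "slowly_varying L \<longleftrightarrow> (\<forall>c>0. ((\<lambda>u. L (c * u) / L u) \<longlongrightarrow> 1) at_top)"

definition levy_measure :: "real measure \<Rightarrow> bool" where
  "levy_measure \<nu> \<longleftrightarrow> sets \<nu> = sets borel \<and> emeasure \<nu> {0} = 0 \<and>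
     (\<integral>\<^sup>+z. ennreal (min 1 (z\<^sup>2)) \<partial>\<nu>) < \<infinity>"

definition standard_brownian_motion :: "'w measure \<Rightarrow> (real \<Rightarrow> 'w \<Rightarrow> real) \<Rightarrow> bool" where
  "standard_brownian_motion P B \<longleftrightarrow>
     (\<forall>t\<in>{0..1}. B t \<in> borel_measurable P) \<and>
     (AE \<omega> in P. B 0 \<omega> = 0) \<and>
     (\<forall>s t. 0 \<le> s \<and> s < t \<and> t \<le> 1 \<longrightarrow>
        distributed P lborel (\<lambda>\<omega>. B t \<omega> - B s \<omega>)
          (\<lambda>x. ennreal (normal_density 0 (sqrt (t - s)) x))) \<and>
     (\<forall>(n::nat) u. (\<forall>i\<le>n. u i \<in> {0..1}) \<and> (\<forall>i<n. u i \<le> u (Suc i)) \<longrightarrow>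
        prob_space.indep_vars P (\<lambda>_. borel) (\<lambda>i \<omega>. B (u (Suc i)) \<omega> - B (u i) \<omega>) {..<n}) \<and>
     (AE \<omega> in P. continuous_on {0..1} (\<lambda>t. B t \<omega>))"

text \<open>A random measure with values \<open>N \<omega>\<close> and intensity measure \<open>\<mu>\<close>.\<close>

definition poisson_random_measure ::
  "'w measure \<Rightarrow> 'a measure \<Rightarrow> ('w \<Rightarrow> 'a measure) \<Rightarrow> bool" where
  "poisson_random_measure P \<mu> N \<longleftrightarrow>
     (\<forall>\<omega>\<in>space P. sets (N \<omega>) = sets \<mu>) \<and>
     (\<forall>A\<in>sets \<mu>. (\<lambda>\<omega>. emeasure (N \<omega>) A) \<in> borel_measurable P) \<and>
     (\<forall>A\<in>sets \<mu>. emeasure \<mu> A < \<infinity> \<longrightarrow>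
        (\<forall>k::nat. measure P {\<omega> \<in> space P. emeasure (N \<omega>) A = of_nat k} =
           measure \<mu> A ^ k / fact k * exp (- measure \<mu> A))) \<and>
     (\<forall>A\<in>sets \<mu>. emeasure \<mu> A = \<infinity> \<longrightarrow> (AE \<omega> in P. emeasure (N \<omega>) A = \<infinity>)) \<and>
     (\<forall>(n::nat) A. (\<forall>i<n. A i \<in> sets \<mu>) \<and> disjoint_family_on A {..<n} \<longrightarrow>
        prob_space.indep_vars P (\<lambda>_. borel) (\<lambda>i \<omega>. emeasure (N \<omega>) (A i)) {..<n})"

text \<open>Independence of \<open>\<sigma>(B\<^sub>t : t \<in> [0,1])\<close> and \<open>\<sigma>(N(A) : A \<in> sets \<mu>)\<close>.\<close>

definition process_indep_of_random_measure ::
  "'w measure \<Rightarrow> 'a measure \<Rightarrow> (real \<Rightarrow> 'w \<Rightarrow> real) \<Rightarrow> ('w \<Rightarrow> 'a measure) \<Rightarrow> bool" where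
  "process_indep_of_random_measure P \<mu> B N \<longleftrightarrow>
     prob_space.indep_set P
       (sets (vimage_algebra (space P) (\<lambda>\<omega>. \<lambda>t\<in>{0..1}. B t \<omega>) (\<Pi>\<^sub>M t\<in>{0..1}. borel)))
       (sets (vimage_algebra (space P) (\<lambda>\<omega>. \<lambda>A\<in>sets \<mu>. emeasure (N \<omega>) A) (\<Pi>\<^sub>M A\<in>sets \<mu>. borel)))"

text \<open>The intensity \<open>\<epsilon>\<inverse> ds \<otimes> \<nu>(dz)\<close> on \<open>[0,1] \<times> \<real>\<close>; the set \<open>[0,1] \<times> {0}\<close> is null because
  \<open>\<nu> {0} = 0\<close>.\<close>

definition jump_intensity :: "real \<Rightarrow> real measure \<Rightarrow> (real \<times> real) measure" where
  "jump_intensity \<epsilon> \<nu> =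
     scale_measure (ennreal (1 / \<epsilon>)) (restrict_space lborel {0..1} \<Otimes>\<^sub>M \<nu>)"

definition truncated_compensated_integral ::
  "(real \<times> real) measure \<Rightarrow> (real \<times> real) measure \<Rightarrow> real \<Rightarrow> real \<Rightarrow> real" where
  "truncated_compensated_integral \<mu> n \<delta> t =
     (LINT p:{0<..t} \<times> {z. \<delta> < \<bar>z\<bar>}|n. snd p) - (LINT p:{0<..t} \<times> {z. \<delta> < \<bar>z\<bar>}|\<mu>. snd p)"

text \<open>\<open>Z\<close> is a cadlag version of the integral of \<open>z\<close> over \<open>(0,t] \<times> (\<real> - {0})\<close> against the
  compensated measure \<open>N - \<mu>\<close>. Since the small jumps need not be summable, this integral is a
  limit in probability of its truncations.\<close>

definition compensated_integral ::
  "'w measure \<Rightarrow> (real \<times> real) measure \<Rightarrow> ('w \<Rightarrow> (real \<times> real) measure) \<Rightarrow>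
   (real \<Rightarrow> 'w \<Rightarrow> real) \<Rightarrow> bool" where
  "compensated_integral P \<mu> N Z \<longleftrightarrow>
     (\<forall>t\<in>{0..1}. Z t \<in> borel_measurable P) \<and>
     (\<forall>t\<in>{0..1}. \<forall>e>0.
        ((\<lambda>\<delta>. measure P {\<omega> \<in> space P.
              e < \<bar>truncated_compensated_integral \<mu> (N \<omega>) \<delta> t - Z t \<omega>\<bar>}) \<longlongrightarrow> 0) (at_right 0)) \<and>
     (AE \<omega> in P. (\<lambda>t\<in>{0..1}. Z t \<omega>) \<in> skorokhod_space)"


section \<open>The stochastic differential equation and the rate function\<close>

definition solves_additive_sde ::
  "'w measure \<Rightarrow> (real \<Rightarrow> real) \<Rightarrow> (real \<Rightarrow> 'w \<Rightarrow> real) \<Rightarrow> (real \<Rightarrow> 'w \<Rightarrow> real) \<Rightarrow> bool" where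
  "solves_additive_sde P b X Y \<longleftrightarrow>
     (\<forall>t\<in>{0..1}. Y t \<in> borel_measurable P) \<and>
     (AE \<omega> in P. (\<lambda>t\<in>{0..1}. Y t \<omega>) \<in> skorokhod_space \<and> Y 0 \<omega> = 0 \<and>
        (\<forall>t\<in>{0<..1}. Y t \<omega> = (LBINT s:{0..t}. b (Y s \<omega>)) + X t \<omega>))"

definition solution_map :: "(real \<Rightarrow> real) \<Rightarrow> (real \<Rightarrow> real) \<Rightarrow> real \<Rightarrow> real" where
  "solution_map b g =
     (THE f. f \<in> skorokhod_space \<and> (\<forall>t\<in>{0..1}. f t = (LBINT s:{0..t}. b (f s)) + g t))"

text \<open>Constancy on every interval \<open>[s,t]\<close> such that \<open>(s,t]\<close> avoids a fixed finite set of times.\<close>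

definition step_function :: "(real \<Rightarrow> real) \<Rightarrow> bool" where
  "step_function f \<longleftrightarrow> f \<in> skorokhod_space \<and>
     (\<exists>T. finite T \<and>
        (\<forall>s t. 0 \<le> s \<and> s \<le> t \<and> t \<le> 1 \<and> {s<..t} \<inter> T = {} \<longrightarrow> f s = f t))"

definition jump :: "(real \<Rightarrow> real) \<Rightarrow> real \<Rightarrow> real" where
  "jump f t = f t - Lim (at_left t) f"

text \<open>Counting measure rather than \<^const>\<open>card\<close>, so that an infinite set of jumps counts as
  \<open>\<infinity>\<close> and not as 0.\<close>

definition up_jumps :: "(real \<Rightarrow> real) \<Rightarrow> ennreal" where
  "up_jumps f = emeasure (count_space UNIV) {t \<in> {0<..1}. 0 < jump f t}"

definition down_jumps :: "(real \<Rightarrow> real) \<Rightarrow> ennreal" where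
  "down_jumps f = emeasure (count_space UNIV) {t \<in> {0<..1}. jump f t < 0}"

definition rate_function ::
  "real \<Rightarrow> real \<Rightarrow> (real \<Rightarrow> real) \<Rightarrow> (real \<Rightarrow> real) \<Rightarrow> ennreal" where
  "rate_function \<alpha> \<beta> b \<xi> =
     (if \<exists>\<eta>. step_function \<eta> \<and> \<eta> 0 = 0 \<and> \<xi> = solution_map b \<eta>
      then ennreal (\<alpha> - 1) * up_jumps \<xi> + ennreal (\<beta> - 1) * down_jumps \<xi>
      else \<infinity>)"

definition log_prob :: "real \<Rightarrow> ereal" where
  "log_prob p = (if p = 0 then - \<infinity> else ereal (ln p))"

end

theory Submission
  imports Defs "HOL-Real_Asymp.Real_Asymp"
begin

text \<open>
  The rate function charges at least \<open>min (\<alpha> - 1) (\<beta> - 1)\<close> for every jump and is infinite on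
  paths that are not driven by a step function. A small continuous perturbation therefore makes a
  path with a single jump very expensive, while Brownian noise supplies such perturbations for
  free. For a counterexample the perturbed paths have to form a closed set, although paths with a
  vanishing perturbation tend to converge to cheap ones. The way out is to let the perturbation
  vanish only while the end point of the path goes to infinity.

  The set is \<open>escape_set\<close>: for some \<open>k \<ge> k0\<close>, the path satisfies \<open>\<bar>x 1\<bar> \<ge> k\<close> and has \<open>n\<close>
  consecutive increments that exceed what the drift, bounded by \<open>C\<close>, can produce, by a margin
  \<open>r k\<close>. It is closed (\<open>closedin_escape_set\<close>), because a time change carries such increments over
  to a nearby path and because a ball meets only finitely many values of \<open>k\<close>. If a path in it is
  driven by a step function, each of the \<open>n\<close> increments needs a jump of its own (\<open>rough_jumps\<close>),
  so that the rate function is at least \<open>n * min (\<alpha> - 1) (\<beta> - 1)\<close> on the set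
  (\<open>escape_set_rate\<close>).

  The probability of the set is bounded below along \<open>\<epsilon> = 2\<^sup>-\<^sup>k\<close>. First, the end point of the noise
  has modulus at least \<open>k + C\<close> with probability at least \<open>2 \<epsilon>\<^sup>s\<close>, where \<open>s\<close> depends only on the Levy
  measure (\<open>endpoint_escapes\<close>): one big jump suffices, and a dichotomy on the remaining part of the
  noise makes it unnecessary to control that part (\<open>truncated_integral_lower_bound\<close>). Secondly, over
  a time step \<open>h\<close> the Brownian part is of order \<open>sqrt (\<epsilon> h)\<close>, the drift only of order \<open>h\<close>, and the
  independent jump part cannot concentrate the increment (\<open>increment_anticoncentration\<close>). Hence for
  \<open>h\<close> small enough, depending on \<open>k\<close>, all \<open>n\<close> increments are large except with probability
  \<open>\<epsilon>\<^sup>s\<close>, and \<open>r k = h\<close> is an admissible margin (\<open>rough_event\<close>). So the set has probability at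
  least \<open>\<epsilon>\<^sup>s\<close>, and the upper bound fails as soon as \<open>n * min (\<alpha> - 1) (\<beta> - 1) > s\<close>.
\<close>

section \<open>The integral equation\<close>

text \<open>A right-continuous function is the pointwise limit of its values at the next point
  of a grid strictly to the right, and such an approximation takes only countably many values.\<close>

lemma skorokhod_measurable:
  assumes "x \<in> skorokhod_space"
  shows "x \<in> borel_measurable (restrict_space borel {0..1})"
proof (rule borel_measurable_LIMSEQ_real)
  define q where "q n t = min 1 ((real_of_int \<lfloor>real (Suc n) * t\<rfloor> + 1) / real (Suc n))"
    for n :: nat and t :: real
  show "(\<lambda>t. x (q n t)) \<in> borel_measurable (restrict_space borel {0..1})" for n
  proof (rule measurable_restrict_space1)
    have "(\<lambda>t. \<lfloor>real (Suc n) * t\<rfloor>) \<in> borel \<rightarrow>\<^sub>M count_space UNIV"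
      by measurable
    then show "(\<lambda>t. x (q n t)) \<in> borel_measurable borel"
      unfolding q_def
      by (rule measurable_compose[where g = "\<lambda>i. x (min 1 ((real_of_int i + 1) / real (Suc n)))"]) simp
  qed
  fix t :: real assume "t \<in> space (restrict_space borel {0..1})"
  then have t: "0 \<le> t" "t \<le> 1" by (auto simp: space_restrict_space)
  show "(\<lambda>n. x (q n t)) \<longlonglongrightarrow> x t"
  proof (cases "t = 1")
    case True
    then have "q n t = 1" for n by (simp add: q_def field_simps)
    then show ?thesis using True by simp
  next
    case False
    then have t1: "t < 1" using t by simp
    have fl: "t < (real_of_int \<lfloor>real (Suc n) * t\<rfloor> + 1) / real (Suc n)" for n
    proof -
      have "real (Suc n) * t < real_of_int \<lfloor>real (Suc n) * t\<rfloor> + 1" by linarith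
      then show ?thesis by (simp add: field_simps)
    qed
    have gt: "t < q n t" for n
      using t1 fl[of n] by (simp add: q_def)
    have le: "q n t \<le> t + 1 / real (Suc n)" for n
    proof -
      have "real_of_int \<lfloor>real (Suc n) * t\<rfloor> + 1 \<le> real (Suc n) * t + 1" by linarith
      then have "(real_of_int \<lfloor>real (Suc n) * t\<rfloor> + 1) / real (Suc n) \<le> (real (Suc n) * t + 1) / real (Suc n)"
        by (rule divide_right_mono) simp
      also have "\<dots> = t + 1 / real (Suc n)"
        by (simp add: add_divide_distrib)
      finally have "(real_of_int \<lfloor>real (Suc n) * t\<rfloor> + 1) / real (Suc n) \<le> t + 1 / real (Suc n)" .
      then show ?thesis by (simp add: q_def)
    qed
    have lim: "(\<lambda>n. t + 1 / real (Suc n)) \<longlonglongrightarrow> t"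
      using tendsto_add[OF tendsto_const[of t] LIMSEQ_inverse_real_of_nat]
      by (simp add: inverse_eq_divide)
    have "(\<lambda>n. q n t) \<longlonglongrightarrow> t"
      by (rule real_tendsto_sandwich[OF _ _ tendsto_const lim])
         (use le gt in \<open>auto intro!: always_eventually less_imp_le simp del: of_nat_Suc\<close>)
    then have "filterlim (\<lambda>n. q n t) (at_right t) sequentially"
      unfolding filterlim_at using gt by (auto intro!: always_eventually simp: less_imp_neq[THEN not_sym])
    moreover have "(x \<longlongrightarrow> x t) (at_right t)"
      using assms t t1 by (auto simp: skorokhod_space_def)
    ultimately show ?thesis
      by (rule filterlim_compose[rotated])
  qed
qed

lemma set_integral_increment_bound:
  fixes \<phi> :: "real \<Rightarrow> real"
  assumes m: "\<phi> \<in> borel_measurable (restrict_space borel {0..1})"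
    and C: "\<And>s. s \<in> {0..1} \<Longrightarrow> \<bar>\<phi> s\<bar> \<le> C"
  shows set_integrable_bounded_unit: "t \<le> 1 \<Longrightarrow> 0 \<le> s \<Longrightarrow> set_integrable lborel {s..t} \<phi>"
    and "0 \<le> s \<Longrightarrow> s \<le> t \<Longrightarrow> t \<le> 1 \<Longrightarrow>
      \<bar>(LBINT u:{0..t}. \<phi> u) - (LBINT u:{0..s}. \<phi> u)\<bar> \<le> C * (t - s)"
proof -
  have int: "set_integrable lborel {s..t} \<phi>" if "t \<le> 1" "0 \<le> s" for s t
  proof -
    have "(\<lambda>u. indicator {0..1} u * \<phi> u) \<in> borel_measurable borel"
      using m by (subst (asm) borel_measurable_restrict_space_iff) (auto simp: mult.commute)
    then have "(\<lambda>u. indicator {s..t} u * (indicator {0..1} u * \<phi> u)) \<in> borel_measurable borel"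
      by measurable
    also have "(\<lambda>u. indicator {s..t} u * (indicator {0..1} u * \<phi> u)) = (\<lambda>u. indicator {s..t} u * \<phi> u)"
      using that by (auto simp: fun_eq_iff indicator_def)
    finally have "(\<lambda>u. indicator {s..t} u * \<phi> u) \<in> borel_measurable borel" .
    then show ?thesis
      unfolding set_integrable_def
      by (intro integrableI_bounded_set[where A = "{s..t}" and B = C])
         (use that C[of 0] C in \<open>auto simp: emeasure_lborel_Icc_eq split: split_indicator\<close>)
  qed
  then show "t \<le> 1 \<Longrightarrow> 0 \<le> s \<Longrightarrow> set_integrable lborel {s..t} \<phi>" .
  assume st: "0 \<le> s" "s \<le> t" "t \<le> 1"
  have int': "set_integrable lborel {s<..t} \<phi>"
    using st by (intro set_integrable_subset[OF int[of t s]]) auto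
  have "(LBINT u:{0..t}. \<phi> u) - (LBINT u:{0..s}. \<phi> u) = (LBINT u:{s<..t}. \<phi> u)"
  proof -
    have "{0..t} = {0..s} \<union> {s<..t}" using st by auto
    moreover have "set_integrable lborel {0..s} \<phi>" "set_integrable lborel {s<..t} \<phi>"
      using int[of s 0] int' st by auto
    ultimately show ?thesis
      by (subst \<open>{0..t} = _\<close>, subst set_integral_Un) auto
  qed
  also have "\<bar>\<dots>\<bar> \<le> C * (t - s)"
  proof -
    have "norm (LBINT u:{s<..t}. \<phi> u) \<le> C * measure lborel {s<..t}"
      unfolding set_lebesgue_integral_def
    proof (rule order_trans[OF integral_norm_bound])
      have "(LINT u|lborel. norm (indicator {s<..t} u *\<^sub>R \<phi> u)) \<le> (LINT u|lborel. C * indicator {s<..t} u)"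
      proof (rule integral_mono)
        show "integrable lborel (\<lambda>u. norm (indicator {s<..t} u *\<^sub>R \<phi> u))"
          using int' by (intro integrable_norm) (simp add: set_integrable_def)
        show "integrable lborel (\<lambda>u. C * indicator {s<..t} u)"
          using st by (intro integrable_mult_right integrable_real_indicator) auto
        show "norm (indicator {s<..t} u *\<^sub>R \<phi> u) \<le> C * indicator {s<..t} u" for u
          using C[of u] st by (auto simp: indicator_def)
      qed
      then show "(LINT u|lborel. norm (indicator {s<..t} u *\<^sub>R \<phi> u)) \<le> C * measure lborel {s<..t}"
        by simp
    qed
    then show ?thesis using st by simp
  qed
  finally show "\<bar>(LBINT u:{0..t}. \<phi> u) - (LBINT u:{0..s}. \<phi> u)\<bar> \<le> C * (t - s)" .
qed

lemma measurable_drift: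
  fixes b :: "real \<Rightarrow> real"
  assumes x: "x \<in> skorokhod_space" and b: "L-lipschitz_on UNIV b"
  shows "(\<lambda>s. b (x s)) \<in> borel_measurable (restrict_space borel {0..1})"
proof -
  have "b \<in> borel_measurable borel"
    by (intro borel_measurable_continuous_onI lipschitz_on_continuous_on[OF b])
  then show ?thesis
    using skorokhod_measurable[OF x] by (rule measurable_compose[rotated])
qed

definition clamp01 :: "real \<Rightarrow> real" where
  "clamp01 t = max 0 (min t 1)"

lemma clamp01_simps [simp]: "0 \<le> clamp01 t" "clamp01 t \<le> 1" "t \<in> {0..1} \<Longrightarrow> clamp01 t = t"
  by (auto simp: clamp01_def)

lemma continuous_clamped_integral:
  fixes \<phi> :: "real \<Rightarrow> real"
  assumes m: "\<phi> \<in> borel_measurable (restrict_space borel {0..1})"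
    and C: "\<And>s. s \<in> {0..1} \<Longrightarrow> \<bar>\<phi> s\<bar> \<le> C"
  shows "continuous_on UNIV (\<lambda>t. LBINT u:{0..clamp01 t}. \<phi> u)"
proof -
  have C0: "0 \<le> C" using C[of 0] by simp
  have *: "\<bar>(LBINT u:{0..clamp01 t}. \<phi> u) - (LBINT u:{0..clamp01 s}. \<phi> u)\<bar> \<le> C * (t - s)" if "s \<le> t" for s t
  proof -
    have "\<bar>(LBINT u:{0..clamp01 t}. \<phi> u) - (LBINT u:{0..clamp01 s}. \<phi> u)\<bar> \<le> C * (clamp01 t - clamp01 s)"
      using that by (intro set_integral_increment_bound(2)[OF m C]) (auto simp: clamp01_def)
    also have "\<dots> \<le> C * (t - s)"
      using that by (intro mult_left_mono C0) (auto simp: clamp01_def)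
    finally show ?thesis .
  qed
  have "C-lipschitz_on UNIV (\<lambda>t. LBINT u:{0..clamp01 t}. \<phi> u)"
  proof (rule lipschitz_onI[OF _ C0])
    fix s t :: real
    show "dist (LBINT u:{0..clamp01 s}. \<phi> u) (LBINT u:{0..clamp01 t}. \<phi> u) \<le> C * dist s t"
      using *[of s t] *[of t s] by (cases "s \<le> t") (auto simp: dist_real_def)
  qed
  then show ?thesis by (rule lipschitz_on_continuous_on)
qed

lemma integral_exp_bound:
  fixes l t :: real
  assumes "0 < l" "0 \<le> t"
  shows "(LBINT s:{0..t}. exp (l * s)) \<le> exp (l * t) / l"
    and "set_integrable lborel {0..t} (\<lambda>s. exp (l * s))"
proof -
  have "(LINT s|lborel. indicator {0..t} s *\<^sub>R exp (l * s)) = exp (l * t) / l - exp (l * 0) / l"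
    by (rule integral_FTC_atLeastAtMost[of 0 t])
       (use assms in \<open>auto intro!: derivative_eq_intros continuous_intros simp: has_real_derivative_iff_has_vector_derivative[symmetric]\<close>)
  then show "(LBINT s:{0..t}. exp (l * s)) \<le> exp (l * t) / l"
    using assms by (simp add: set_lebesgue_integral_def)
  show "set_integrable lborel {0..t} (\<lambda>s. exp (l * s))"
    by (intro borel_integrable_atLeastAtMost' continuous_intros)
qed

text \<open>With the weight \<open>exp (- 2 L t)\<close> the Picard map halves distances on the whole unit
  interval, so that one application of Banach's theorem gives a global solution.\<close>

lemma weighted_contraction:
  fixes b :: "real \<Rightarrow> real"
  assumes L: "0 < L" "L-lipschitz_on UNIV b" and C: "\<And>y. \<bar>b y\<bar> \<le> C"
    and f: "f \<in> borel_measurable (restrict_space borel {0..1})"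
    and h: "h \<in> borel_measurable (restrict_space borel {0..1})"
    and d: "\<And>s. s \<in> {0..1} \<Longrightarrow> \<bar>f s - h s\<bar> \<le> exp (2 * L * s) * d"
    and t: "t \<in> {0..1}"
  shows "\<bar>exp (- (2 * L * t)) * (LBINT s:{0..t}. b (f s)) - exp (- (2 * L * t)) * (LBINT s:{0..t}. b (h s))\<bar> \<le> d / 2"
proof -
  have bm: "b \<in> borel_measurable borel"
    by (intro borel_measurable_continuous_onI lipschitz_on_continuous_on[OF L(2)])
  have d0: "0 \<le> d" using d[of 0] by simp
  have int: "set_integrable lborel {0..t} (\<lambda>s. b (f s))" "set_integrable lborel {0..t} (\<lambda>s. b (h s))"
    using t C by (auto intro!: set_integrable_bounded_unit measurable_compose[OF f bm] measurable_compose[OF h bm])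
  have "\<bar>(LBINT s:{0..t}. b (f s)) - (LBINT s:{0..t}. b (h s))\<bar> = norm (LBINT s:{0..t}. b (f s) - b (h s))"
    using int by (simp add: set_integral_diff)
  also have "\<dots> \<le> (LBINT s:{0..t}. norm (b (f s) - b (h s)))"
    by (rule set_integral_norm_bound) (rule set_integral_diff(1)[OF int])
  also have "\<dots> \<le> (LBINT s:{0..t}. L * d * exp (2 * L * s))"
  proof (rule set_integral_mono)
    show "set_integrable lborel {0..t} (\<lambda>s. norm (b (f s) - b (h s)))"
      by (rule set_integrable_norm) (rule set_integral_diff(1)[OF int])
    show "set_integrable lborel {0..t} (\<lambda>s. L * d * exp (2 * L * s))"
      using L t by (intro set_integrable_mult_right integral_exp_bound(2)) auto
    fix s assume s: "s \<in> {0..t}"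
    have "norm (b (f s) - b (h s)) \<le> L * \<bar>f s - h s\<bar>"
      using lipschitz_onD[OF L(2), of "f s" "h s"] by (simp add: dist_real_def)
    also have "\<dots> \<le> L * (exp (2 * L * s) * d)"
      using d[of s] s t L by (intro mult_left_mono) auto
    finally show "norm (b (f s) - b (h s)) \<le> L * d * exp (2 * L * s)"
      by (simp add: mult_ac)
  qed
  also have "\<dots> = L * d * (LBINT s:{0..t}. exp (2 * L * s))"
    by simp
  also have "\<dots> \<le> L * d * (exp (2 * L * t) / (2 * L))"
    using L t d0 integral_exp_bound(1)[of "2 * L" t] by (intro mult_left_mono) auto
  also have "\<dots> = exp (2 * L * t) * (d / 2)"
    using L by simp
  finally have "exp (- (2 * L * t)) * \<bar>(LBINT s:{0..t}. b (f s)) - (LBINT s:{0..t}. b (h s))\<bar>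
      \<le> exp (- (2 * L * t)) * (exp (2 * L * t) * (d / 2))"
    by (intro mult_left_mono) auto
  also have "\<dots> = d / 2"
    by (simp add: mult.assoc[symmetric] exp_add[symmetric])
  finally show ?thesis
    by (simp only: right_diff_distrib[symmetric] abs_mult abs_exp_cancel)
qed

text \<open>Subtracting the driver leaves a continuous unknown; its weighted version lives in the
  complete space of bounded continuous functions on the line, where times are clamped to the
  unit interval. Every solution yields a fixed point, hence uniqueness in the whole Skorokhod
  space.\<close>

lemma additive_equation_ex1:
  fixes b :: "real \<Rightarrow> real"
  assumes b: "\<exists>L. L-lipschitz_on UNIV b" "bounded (range b)" and g: "g \<in> skorokhod_space"
  shows "\<exists>!f. f \<in> skorokhod_space \<and> (\<forall>t\<in>{0..1}. f t = (LBINT s:{0..t}. b (f s)) + g t)"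
proof -
  obtain L0 where L0: "L0-lipschitz_on UNIV b" using b by auto
  define L where "L = max L0 1"
  have L: "0 < L" "L-lipschitz_on UNIV b"
    using L0 by (auto simp: L_def intro: lipschitz_on_mono)
  have bm: "b \<in> borel_measurable borel"
    by (intro borel_measurable_continuous_onI lipschitz_on_continuous_on[OF L(2)])
  obtain C where C: "\<And>y. \<bar>b y\<bar> \<le> C"
    using b(2) unfolding bounded_iff by auto
  define U where "U f t = exp (- (2 * L * clamp01 t)) * (LBINT s:{0..clamp01 t}. b (f s))"
    for f and t :: real
  note gm = skorokhod_measurable[OF g]
  have U_mem: "U f \<in> bcontfun" if f: "f \<in> borel_measurable (restrict_space borel {0..1})" for f
  proof (rule bcontfun_normI)
    note fm = measurable_compose[OF f bm]
    have "continuous_on UNIV clamp01"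
      unfolding clamp01_def by (intro continuous_intros)
    then show "continuous_on UNIV (U f)"
      unfolding U_def using C
      by (intro continuous_intros continuous_clamped_integral[OF fm]) auto
    fix t :: real
    have "\<bar>(LBINT s:{0..clamp01 t}. b (f s)) - (LBINT s:{0..0}. b (f s))\<bar> \<le> C * (clamp01 t - 0)"
      using C by (intro set_integral_increment_bound(2)[OF fm]) auto
    moreover have "(LBINT s:{0..0::real}. b (f s)) = 0"
      unfolding set_lebesgue_integral_def
      by (rule integral_eq_zero_AE) (rule eventually_mono[OF AE_lborel_singleton[of 0]], simp)
    moreover have "C * clamp01 t \<le> C * 1"
      using C[of 0] by (intro mult_left_mono) auto
    ultimately have "\<bar>LBINT s:{0..clamp01 t}. b (f s)\<bar> \<le> C" by simp
    moreover have "exp (- (2 * L * clamp01 t)) \<le> 1" using L by simp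
    ultimately show "norm (U f t) \<le> C"
      unfolding U_def real_norm_def abs_mult abs_exp_cancel
      using mult_mono[of "exp (- (2 * L * clamp01 t))" 1 "\<bar>LBINT s:{0..clamp01 t}. b (f s)\<bar>" C] by simp
  qed
  define E where "E v s = exp (2 * L * s) * v s + g s" for v and s :: real
  have E_meas: "E (apply_bcontfun v) \<in> borel_measurable (restrict_space borel {0..1})" for v
  proof -
    have "apply_bcontfun v \<in> borel_measurable borel"
      by (intro borel_measurable_continuous_onI) simp
    then have "(\<lambda>s. exp (2 * L * s) * apply_bcontfun v s) \<in> borel_measurable (restrict_space borel {0..1})"
      by (intro measurable_restrict_space1) measurable
    with gm show ?thesis unfolding E_def by measurable
  qed
  define \<Phi> where "\<Phi> v = Bcontfun (U (E (apply_bcontfun v)))" for v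
  have \<Phi>: "apply_bcontfun (\<Phi> v) = U (E (apply_bcontfun v))" for v
    unfolding \<Phi>_def by (rule Bcontfun_inverse[OF U_mem[OF E_meas]])
  have "\<exists>!v. \<Phi> v = v"
  proof (rule banach_fix_type[of "1/2"]; (intro allI)?)
    fix v w :: "real \<Rightarrow>\<^sub>C real"
    show "dist (\<Phi> v) (\<Phi> w) \<le> 1/2 * dist v w"
    proof (rule dist_bound)
      fix t :: real
      have "\<bar>E v s - E w s\<bar> \<le> exp (2 * L * s) * dist v w" for s
        using mult_left_mono[OF dist_bounded[of v s w], of "exp (2 * L * s)"]
        by (simp add: E_def dist_real_def right_diff_distrib[symmetric] abs_mult)
      then show "dist (\<Phi> v t) (\<Phi> w t) \<le> 1/2 * dist v w"
        using weighted_contraction[OF L C E_meas E_meas, of v w "dist v w" "clamp01 t"]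
        by (simp add: \<Phi> U_def dist_real_def)
    qed
  qed auto
  then obtain v where v: "\<Phi> v = v" "\<And>w. \<Phi> w = w \<Longrightarrow> w = v" by auto
  define f where "f = restrict (E v) {0..1}"
  have v_eq: "apply_bcontfun v t = U (E v) t" for t
    using \<Phi>[of v] v(1) by simp
  show ?thesis
  proof (rule ex1I[of _ f])
    have *: "(LBINT s:{0..t}. b (f s)) = (LBINT s:{0..t}. b (E v s))" if "t \<in> {0..1}" for t
      using that by (intro set_lebesgue_integral_cong) (auto simp: f_def)
    have "f t = (LBINT s:{0..t}. b (f s)) + g t" if t: "t \<in> {0..1}" for t
      unfolding *[OF t] using t
      by (simp add: f_def) (subst E_def, simp add: v_eq U_def exp_minus)
    moreover have "f \<in> skorokhod_space"
      unfolding skorokhod_space_def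
    proof (intro CollectI conjI ballI)
      show "f \<in> extensional {0..1}" by (simp add: f_def)
    next
      fix t :: real assume t: "t \<in> {0..<1}"
      have "isCont v t" using continuous_on_eq_continuous_at[of UNIV] by auto
      then have "((\<lambda>s. exp (2 * L * s) * v s + g s) \<longlongrightarrow> exp (2 * L * t) * v t + g t) (at_right t)"
        using g t by (intro tendsto_intros) (auto simp: skorokhod_space_def isCont_def intro: filterlim_at_split[THEN iffD1, THEN conjunct2])
      moreover have "eventually (\<lambda>s. exp (2 * L * s) * v s + g s = f s) (at_right t)"
        using eventually_at_right_real[of t 1] t
        by (auto elim!: eventually_mono simp: f_def E_def)
      ultimately show "(f \<longlongrightarrow> f t) (at_right t)"
        using t by (auto simp: f_def E_def elim!: Lim_transform_eventually)
    next
      fix t :: real assume t: "t \<in> {0<..1}"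
      then obtain l where l: "(g \<longlongrightarrow> l) (at_left t)" using g unfolding skorokhod_space_def by blast
      have "isCont v t" using continuous_on_eq_continuous_at[of UNIV] by auto
      then have "((\<lambda>s. exp (2 * L * s) * v s + g s) \<longlongrightarrow> exp (2 * L * t) * v t + l) (at_left t)"
        using l by (intro tendsto_intros) (auto simp: isCont_def intro: filterlim_at_split[THEN iffD1, THEN conjunct1])
      moreover have "eventually (\<lambda>s. exp (2 * L * s) * v s + g s = f s) (at_left t)"
        using eventually_at_left_real[of 0 t] t
        by (auto elim!: eventually_mono simp: f_def E_def)
      ultimately show "\<exists>l. (f \<longlongrightarrow> l) (at_left t)"
        by (auto elim!: Lim_transform_eventually)
    qed
    ultimately show "f \<in> skorokhod_space \<and> (\<forall>t\<in>{0..1}. f t = (LBINT s:{0..t}. b (f s)) + g t)"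
      by auto
  next
    fix f' assume f': "f' \<in> skorokhod_space \<and> (\<forall>t\<in>{0..1}. f' t = (LBINT s:{0..t}. b (f' s)) + g t)"
    have f'm: "f' \<in> borel_measurable (restrict_space borel {0..1})"
      using f' skorokhod_measurable by auto
    define w where "w = Bcontfun (U f')"
    have w: "apply_bcontfun w = U f'"
      unfolding w_def by (rule Bcontfun_inverse[OF U_mem[OF f'm]])
    have Ew: "E w s = f' s" if "s \<in> {0..1}" for s
      using f' that by (simp add: E_def w U_def exp_minus)
    have "\<Phi> w = w"
    proof (rule bcontfun_eqI)
      fix t
      have "(LBINT s:{0..clamp01 t}. b (E w s)) = (LBINT s:{0..clamp01 t}. b (f' s))"
        using Ew order_trans[OF _ clamp01_simps(2)[of t]] by (intro set_lebesgue_integral_cong) auto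
      then show "apply_bcontfun (\<Phi> w) t = apply_bcontfun w t"
        by (simp add: \<Phi> U_def) (simp add: w U_def)
    qed
    then have "w = v" by (rule v(2))
    then have "f' t = f t" if "t \<in> {0..1}" for t
      using Ew[OF that] that by (simp add: f_def)
    then show "f' = f"
      using f' by (intro extensionalityI[where A = "{0..1}"]) (auto simp: skorokhod_space_def f_def)
  qed
qed

lemma solution_map_solves:
  fixes b :: "real \<Rightarrow> real"
  assumes "\<exists>L. L-lipschitz_on UNIV b" "bounded (range b)" "g \<in> skorokhod_space"
  shows "solution_map b g \<in> skorokhod_space"
    and "t \<in> {0..1} \<Longrightarrow> solution_map b g t = (LBINT s:{0..t}. b (solution_map b g s)) + g t"
  using theI'[OF additive_equation_ex1[OF assms]] unfolding solution_map_def by blast+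

section \<open>Jumps of a path that is driven by a step function\<close>

lemma skorokhod_continuous_on:
  assumes x: "x \<in> skorokhod_space" and st: "0 \<le> s" "s < t" "t \<le> 1"
    and j: "\<And>u. u \<in> {s<..t} \<Longrightarrow> jump x u = 0"
  shows "continuous_on {s..t} x"
proof -
  have right: "(x \<longlongrightarrow> x u) (at_right u)" if "s \<le> u" "u < t" for u
    using x that st by (auto simp: skorokhod_space_def)
  have left: "(x \<longlongrightarrow> x u) (at_left u)" if u: "s < u" "u \<le> t" for u
  proof -
    have "u \<in> {0<..1}" using u st by auto
    then obtain l where l: "(x \<longlongrightarrow> l) (at_left u)"
      using x unfolding skorokhod_space_def by blast
    have "at_left u \<noteq> bot" by (rule trivial_limit_at_left_real)
    with l have "Lim (at_left u) x = l" by (intro tendsto_Lim)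
    with j[of u] l u show ?thesis by (simp add: jump_def)
  qed
  show ?thesis
    unfolding continuous_on_def
  proof
    fix u assume u: "u \<in> {s..t}"
    consider "u = s" | "u = t" | "s < u" "u < t" using u by force
    then show "(x \<longlongrightarrow> x u) (at u within {s..t})"
    proof cases
      case 1
      then show ?thesis using right[of u] st by (simp add: at_within_Icc_at_right)
    next
      case 2
      then show ?thesis using left[of u] st by (simp add: at_within_Icc_at_left)
    next
      case 3
      then have "(x \<longlongrightarrow> x u) (at u)"
        using left[of u] right[of u] by (auto simp: filterlim_at_split)
      then show ?thesis by (rule tendsto_within_subset) auto
    qed
  qed
qed

text \<open>Each value is already taken at the left end point or at the last exceptional time before it.\<close>

lemma step_function_finite_range:
  assumes "step_function \<eta>" "0 \<le> s" "t \<le> 1"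
  shows "finite (\<eta> ` {s..t})"
proof -
  obtain T where T: "finite T"
    "\<And>s t. 0 \<le> s \<Longrightarrow> s \<le> t \<Longrightarrow> t \<le> 1 \<Longrightarrow> {s<..t} \<inter> T = {} \<Longrightarrow> \<eta> s = \<eta> t"
    using assms(1) unfolding step_function_def by blast
  have "\<eta> u \<in> \<eta> ` insert s T" if u: "u \<in> {s..t}" for u
  proof -
    define p where "p = Max (insert s {\<tau>\<in>T. s \<le> \<tau> \<and> \<tau> \<le> u})"
    have fin: "finite (insert s {\<tau>\<in>T. s \<le> \<tau> \<and> \<tau> \<le> u})" using T(1) by simp
    have p_in: "p \<in> insert s {\<tau>\<in>T. s \<le> \<tau> \<and> \<tau> \<le> u}"
      unfolding p_def by (rule Max_in[OF fin]) simp
    have p_max: "\<tau> \<le> p" if "\<tau> \<in> T" "s \<le> \<tau>" "\<tau> \<le> u" for \<tau>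
      unfolding p_def by (rule Max_ge[OF fin]) (use that in simp)
    have "s \<le> p" "p \<le> u" using p_in u by auto
    moreover have "{p<..u} \<inter> T = {}"
      using p_max \<open>s \<le> p\<close> by force
    ultimately have "\<eta> p = \<eta> u"
      using T(2)[of p u] assms u by auto
    with p_in show ?thesis by (metis (no_types, lifting) image_eqI insert_iff mem_Collect_eq)
  qed
  then have "\<eta> ` {s..t} \<subseteq> \<eta> ` insert s T" by blast
  then show ?thesis by (rule finite_subset) (use T(1) in simp)
qed

text \<open>The drift part is continuous, so a stretch without jumps of \<open>\<xi>\<close> is a stretch on which the
  step function \<open>\<eta>\<close> is continuous. A continuous function with finitely many values is constant
  on an interval, and then \<open>\<xi>\<close> moves by the drift alone.\<close>

lemma no_jump_increment:
  fixes b :: "real \<Rightarrow> real"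
  assumes b: "L-lipschitz_on UNIV b" "\<And>y. \<bar>b y\<bar> \<le> C"
    and \<xi>: "\<xi> \<in> skorokhod_space" and \<eta>: "step_function \<eta>"
    and eq: "\<And>t. t \<in> {0..1} \<Longrightarrow> \<xi> t = (LBINT s:{0..t}. b (\<xi> s)) + \<eta> t"
    and st: "0 \<le> s" "s < t" "t \<le> 1"
    and j: "\<And>u. u \<in> {s<..t} \<Longrightarrow> jump \<xi> u = 0"
  shows "\<bar>\<xi> t - \<xi> s\<bar> \<le> C * (t - s)"
proof -
  note m = measurable_drift[OF \<xi> b(1)]
  have "continuous_on {s..t} (\<lambda>u. \<xi> u - (LBINT v:{0..clamp01 u}. b (\<xi> v)))"
    using b(2) by (intro continuous_intros skorokhod_continuous_on[OF \<xi> st j]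
      continuous_on_subset[OF continuous_clamped_integral[OF m]]) auto
  moreover have "continuous_on {s..t} (\<lambda>u. \<xi> u - (LBINT v:{0..clamp01 u}. b (\<xi> v))) \<longleftrightarrow>
      continuous_on {s..t} \<eta>"
    by (rule continuous_on_cong[OF refl]) (use eq st in simp)
  ultimately have "continuous_on {s..t} \<eta>" by simp
  then have "\<eta> constant_on {s..t}"
    using step_function_finite_range[OF \<eta>, of s t] st
    by (intro continuous_finite_range_constant) auto
  then have "\<eta> t = \<eta> s" using st by (auto simp: constant_on_def)
  then have "\<xi> t - \<xi> s = (LBINT u:{0..t}. b (\<xi> u)) - (LBINT u:{0..s}. b (\<xi> u))"
    using eq[of t] eq[of s] st by simp
  also have "\<bar>\<dots>\<bar> \<le> C * (t - s)"
    using st b(2) by (intro set_integral_increment_bound(2)[OF m]) auto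
  finally show ?thesis .
qed

section \<open>Rough paths with a distant end point\<close>

text \<open>The slope \<open>C\<close> is meant to be a bound of the drift: a path with this drift cannot make
  such an increment by drifting, and the excess is at least \<open>\<rho>\<close>.\<close>

definition steep_chain :: "nat \<Rightarrow> real \<Rightarrow> real \<Rightarrow> (real \<Rightarrow> real) \<Rightarrow> (nat \<Rightarrow> real) \<Rightarrow> bool" where
  "steep_chain n C \<rho> x u \<longleftrightarrow>
     (\<forall>i<n. u i < u (Suc i) \<and> \<rho> + C * (u (Suc i) - u i) < \<bar>x (u (Suc i)) - x (u i)\<bar>)"

text \<open>The slack \<open>e\<close> turns a condition of the kind ``the best excess of a chain is at least
  \<open>r\<close>'' into one that involves no attained supremum. It absorbs the error of a time change, which
  is what makes the condition pass to Skorokhod limits.\<close>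

definition rough :: "nat \<Rightarrow> real \<Rightarrow> real \<Rightarrow> (real \<Rightarrow> real) \<Rightarrow> bool" where
  "rough n C r x \<longleftrightarrow> (\<forall>e>0. \<exists>u. u \<in> {..n} \<rightarrow> {0..1} \<and> steep_chain n C (r - e) x u)"

text \<open>The scale \<open>r k\<close> may tend to \<open>0\<close> as \<open>k\<close> grows; then the end point tends to infinity,
  so that no path is a limit of members with vanishing scales.\<close>

definition escape_set :: "nat \<Rightarrow> real \<Rightarrow> nat \<Rightarrow> (nat \<Rightarrow> real) \<Rightarrow> (real \<Rightarrow> real) set" where
  "escape_set n C k0 r =
     (\<Union>k\<in>{k0..}. {x \<in> skorokhod_space. real k \<le> \<bar>x 1\<bar> \<and> rough n C (r k) x})"

text \<open>Each interval of a chain with positive excess must contain a jump, and the intervals are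
  disjoint.\<close>

lemma rough_jumps:
  fixes b :: "real \<Rightarrow> real"
  assumes b: "L-lipschitz_on UNIV b" "\<And>y. \<bar>b y\<bar> \<le> C"
    and \<xi>: "\<xi> \<in> skorokhod_space" and \<eta>: "step_function \<eta>"
    and eq: "\<And>t. t \<in> {0..1} \<Longrightarrow> \<xi> t = (LBINT s:{0..t}. b (\<xi> s)) + \<eta> t"
    and r: "rough n C r \<xi>" "0 < r"
  shows "of_nat n \<le> up_jumps \<xi> + down_jumps \<xi>"
proof -
  obtain u where u: "u \<in> {..n} \<rightarrow> {0..1}" and ch: "steep_chain n C (r - r) \<xi> u"
    using r unfolding rough_def by blast
  have "\<exists>w\<in>{u i<..u (Suc i)}. jump \<xi> w \<noteq> 0" if i: "i < n" for i
  proof (rule ccontr)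
    assume "\<not> ?thesis"
    moreover have "u i \<in> {0..1}" "u (Suc i) \<in> {0..1}" "u i < u (Suc i)"
      using u ch i by (auto simp: steep_chain_def Pi_iff)
    ultimately have "\<bar>\<xi> (u (Suc i)) - \<xi> (u i)\<bar> \<le> C * (u (Suc i) - u i)"
      by (intro no_jump_increment[OF b \<xi> \<eta> eq]) auto
    with ch i show False by (auto simp: steep_chain_def)
  qed
  then obtain w where w: "\<And>i. i < n \<Longrightarrow> w i \<in> {u i<..u (Suc i)} \<and> jump \<xi> (w i) \<noteq> 0"
    by metis
  have mono: "u i \<le> u j" if "i \<le> j" "j \<le> n" for i j
    using that
  proof (induction j rule: dec_induct)
    case (step j)
    then have "u j < u (Suc j)" using ch by (simp add: steep_chain_def)
    with step show ?case by simp
  qed simp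
  have less: "w i < w j" if "i < j" "j < n" for i j
    using w[of i] w[of j] mono[of "Suc i" j] that by auto
  have inj: "inj_on w {..<n}"
    by (rule inj_onI) (metis less lessThan_iff less_irrefl linorder_neqE_nat)
  define U where "U = {t \<in> {0<..1}. 0 < jump \<xi> t}"
  define D where "D = {t \<in> {0<..1}. jump \<xi> t < 0}"
  have sub: "w ` {..<n} \<subseteq> U \<union> D"
  proof
    fix t assume "t \<in> w ` {..<n}"
    then obtain i where i: "i < n" "t = w i" by auto
    have "u i \<in> {0..1}" "u (Suc i) \<in> {0..1}" using u i by auto
    with w[OF i(1)] i show "t \<in> U \<union> D"
      by (auto simp: U_def D_def)
  qed
  \<comment> \<open>Distinct intervals give distinct jump times, so that counting the jumps loses nothing.\<close>
  have "of_nat n = emeasure (count_space UNIV) (w ` {..<n})"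
    using inj by (simp add: emeasure_count_space_finite card_image)
  also have "\<dots> \<le> emeasure (count_space UNIV) (U \<union> D)"
    using sub by (intro emeasure_mono) auto
  also have "\<dots> \<le> emeasure (count_space UNIV) U + emeasure (count_space UNIV) D"
    by (intro emeasure_subadditive) auto
  finally show ?thesis by (simp add: up_jumps_def down_jumps_def U_def D_def)
qed

lemma escape_set_rate:
  fixes b :: "real \<Rightarrow> real"
  assumes b: "\<exists>L. L-lipschitz_on UNIV b" "\<And>y. \<bar>b y\<bar> \<le> C"
    and r: "\<And>k. 0 < r k" and c: "0 \<le> c" "c \<le> \<alpha> - 1" "c \<le> \<beta> - 1"
    and x: "x \<in> escape_set n C k0 r"
  shows "ennreal (c * real n) \<le> rate_function \<alpha> \<beta> b x"
proof (cases "\<exists>\<eta>. step_function \<eta> \<and> \<eta> 0 = 0 \<and> x = solution_map b \<eta>")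
  case True
  then obtain \<eta> where \<eta>: "step_function \<eta>" "x = solution_map b \<eta>" by auto
  obtain L where L: "L-lipschitz_on UNIV b" using b by auto
  have "bounded (range b)" using b(2) unfolding bounded_iff by auto
  note sol = solution_map_solves[OF b(1) this, of \<eta>]
  have \<eta>s: "\<eta> \<in> skorokhod_space" using \<eta>(1) by (simp add: step_function_def)
  obtain k where k: "rough n C (r k) x" using x by (auto simp: escape_set_def)
  have "of_nat n \<le> up_jumps x + down_jumps x"
    using sol[OF \<eta>s] k r by (intro rough_jumps[OF L b(2) _ \<eta>(1)]) (auto simp: \<eta>(2))
  then have "ennreal c * of_nat n \<le> ennreal c * (up_jumps x + down_jumps x)"
    by (intro mult_left_mono) auto
  also have "\<dots> \<le> ennreal (\<alpha> - 1) * up_jumps x + ennreal (\<beta> - 1) * down_jumps x"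
    unfolding distrib_left using c by (intro add_mono mult_right_mono ennreal_leI) auto
  also have "\<dots> = rate_function \<alpha> \<beta> b x" using True by (simp add: rate_function_def)
  finally show ?thesis using c
    by (simp add: ennreal_mult ennreal_of_nat_eq_real_of_nat)
qed (auto simp: rate_function_def)

lemma time_changes_fix_one:
  assumes "\<theta> \<in> time_changes"
  shows "\<theta> 1 = 1"
proof (rule ccontr)
  assume "\<theta> 1 \<noteq> 1"
  with time_changes_range[OF assms, of 1] have lt: "\<theta> 1 < 1" by auto
  obtain \<mu> where \<mu>: "\<mu> \<in> time_changes" "\<And>t. t \<in> {0..1} \<Longrightarrow> \<theta> (\<mu> t) = t"
    using time_changes_inverse[OF assms] by metis
  have m: "\<mu> 1 \<in> {0..1}" "\<theta> (\<mu> 1) = 1" using \<mu> time_changes_range[OF \<mu>(1)] by auto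
  moreover have "strict_mono_on {0..1} \<theta>" using assms by (simp add: time_changes_def)
  ultimately have "\<theta> (\<mu> 1) \<le> \<theta> 1"
    by (intro strict_mono_on_leD[of "{0..1}" \<theta>]) auto
  with m lt show False by simp
qed

text \<open>A time change maps a chain to a chain; it moves the times by less than \<open>\<rho>\<close> and the values
  by less than \<open>\<rho>\<close>, which costs at most \<open>2 C \<rho> + 2 \<rho>\<close> of excess.\<close>

lemma rough_limit:
  assumes C: "0 \<le> C" and x: "x \<in> skorokhod_space"
    and lim: "\<And>\<rho>. 0 < \<rho> \<Longrightarrow> \<exists>y\<in>skorokhod_space. skorokhod_dist x y < \<rho> \<and> a \<le> \<bar>y 1\<bar> \<and> rough n C r y"
  shows "a \<le> \<bar>x 1\<bar> \<and> rough n C r x"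
proof
  show "a \<le> \<bar>x 1\<bar>"
  proof (rule field_le_epsilon)
    fix \<rho> :: real assume "0 < \<rho>"
    then obtain y where y: "y \<in> skorokhod_space" "skorokhod_dist x y < \<rho>" "a \<le> \<bar>y 1\<bar>"
      using lim by blast
    obtain \<theta> where \<theta>: "\<theta> \<in> time_changes" "\<And>t. t \<in> {0..1} \<Longrightarrow> \<bar>x (\<theta> t) - y t\<bar> < \<rho>"
      using skorokhod_dist_lessE[OF x y(1,2)] by metis
    have "\<bar>x 1 - y 1\<bar> < \<rho>" using \<theta>(2)[of 1] time_changes_fix_one[OF \<theta>(1)] by simp
    with y(3) show "a \<le> \<bar>x 1\<bar> + \<rho>" by linarith
  qed
  show "rough n C r x"
    unfolding rough_def
  proof (intro allI impI)
    fix e :: real assume e: "0 < e"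
    define \<rho> where "\<rho> = e / (4 * (C + 1))"
    have "(C + 1) * \<rho> = e / 4" using C by (simp add: \<rho>_def add_nonneg_eq_0_iff divide_simps)
    then have \<rho>: "0 < \<rho>" "2 * C * \<rho> + 2 * \<rho> = e / 2"
      using e C by (simp add: \<rho>_def, simp add: algebra_simps)
    obtain y where y: "y \<in> skorokhod_space" "skorokhod_dist x y < \<rho>" "rough n C r y"
      using lim[OF \<rho>(1)] by blast
    obtain \<theta> where \<theta>: "\<theta> \<in> time_changes" "\<And>t. t \<in> {0..1} \<Longrightarrow> \<bar>\<theta> t - t\<bar> < \<rho>"
      "\<And>t. t \<in> {0..1} \<Longrightarrow> \<bar>x (\<theta> t) - y t\<bar> < \<rho>"
      using skorokhod_dist_lessE[OF x y(1,2)] by metis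
    have "0 < e / 2" using e by simp
    then obtain u where u: "u \<in> {..n} \<rightarrow> {0..1}" "steep_chain n C (r - e / 2) y u"
      using y(3) unfolding rough_def by blast
    have "steep_chain n C (r - e) x (\<theta> \<circ> u)"
      unfolding steep_chain_def o_def
    proof (intro allI impI conjI)
      fix i assume i: "i < n"
      have ui: "u i \<in> {0..1}" "u (Suc i) \<in> {0..1}" using u(1) i by auto
      have ch: "u i < u (Suc i)"
        "r - e / 2 + C * (u (Suc i) - u i) < \<bar>y (u (Suc i)) - y (u i)\<bar>"
        using u(2) i by (auto simp: steep_chain_def)
      show "\<theta> (u i) < \<theta> (u (Suc i))"
        using \<theta>(1) ui ch(1) by (auto simp: time_changes_def strict_mono_on_def)
      have "C * (\<theta> (u (Suc i)) - \<theta> (u i)) \<le> C * (u (Suc i) - u i + 2 * \<rho>)"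
        using \<theta>(2)[OF ui(1)] \<theta>(2)[OF ui(2)] by (intro mult_left_mono C) auto
      then have "r - e + C * (\<theta> (u (Suc i)) - \<theta> (u i)) \<le> r - e / 2 + C * (u (Suc i) - u i) - 2 * \<rho>"
        using \<rho>(2) by (simp add: algebra_simps)
      also have "\<dots> < \<bar>y (u (Suc i)) - y (u i)\<bar> - 2 * \<rho>" using ch(2) by simp
      also have "\<dots> \<le> \<bar>x (\<theta> (u (Suc i))) - x (\<theta> (u i))\<bar>"
        using \<theta>(3)[OF ui(1)] \<theta>(3)[OF ui(2)] by linarith
      finally show "r - e + C * (\<theta> (u (Suc i)) - \<theta> (u i)) < \<bar>x (\<theta> (u (Suc i))) - x (\<theta> (u i))\<bar>" .
    qed
    moreover have "\<theta> \<circ> u \<in> {..n} \<rightarrow> {0..1}"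
      using u(1) time_changes_range[OF \<theta>(1)] unfolding Pi_iff o_def by blast
    ultimately show "\<exists>u. u \<in> {..n} \<rightarrow> {0..1} \<and> steep_chain n C (r - e) x u" by blast
  qed
qed

text \<open>The members for a fixed \<open>k\<close> form a closed set, and since the end point is a continuous
  functional, a ball of radius \<open>1\<close> meets only finitely many of these sets.\<close>

lemma closedin_escape_set:
  assumes C: "0 \<le> C"
  shows "closedin skorokhod_topology (escape_set n C k0 r)"
proof -
  interpret Metric_space skorokhod_space skorokhod_dist by (rule Metric_space_skorokhod)
  define K where "K k = {x \<in> skorokhod_space. real k \<le> \<bar>x 1\<bar> \<and> rough n C (r k) x}" for k
  have K_eq: "escape_set n C k0 r = (\<Union>k\<in>{k0..}. K k)"
    by (simp add: escape_set_def K_def)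
  have clK: "closedin mtopology (K k)" for k
    unfolding closedin_metric
  proof (intro conjI allI impI)
    show "K k \<subseteq> skorokhod_space" by (auto simp: K_def)
    fix x assume x: "x \<in> skorokhod_space - K k"
    show "\<exists>\<rho>>0. disjnt (K k) (mball x \<rho>)"
    proof (rule ccontr)
      assume no: "\<not> ?thesis"
      have "real k \<le> \<bar>x 1\<bar> \<and> rough n C (r k) x"
      proof (rule rough_limit[OF C])
        fix \<rho> :: real assume "0 < \<rho>"
        with no have "\<not> disjnt (K k) (mball x \<rho>)" by auto
        then show "\<exists>y\<in>skorokhod_space. skorokhod_dist x y < \<rho> \<and> real k \<le> \<bar>y 1\<bar> \<and> rough n C (r k) y"
          by (auto simp: disjnt_iff K_def)
      qed (use x in auto)
      with x show False by (auto simp: K_def)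
    qed
  qed
  show ?thesis
    unfolding skorokhod_topology_def closedin_metric K_eq
  proof (intro conjI allI impI)
    show "(\<Union>k\<in>{k0..}. K k) \<subseteq> skorokhod_space" by (auto simp: K_def)
    fix x assume x: "x \<in> skorokhod_space - (\<Union>k\<in>{k0..}. K k)"
    define k1 where "k1 = nat \<lceil>\<bar>x 1\<bar> + 1\<rceil>"
    have "closedin mtopology (\<Union>k\<in>{k0..k1}. K k)"
      by (intro closedin_Union) (auto simp: clK)
    moreover have "x \<in> skorokhod_space - (\<Union>k\<in>{k0..k1}. K k)" using x by auto
    ultimately obtain \<rho> where \<rho>: "0 < \<rho>" "disjnt (\<Union>k\<in>{k0..k1}. K k) (mball x \<rho>)"
      unfolding closedin_metric by blast
    show "\<exists>\<rho>>0. disjnt (\<Union>k\<in>{k0..}. K k) (mball x \<rho>)"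
    proof (intro exI conjI)
      show "0 < min \<rho> 1" using \<rho> by simp
      have False if y: "y \<in> K k" "k0 \<le> k" "y \<in> mball x (min \<rho> 1)" for y k
      proof -
        have y': "x \<in> skorokhod_space" "y \<in> skorokhod_space" "skorokhod_dist x y < 1"
          using y(3) by auto
        obtain \<theta> where \<theta>: "\<theta> \<in> time_changes" "\<And>t. t \<in> {0..1} \<Longrightarrow> \<bar>x (\<theta> t) - y t\<bar> < 1"
          using skorokhod_dist_lessE[OF y'] by metis
        have "\<bar>x 1 - y 1\<bar> < 1" using \<theta>(2)[of 1] time_changes_fix_one[OF \<theta>(1)] by simp
        then have "real k \<le> \<bar>x 1\<bar> + 1" using y(1) by (auto simp: K_def)
        then have "k \<le> k1" unfolding k1_def by linarith
        with y \<rho>(2) show False by (auto simp: disjnt_iff)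
      qed
      then show "disjnt (\<Union>k\<in>{k0..}. K k) (mball x (min \<rho> 1))"
        by (auto simp: disjnt_iff)
    qed
  qed
qed

lemma rational_right_approx:
  assumes x: "x \<in> skorokhod_space" and t: "t \<in> {0..1}" and g: "0 < g"
  shows "\<exists>q\<in>\<rat> \<inter> {0..1}. t \<le> q \<and> q < t + g \<and> \<bar>x q - x t\<bar> < g"
proof (cases "t = 1")
  case True
  then show ?thesis using g by (intro bexI[of _ 1]) auto
next
  case False
  with t x have "(x \<longlongrightarrow> x t) (at_right t)" by (auto simp: skorokhod_space_def)
  then have "eventually (\<lambda>s. dist (x s) (x t) < g) (at_right t)" using g by (rule tendstoD)
  then obtain c where c: "c > t" "\<And>s. t < s \<Longrightarrow> s < c \<Longrightarrow> dist (x s) (x t) < g"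
    by (auto simp: eventually_at_right_field)
  have "t < Min {c, 1, t + g}" using c t False g by auto
  then obtain q where "q \<in> \<rat>" "t < q" "q < Min {c, 1, t + g}"
    using Rats_dense_in_real by blast
  then show ?thesis using c(2)[of q] t by (intro bexI[of _ q]) (auto simp: dist_real_def)
qed

text \<open>By right-continuity the times of a chain can be moved to rational times to their right,
  which leaves only countably many chains to consider.\<close>

lemma rough_rational:
  assumes x: "x \<in> skorokhod_space" and C: "0 \<le> C"
  shows "rough n C r x \<longleftrightarrow>
    (\<forall>l. \<exists>q \<in> {..n} \<rightarrow>\<^sub>E \<rat> \<inter> {0..1}. steep_chain n C (r - inverse (real (Suc l))) x q)"
proof
  assume R: "rough n C r x"
  show "\<forall>l. \<exists>q \<in> {..n} \<rightarrow>\<^sub>E \<rat> \<inter> {0..1}. steep_chain n C (r - inverse (real (Suc l))) x q"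
  proof
    fix l
    define e where "e = inverse (real (Suc l))"
    have e: "0 < e" "0 < e / 2" by (simp_all add: e_def)
    obtain u where u: "u \<in> {..n} \<rightarrow> {0..1}" "steep_chain n C (r - e / 2) x u"
      using R e(2) unfolding rough_def by blast
    \<comment> \<open>Moving each time by less than the smallest gap keeps the chain increasing; the other bound makes the loss of excess, \<open>C g + 2 g\<close>, at most \<open>e / 2\<close>.\<close>
    define g where "g = Min (insert (e / (2 * (C + 2))) ((\<lambda>i. u (Suc i) - u i) ` {..<n}))"
    have g0: "0 < g"
      using u(2) e C unfolding g_def by (subst Min_gr_iff) (auto simp: steep_chain_def)
    have g1: "g \<le> e / (2 * (C + 2))" unfolding g_def by (intro Min_le) auto
    have g2: "g \<le> u (Suc i) - u i" if "i < n" for i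
      unfolding g_def by (rule Min_le) (use that in auto)
    have g3: "C * g + 2 * g \<le> e / 2"
      using g1 C by (simp add: field_simps)
    have "\<exists>q\<in>\<rat> \<inter> {0..1}. u i \<le> q \<and> q < u i + g \<and> \<bar>x q - x (u i)\<bar> < g" if "i \<le> n" for i
      using u(1) that by (intro rational_right_approx[OF x _ g0]) auto
    then obtain q where q: "\<And>i. i \<le> n \<Longrightarrow> q i \<in> \<rat> \<inter> {0..1} \<and> u i \<le> q i \<and> q i < u i + g \<and> \<bar>x (q i) - x (u i)\<bar> < g"
      by metis
    have "steep_chain n C (r - e) x (restrict q {..n})"
      unfolding steep_chain_def
    proof (intro allI impI)
      fix i assume i: "i < n"
      have qi: "u i \<le> q i" "q i < u i + g" "\<bar>x (q i) - x (u i)\<bar> < g"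
        "u (Suc i) \<le> q (Suc i)" "q (Suc i) < u (Suc i) + g" "\<bar>x (q (Suc i)) - x (u (Suc i))\<bar> < g"
        using q[of i] q[of "Suc i"] i by auto
      have "q i < q (Suc i)" using qi g2[OF i] by linarith
      moreover have "r - e + C * (q (Suc i) - q i) < \<bar>x (q (Suc i)) - x (q i)\<bar>"
      proof -
        have "C * (q (Suc i) - q i) \<le> C * (u (Suc i) - u i + g)"
          using qi by (intro mult_left_mono C) auto
        then have "r - e + C * (q (Suc i) - q i) \<le> r - e / 2 + C * (u (Suc i) - u i) - 2 * g"
          using g3 by (simp add: algebra_simps)
        also have "\<dots> < \<bar>x (u (Suc i)) - x (u i)\<bar> - 2 * g"
          using u(2)[unfolded steep_chain_def, rule_format, OF i] by simp
        also have "\<dots> \<le> \<bar>x (q (Suc i)) - x (q i)\<bar>" using qi by linarith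
        finally show ?thesis .
      qed
      ultimately show "restrict q {..n} i < restrict q {..n} (Suc i) \<and>
          r - e + C * (restrict q {..n} (Suc i) - restrict q {..n} i)
          < \<bar>x (restrict q {..n} (Suc i)) - x (restrict q {..n} i)\<bar>"
        using i by simp
    qed
    then show "\<exists>q \<in> {..n} \<rightarrow>\<^sub>E \<rat> \<inter> {0..1}. steep_chain n C (r - inverse (real (Suc l))) x q"
      using q unfolding e_def by (intro bexI[of _ "restrict q {..n}"]) auto
  qed
next
  assume Q: "\<forall>l. \<exists>q \<in> {..n} \<rightarrow>\<^sub>E \<rat> \<inter> {0..1}. steep_chain n C (r - inverse (real (Suc l))) x q"
  show "rough n C r x"
    unfolding rough_def
  proof (intro allI impI)
    fix e :: real assume "0 < e"
    then obtain l where l: "inverse (real (Suc l)) < e" using reals_Archimedean by blast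
    obtain q where q: "q \<in> {..n} \<rightarrow>\<^sub>E \<rat> \<inter> {0..1}" "steep_chain n C (r - inverse (real (Suc l))) x q"
      using Q by blast
    have "steep_chain n C (r - e) x q" using q(2) l unfolding steep_chain_def by force
    with q(1) show "\<exists>u. u \<in> {..n} \<rightarrow> {0..1} \<and> steep_chain n C (r - e) x u"
      by (intro exI[of _ q]) auto
  qed
qed

text \<open>Without this, the event could have probability \<open>0\<close> by convention and would then satisfy
  every upper bound.\<close>

lemma escape_event_measurable:
  fixes Y :: "real \<Rightarrow> 'w \<Rightarrow> real"
  assumes "complete_measure P" and C: "0 \<le> C"
    and Y: "\<And>t. t \<in> {0..1} \<Longrightarrow> Y t \<in> borel_measurable P"
    and path: "AE \<omega> in P. (\<lambda>t\<in>{0..1}. Y t \<omega>) \<in> skorokhod_space"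
  shows "{\<omega> \<in> space P. (\<lambda>t\<in>{0..1}. Y t \<omega>) \<in> escape_set n C k0 r} \<in> sets P" (is "?E \<in> _")
proof -
  interpret complete_measure P by fact
  define Q where "Q = ({..n} \<rightarrow>\<^sub>E \<rat> \<inter> {0..1::real})"
  have countQ: "countable Q"
    unfolding Q_def by (rule countable_PiE) (simp_all add: countable_Int1 countable_rat)
  define A where "A k l q = (\<Inter>i\<in>{..<n}. {\<omega> \<in> space P. q i < q (Suc i) \<and>
     r k - inverse (real (Suc l)) + C * (q (Suc i) - q i) < \<bar>Y (q (Suc i)) \<omega> - Y (q i) \<omega>\<bar>}) \<inter> space P"
    for k l q
  define S where "S = (\<Union>k\<in>{k0..}. {\<omega> \<in> space P. real k \<le> \<bar>Y 1 \<omega>\<bar>} \<inter> (\<Inter>l. \<Union>q\<in>Q. A k l q))"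
  have A: "A k l q \<in> sets P" if q: "q \<in> Q" for k l q
  proof -
    have Yq: "Y (q i) \<in> borel_measurable P" if "i \<le> n" for i
      using q that by (intro Y) (auto simp: Q_def PiE_iff)
    have "{\<omega> \<in> space P. q i < q (Suc i) \<and>
       r k - inverse (real (Suc l)) + C * (q (Suc i) - q i) < \<bar>Y (q (Suc i)) \<omega> - Y (q i) \<omega>\<bar>} \<in> sets P"
      if "i < n" for i
    proof -
      have [measurable]: "Y (q i) \<in> borel_measurable P" "Y (q (Suc i)) \<in> borel_measurable P"
        using that by (auto intro: Yq)
      have "{\<omega> \<in> space P. r k - inverse (real (Suc l)) + C * (q (Suc i) - q i)
          < \<bar>Y (q (Suc i)) \<omega> - Y (q i) \<omega>\<bar>} \<in> sets P"
        by measurable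
      then show ?thesis by (cases "q i < q (Suc i)") auto
    qed
    note step = this
    show ?thesis
    proof (cases "n = 0")
      case True
      then show ?thesis by (simp add: A_def)
    next
      case False
      then show ?thesis
        unfolding A_def by (intro sets.Int sets.finite_INT sets.top step) auto
    qed
  qed
  have S: "S \<in> sets P"
  proof -
    have [measurable]: "Y 1 \<in> borel_measurable P" by (intro Y) auto
    have "(\<Union>q\<in>Q. A k l q) \<in> sets P" for k l
      using countQ A by (rule sets.countable_UN'') 
    then have "(\<Inter>l. \<Union>q\<in>Q. A k l q) \<in> sets P" for k
      by (intro sets.countable_INT) auto
    moreover have "{\<omega> \<in> space P. real k \<le> \<bar>Y 1 \<omega>\<bar>} \<in> sets P" for k
      by measurable
    ultimately show ?thesis
      unfolding S_def by (intro sets.countable_UN'' sets.Int) auto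
  qed
  obtain N where N: "{\<omega> \<in> space P. (\<lambda>t\<in>{0..1}. Y t \<omega>) \<notin> skorokhod_space} \<subseteq> N" "N \<in> null_sets P"
    using path by (auto simp: eventually_ae_filter)
  have eq: "\<omega> \<in> ?E \<longleftrightarrow> \<omega> \<in> S" if \<omega>: "\<omega> \<in> space P" "\<omega> \<notin> N" for \<omega>
  proof -
    define x where "x = (\<lambda>t\<in>{0..1}. Y t \<omega>)"
    have x: "x \<in> skorokhod_space" using \<omega> N(1) by (auto simp: x_def)
    have ch: "steep_chain n C (r k - inverse (real (Suc l))) x q \<longleftrightarrow> \<omega> \<in> A k l q" if "q \<in> Q" for k l q
    proof -
      have "x (q i) = Y (q i) \<omega>" if "i \<le> n" for i
        using \<open>q \<in> Q\<close> that by (auto simp: x_def Q_def PiE_iff)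
      then show ?thesis
        using \<omega>(1) by (auto simp: steep_chain_def A_def)
    qed
    have x1: "x 1 = Y 1 \<omega>" by (simp add: x_def)
    have "x \<in> escape_set n C k0 r \<longleftrightarrow>
        (\<exists>k\<ge>k0. real k \<le> \<bar>x 1\<bar> \<and> (\<forall>l. \<exists>q\<in>Q. steep_chain n C (r k - inverse (real (Suc l))) x q))"
      using x by (auto simp: escape_set_def rough_rational[OF x C] Q_def)
    also have "\<dots> \<longleftrightarrow> (\<exists>k\<ge>k0. real k \<le> \<bar>Y 1 \<omega>\<bar> \<and> (\<forall>l. \<exists>q\<in>Q. \<omega> \<in> A k l q))"
      by (simp only: ch x1 cong: bex_cong)
    also have "\<dots> \<longleftrightarrow> \<omega> \<in> S"
      using \<omega>(1) unfolding S_def by (simp add: Bex_def)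
    finally show ?thesis using \<omega>(1) by (simp add: x_def)
  qed
  have "?E = (S - N) \<union> (?E \<inter> N)"
    using eq sets.sets_into_space[OF S] by blast
  moreover have "?E \<inter> N \<in> sets P"
    by (rule complete[OF _ N(2)]) auto
  ultimately show ?thesis
    using S N(2) by (metis (no_types, lifting) null_setsD2 sets.Diff sets.Un)
qed

section \<open>Integrals against a random measure\<close>

text \<open>The \<open>\<sigma>\<close>-algebra \<open>G\<close> is kept general because the integrals are used both as random
  variables and as functions of the counts alone, which is what independence refers to.\<close>

lemma measurable_nn_integral_random_measure:
  fixes N :: "'w \<Rightarrow> 'a measure"
  assumes sets: "\<And>\<omega>. \<omega> \<in> space G \<Longrightarrow> sets (N \<omega>) = sets \<mu>"
    and count: "\<And>A. A \<in> sets \<mu> \<Longrightarrow> (\<lambda>\<omega>. emeasure (N \<omega>) A) \<in> borel_measurable G"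
    and f: "f \<in> borel_measurable \<mu>"
  shows "(\<lambda>\<omega>. \<integral>\<^sup>+p. f p \<partial>N \<omega>) \<in> borel_measurable G"
  using f
proof (induction rule: borel_measurable_induct)
  case (cong f g)
  have "(\<integral>\<^sup>+p. f p \<partial>N \<omega>) = (\<integral>\<^sup>+p. g p \<partial>N \<omega>)" if "\<omega> \<in> space G" for \<omega>
    using cong(3) sets_eq_imp_space_eq[OF sets[OF that]] by (intro nn_integral_cong) simp
  then show ?case using cong(4) by (simp cong: measurable_cong)
next
  case (set A)
  have "(\<integral>\<^sup>+p. indicator A p \<partial>N \<omega>) = emeasure (N \<omega>) A" if "\<omega> \<in> space G" for \<omega>
    using set sets[OF that] by (intro nn_integral_indicator) simp
  then show ?case using count[OF set] by (simp cong: measurable_cong)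
next
  case (mult f c)
  have "f \<in> borel_measurable (N \<omega>)" if "\<omega> \<in> space G" for \<omega>
    using mult(2) sets[OF that] by (simp cong: measurable_cong_sets)
  then have "(\<integral>\<^sup>+p. c * f p \<partial>N \<omega>) = c * (\<integral>\<^sup>+p. f p \<partial>N \<omega>)" if "\<omega> \<in> space G" for \<omega>
    using that by (intro nn_integral_cmult) simp
  then show ?case using mult(4) by (simp cong: measurable_cong)
next
  case (add f g)
  have "f \<in> borel_measurable (N \<omega>)" "g \<in> borel_measurable (N \<omega>)" if "\<omega> \<in> space G" for \<omega>
    using add.hyps sets[OF that] by (simp_all cong: measurable_cong_sets)
  then have "(\<integral>\<^sup>+p. g p + f p \<partial>N \<omega>) = (\<integral>\<^sup>+p. g p \<partial>N \<omega>) + (\<integral>\<^sup>+p. f p \<partial>N \<omega>)" if "\<omega> \<in> space G" for \<omega>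
    using that by (intro nn_integral_add) simp_all
  then show ?case using add.IH by (simp cong: measurable_cong)
next
  case (seq U)
  have "U i \<in> borel_measurable (N \<omega>)" if "\<omega> \<in> space G" for \<omega> i
    using seq(1) sets[OF that] by (simp cong: measurable_cong_sets)
  then have "(\<integral>\<^sup>+p. (SUP i. U i p) \<partial>N \<omega>) = (SUP i. \<integral>\<^sup>+p. U i p \<partial>N \<omega>)" if "\<omega> \<in> space G" for \<omega>
    using that seq.hyps by (intro nn_integral_monotone_convergence_SUP) simp_all
  moreover have "(\<lambda>\<omega>. SUP i. \<integral>\<^sup>+p. U i p \<partial>N \<omega>) \<in> borel_measurable G"
    using seq.IH by (intro borel_measurable_SUP) auto
  ultimately show ?case by (simp add: SUP_apply image_comp cong: measurable_cong)
qed

lemma measurable_lebesgue_integral_random_measure: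
  fixes N :: "'w \<Rightarrow> 'a measure" and f :: "'a \<Rightarrow> real"
  assumes sets: "\<And>\<omega>. \<omega> \<in> space G \<Longrightarrow> sets (N \<omega>) = sets \<mu>"
    and count: "\<And>A. A \<in> sets \<mu> \<Longrightarrow> (\<lambda>\<omega>. emeasure (N \<omega>) A) \<in> borel_measurable G"
    and f: "f \<in> borel_measurable \<mu>"
  shows "(\<lambda>\<omega>. LINT p|N \<omega>. f p) \<in> borel_measurable G"
proof -
  define u where "u \<omega> = (\<integral>\<^sup>+p. ennreal (f p) \<partial>N \<omega>)" for \<omega>
  define v where "v \<omega> = (\<integral>\<^sup>+p. ennreal (- f p) \<partial>N \<omega>)" for \<omega>
  have [measurable]: "u \<in> borel_measurable G" "v \<in> borel_measurable G"
    using f unfolding u_def v_def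
    by (auto intro!: measurable_nn_integral_random_measure[OF sets count])
  have "(LINT p|N \<omega>. f p) = (if u \<omega> \<noteq> \<infinity> \<and> v \<omega> \<noteq> \<infinity> then enn2real (u \<omega>) - enn2real (v \<omega>) else 0)"
    if "\<omega> \<in> space G" for \<omega>
  proof -
    have "f \<in> borel_measurable (N \<omega>)"
      using f sets[OF that] by (simp cong: measurable_cong_sets)
    then have "integrable (N \<omega>) f \<longleftrightarrow> u \<omega> \<noteq> \<infinity> \<and> v \<omega> \<noteq> \<infinity>"
      by (simp add: real_integrable_def u_def v_def)
    then show ?thesis
      using real_lebesgue_integral_def[of "N \<omega>" f] not_integrable_integral_eq[of "N \<omega>" f]
      by (auto simp: u_def v_def)
  qed
  moreover have "(\<lambda>\<omega>. if u \<omega> \<noteq> \<infinity> \<and> v \<omega> \<noteq> \<infinity> then enn2real (u \<omega>) - enn2real (v \<omega>) else 0)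
      \<in> borel_measurable G"
    by measurable
  ultimately show ?thesis by (simp cong: measurable_cong)
qed

lemma sets_jump_intensity:
  "sets \<nu> = sets borel \<Longrightarrow>
    sets (jump_intensity \<epsilon> \<nu>) = sets (restrict_space lborel {0..1} \<Otimes>\<^sub>M borel)"
  unfolding jump_intensity_def sets_scale_measure by (rule sets_pair_measure_cong) auto

lemma slab_measurable:
  assumes "sets \<nu> = sets borel" "t \<le> 1" "A \<in> sets borel"
  shows "{0<..t} \<times> A \<in> sets (jump_intensity \<epsilon> \<nu>)"
proof -
  have "{0<..t} \<in> sets (restrict_space lborel {0..1})"
    using assms(2) by (auto simp: sets_restrict_space_iff)
  then show ?thesis unfolding sets_jump_intensity[OF assms(1)] using assms(3) by auto
qed

lemma measurable_snd_jump_intensity: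
  "sets \<nu> = sets borel \<Longrightarrow> snd \<in> borel_measurable (jump_intensity \<epsilon> \<nu>)"
  using sets_jump_intensity measurable_snd by (simp cong: measurable_cong_sets)

lemma measurable_truncated_compensated_integral:
  assumes \<nu>: "sets \<nu> = sets borel" and t: "t \<le> 1"
    and sets: "\<And>\<omega>. \<omega> \<in> space G \<Longrightarrow> sets (n \<omega>) = sets (jump_intensity \<epsilon> \<nu>)"
    and count: "\<And>A. A \<in> sets (jump_intensity \<epsilon> \<nu>) \<Longrightarrow> (\<lambda>\<omega>. emeasure (n \<omega>) A) \<in> borel_measurable G"
  shows "(\<lambda>\<omega>. truncated_compensated_integral (jump_intensity \<epsilon> \<nu>) (n \<omega>) \<delta> t) \<in> borel_measurable G"
proof -
  have "{z::real. \<delta> < \<bar>z\<bar>} \<in> sets borel" by measurable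
  note A = slab_measurable[OF \<nu> t this]
  have "(\<lambda>p. indicator ({0<..t} \<times> {z. \<delta> < \<bar>z\<bar>}) p *\<^sub>R snd p) \<in> borel_measurable (jump_intensity \<epsilon> \<nu>)"
    using A measurable_snd_jump_intensity[OF \<nu>] by measurable
  then show ?thesis
    unfolding truncated_compensated_integral_def set_lebesgue_integral_def
    by (intro borel_measurable_diff borel_measurable_const
        measurable_lebesgue_integral_random_measure[OF sets count])
qed

section \<open>Independence and anti-concentration\<close>

context prob_space
begin

definition path_events :: "(real \<Rightarrow> 'a \<Rightarrow> real) \<Rightarrow> 'a measure" where
  "path_events B = vimage_algebra (space M) (\<lambda>\<omega>. \<lambda>t\<in>{0..1}. B t \<omega>) (\<Pi>\<^sub>M t\<in>{0..1}. borel)"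

definition count_events :: "'c measure \<Rightarrow> ('a \<Rightarrow> 'c measure) \<Rightarrow> 'a measure" where
  "count_events \<mu> N =
     vimage_algebra (space M) (\<lambda>\<omega>. \<lambda>A\<in>sets \<mu>. emeasure (N \<omega>) A) (\<Pi>\<^sub>M A\<in>sets \<mu>. borel)"

lemma space_events [simp]: "space (path_events B) = space M" "space (count_events \<mu> N) = space M"
  by (simp_all add: path_events_def count_events_def)

lemma measurable_path_events:
  assumes "t \<in> {0..1}"
  shows "B t \<in> borel_measurable (path_events B)"
proof -
  have "(\<lambda>\<omega>. (\<lambda>t\<in>{0..1}. B t \<omega>) t) \<in> borel_measurable (path_events B)"
    unfolding path_events_def
    by (rule measurable_compose[OF measurable_vimage_algebra1 measurable_component_singleton])
       (use assms in \<open>auto simp: space_PiM\<close>)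
  then show ?thesis using assms by simp
qed

lemma measurable_count_events:
  assumes "A \<in> sets \<mu>"
  shows "(\<lambda>\<omega>. emeasure (N \<omega>) A) \<in> borel_measurable (count_events \<mu> N)"
proof -
  have "(\<lambda>\<omega>. (\<lambda>A\<in>sets \<mu>. emeasure (N \<omega>) A) A) \<in> borel_measurable (count_events \<mu> N)"
    unfolding count_events_def
    by (rule measurable_compose[OF measurable_vimage_algebra1 measurable_component_singleton])
       (use assms in \<open>auto simp: space_PiM\<close>)
  then show ?thesis using assms by simp
qed

text \<open>The order of the pair puts the jump part first, so that the Gaussian variable is integrated
  out first when the joint law is computed.\<close>

lemma indep_path_count:
  fixes B :: "real \<Rightarrow> 'a \<Rightarrow> real" and N :: "'a \<Rightarrow> 'c measure"
  assumes ind: "process_indep_of_random_measure M \<mu> B N"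
    and U: "U \<in> borel_measurable (path_events B)" and V: "V \<in> borel_measurable (count_events \<mu> N)"
  shows "indep_var borel (V :: 'a \<Rightarrow> real) borel (U :: 'a \<Rightarrow> real)"
proof -
  have ind': "indep_set (sets (path_events B)) (sets (count_events \<mu> N))"
    using ind by (simp add: process_indep_of_random_measure_def path_events_def count_events_def)
  have U': "sigma_sets (space M) {U -` A \<inter> space M | A. A \<in> sets borel} \<subseteq> sets (path_events B)"
  proof -
    have "{U -` A \<inter> space M | A. A \<in> sets borel} \<subseteq> sets (path_events B)"
      using measurable_sets[OF U] by auto
    from sets.sigma_sets_subset[OF this] show ?thesis by simp
  qed
  have V': "sigma_sets (space M) {V -` A \<inter> space M | A. A \<in> sets borel} \<subseteq> sets (count_events \<mu> N)"
  proof -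
    have "{V -` A \<inter> space M | A. A \<in> sets borel} \<subseteq> sets (count_events \<mu> N)"
      using measurable_sets[OF V] by auto
    from sets.sigma_sets_subset[OF this] show ?thesis by simp
  qed
  have rv: "random_variable borel U" "random_variable borel V"
    using U V indep_setD_ev1[OF ind'] indep_setD_ev2[OF ind'] by (auto simp: measurable_def)
  show ?thesis
    unfolding indep_var_eq
  proof (intro conjI rv)
    show "indep_set (sigma_sets (space M) {V -` A \<inter> space M | A. A \<in> sets borel})
        (sigma_sets (space M) {U -` A \<inter> space M | A. A \<in> sets borel})"
    proof (rule indep_setI)
      show "sigma_sets (space M) {V -` A \<inter> space M | A. A \<in> sets borel} \<subseteq> events"
        using V' indep_setD_ev2[OF ind'] by auto
      show "sigma_sets (space M) {U -` A \<inter> space M | A. A \<in> sets borel} \<subseteq> events"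
        using U' indep_setD_ev1[OF ind'] by auto
      fix a b assume "a \<in> sigma_sets (space M) {V -` A \<inter> space M | A. A \<in> sets borel}"
        "b \<in> sigma_sets (space M) {U -` A \<inter> space M | A. A \<in> sets borel}"
      then show "prob (a \<inter> b) = prob a * prob b"
        using U' V' indep_setD[OF ind', of b a] by (auto simp: Int_commute mult.commute)
    qed
  qed
qed

text \<open>Conditionally on \<open>V\<close>, the sum has a density bounded by \<open>1 / (2 a \<sigma>)\<close>, whatever the
  law of \<open>V\<close> is.\<close>

lemma gaussian_anticoncentration:
  assumes ind: "indep_var borel V borel U"
    and U: "distributed M lborel U (\<lambda>x. ennreal (normal_density 0 \<sigma> x))"
    and \<sigma>: "0 < \<sigma>" and a: "0 < a" and \<kappa>: "0 \<le> \<kappa>"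
  shows "prob {\<omega> \<in> space M. \<bar>a * U \<omega> + V \<omega>\<bar> \<le> \<kappa>} \<le> \<kappa> / (a * \<sigma>)"
proof -
  have rv[measurable]: "random_variable borel U" "random_variable borel V"
    using indep_var_rv1[OF ind] indep_var_rv2[OF ind] by auto
  have joint: "distr M borel V \<Otimes>\<^sub>M distr M borel U = distr M (borel \<Otimes>\<^sub>M borel) (\<lambda>\<omega>. (V \<omega>, U \<omega>))"
    using ind by (simp add: indep_var_distribution_eq)
  define S where "S = {p :: real \<times> real. \<bar>a * snd p + fst p\<bar> \<le> \<kappa>}"
  have S: "S \<in> sets (borel \<Otimes>\<^sub>M borel)" 
  proof -
    have "S = {p \<in> space (borel \<Otimes>\<^sub>M borel). \<bar>a * snd p + fst p\<bar> \<le> \<kappa>}"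
      by (simp add: S_def space_pair_measure)
    also have "\<dots> \<in> sets (borel \<Otimes>\<^sub>M borel)" by measurable
    finally show ?thesis .
  qed
  interpret V: prob_space "distr M borel V" by (rule prob_space_distr) simp
  interpret U: prob_space "distr M borel U" by (rule prob_space_distr) simp
  have slice: "emeasure (distr M borel U) (Pair v -` S) \<le> ennreal (\<kappa> / (a * \<sigma>))" for v
  proof -
    have eq: "Pair v -` S = {(- \<kappa> - v) / a .. (\<kappa> - v) / a}"
      using a by (auto simp: S_def abs_le_iff field_simps)
    have "emeasure (distr M borel U) (Pair v -` S) = emeasure (distr M lborel U) (Pair v -` S)"
      by (metis (no_types) distr_cong sets_lborel)
    also have "\<dots> = (\<integral>\<^sup>+x. ennreal (normal_density 0 \<sigma> x) * indicator (Pair v -` S) x \<partial>lborel)"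
      unfolding distributed_distr_eq_density[OF U, symmetric]
      by (subst distributed_distr_eq_density[OF U], subst emeasure_density) (auto simp: eq)
    also have "\<dots> \<le> (\<integral>\<^sup>+x. ennreal (1 / (2 * \<sigma>)) * indicator (Pair v -` S) x \<partial>lborel)"
    proof (intro nn_integral_mono mult_right_mono ennreal_leI)
      fix x :: real
      have "2 * \<sigma> \<le> sqrt (2 * pi * \<sigma>\<^sup>2)"
      proof (rule real_le_rsqrt)
        have "4 * \<sigma>\<^sup>2 \<le> 2 * pi * \<sigma>\<^sup>2" using pi_ge_two by (intro mult_right_mono) auto
        then show "(2 * \<sigma>)\<^sup>2 \<le> 2 * pi * \<sigma>\<^sup>2" by (simp add: power_mult_distrib)
      qed
      then have "1 / sqrt (2 * pi * \<sigma>\<^sup>2) \<le> 1 / (2 * \<sigma>)"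
        using \<sigma> by (intro divide_left_mono) auto
      moreover have "exp (- (x - 0)\<^sup>2 / (2 * \<sigma>\<^sup>2)) \<le> 1" by simp
      ultimately show "normal_density 0 \<sigma> x \<le> 1 / (2 * \<sigma>)"
        unfolding normal_density_def using \<sigma>
        by (metis (no_types, opaque_lifting) exp_ge_zero mult.right_neutral mult_mono real_sqrt_ge_zero
            zero_le_divide_1_iff mult_nonneg_nonneg pi_ge_zero zero_le_numeral zero_le_power2 order_trans)
    qed auto
    also have "\<dots> = ennreal (1 / (2 * \<sigma>)) * emeasure lborel (Pair v -` S)"
      by (rule nn_integral_cmult_indicator) (auto simp: eq)
    also have "emeasure lborel (Pair v -` S) = ennreal (2 * \<kappa> / a)"
    proof -
      have "(- \<kappa> - v) / a \<le> (\<kappa> - v) / a" using a \<kappa> by (intro divide_right_mono) auto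
      then show ?thesis unfolding eq by (simp add: diff_divide_distrib)
    qed
    also have "ennreal (1 / (2 * \<sigma>)) * ennreal (2 * \<kappa> / a) = ennreal (\<kappa> / (a * \<sigma>))"
      using \<sigma> a \<kappa> by (simp add: ennreal_mult[symmetric] mult.commute)
    finally show ?thesis .
  qed
  have "ennreal (prob {\<omega> \<in> space M. \<bar>a * U \<omega> + V \<omega>\<bar> \<le> \<kappa>}) =
      emeasure (distr M (borel \<Otimes>\<^sub>M borel) (\<lambda>\<omega>. (V \<omega>, U \<omega>))) S"
    using S by (subst emeasure_distr) (auto simp: emeasure_eq_measure S_def intro!: arg_cong[where f = prob])
  also have "\<dots> = (\<integral>\<^sup>+v. emeasure (distr M borel U) (Pair v -` S) \<partial>distr M borel V)"
    unfolding joint[symmetric] using S by (intro U.emeasure_pair_measure_alt) simp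
  also have "\<dots> \<le> (\<integral>\<^sup>+v. ennreal (\<kappa> / (a * \<sigma>)) \<partial>distr M borel V)"
    by (intro nn_integral_mono slice)
  also have "\<dots> = ennreal (\<kappa> / (a * \<sigma>))"
    using V.emeasure_space_1 by simp
  finally show ?thesis using a \<sigma> \<kappa> by (subst (asm) ennreal_le_iff) auto
qed

end

section \<open>The jump intensity and its cells\<close>

lemma levy_measure_tail_finite:
  assumes "levy_measure \<nu>" "0 < \<delta>"
  shows "emeasure \<nu> {z. \<delta> < \<bar>z\<bar>} < \<infinity>"
proof -
  have s: "sets \<nu> = sets borel" using assms by (simp add: levy_measure_def)
  have m: "{z::real. \<delta> < \<bar>z\<bar>} \<in> sets \<nu>" unfolding s by measurable
  have "ennreal (min 1 (\<delta>\<^sup>2)) * emeasure \<nu> {z. \<delta> < \<bar>z\<bar>} =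
      (\<integral>\<^sup>+z. ennreal (min 1 (\<delta>\<^sup>2)) * indicator {z. \<delta> < \<bar>z\<bar>} z \<partial>\<nu>)"
    by (rule nn_integral_cmult_indicator[OF m, symmetric])
  also have "\<dots> \<le> (\<integral>\<^sup>+z. ennreal (min 1 (z\<^sup>2)) \<partial>\<nu>)"
  proof (rule nn_integral_mono)
    fix z :: real
    have "\<delta>\<^sup>2 \<le> z\<^sup>2" if "\<delta> < \<bar>z\<bar>"
      using that assms(2) by (metis abs_of_pos abs_le_square_iff less_imp_le)
    then show "ennreal (min 1 (\<delta>\<^sup>2)) * indicator {z. \<delta> < \<bar>z\<bar>} z \<le> ennreal (min 1 (z\<^sup>2))"
      by (auto split: split_indicator intro!: ennreal_leI)
  qed
  also have "\<dots> < \<infinity>" using assms by (simp add: levy_measure_def)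
  finally have "ennreal (min 1 (\<delta>\<^sup>2)) * emeasure \<nu> {z. \<delta> < \<bar>z\<bar>} < \<infinity>" .
  moreover have "min 1 (\<delta>\<^sup>2) > 0" using assms(2) by simp
  ultimately show ?thesis by (auto simp: ennreal_mult_less_top)
qed

lemma levy_measure_sigma_finite:
  assumes "levy_measure \<nu>"
  shows "sigma_finite_measure \<nu>"
proof
  have s: "sets \<nu> = sets borel" using assms by (simp add: levy_measure_def)
  have sp: "space \<nu> = UNIV" using sets_eq_imp_space_eq[OF s] by simp
  show "\<exists>A. countable A \<and> A \<subseteq> sets \<nu> \<and> \<Union> A = space \<nu> \<and> (\<forall>a\<in>A. emeasure \<nu> a \<noteq> \<infinity>)"
  proof (intro exI conjI ballI)
    show "countable (insert {0} (range (\<lambda>n. {z::real. inverse (real (Suc n)) < \<bar>z\<bar>})))" by simp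
    show "insert {0} (range (\<lambda>n. {z::real. inverse (real (Suc n)) < \<bar>z\<bar>})) \<subseteq> sets \<nu>"
      unfolding s by auto
    show "\<Union> (insert {0} (range (\<lambda>n. {z::real. inverse (real (Suc n)) < \<bar>z\<bar>}))) = space \<nu>"
      unfolding sp using reals_Archimedean[of "\<bar>_\<bar>"] by auto
    fix a assume "a \<in> insert {0} (range (\<lambda>n. {z::real. inverse (real (Suc n)) < \<bar>z\<bar>}))"
    then consider "a = {0}" | n where "a = {z::real. inverse (real (Suc n)) < \<bar>z\<bar>}" by auto
    then show "emeasure \<nu> a \<noteq> \<infinity>"
    proof cases
      case 1
      then show ?thesis using assms by (simp add: levy_measure_def)
    next
      case 2
      have "0 < inverse (real (Suc n))" by simp
      with levy_measure_tail_finite[OF assms this] 2 show ?thesis by (metis less_irrefl)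
    qed
  qed
qed

lemma emeasure_jump_intensity_slab:
  assumes "levy_measure \<nu>" "A \<in> sets borel"
  shows "emeasure (jump_intensity \<epsilon> \<nu>) ({0<..1} \<times> A) = ennreal (1 / \<epsilon>) * emeasure \<nu> A"
proof -
  interpret sigma_finite_measure \<nu> by (rule levy_measure_sigma_finite[OF assms(1)])
  have s: "sets \<nu> = sets borel" using assms by (simp add: levy_measure_def)
  have "emeasure (restrict_space lborel {0..1::real}) {0<..1} = 1"
    by (subst emeasure_restrict_space) auto
  moreover have "{0<..1} \<in> sets (restrict_space lborel {0..1::real})"
    by (auto simp: sets_restrict_space_iff)
  ultimately show ?thesis
    using assms(2) s by (simp add: jump_intensity_def emeasure_pair_measure_Times)
qed

text \<open>A Riemann sum: the function \<open>f\<close> oscillates by at most \<open>w\<close> on each cell.\<close>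

lemma integral_over_cells:
  fixes f :: "'a \<Rightarrow> real"
  assumes f: "f \<in> borel_measurable n" and I: "finite I" and A: "disjoint_family_on A I"
    "\<And>i. i \<in> I \<Longrightarrow> A i \<in> sets n" "\<And>i. i \<in> I \<Longrightarrow> emeasure n (A i) < \<infinity>"
    and v: "\<And>i p. i \<in> I \<Longrightarrow> p \<in> A i \<Longrightarrow> v i \<le> f p \<and> f p \<le> v i + w"
  shows "set_integrable n (\<Union>i\<in>I. A i) f"
    and "\<bar>(LINT p:(\<Union>i\<in>I. A i)|n. f p) - (\<Sum>i\<in>I. v i * measure n (A i))\<bar>
      \<le> w * measure n (\<Union>i\<in>I. A i)"
proof -
  have int: "set_integrable n (A i) f" if i: "i \<in> I" for i
    unfolding set_integrable_def
  proof (rule integrableI_bounded_set_indicator[where B = "\<bar>v i\<bar> + \<bar>w\<bar>"])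
    show "AE p in n. p \<in> A i \<longrightarrow> norm (f p) \<le> \<bar>v i\<bar> + \<bar>w\<bar>"
      using v[OF i] by (intro always_eventually) fastforce
  qed (use A(2,3)[OF i] f in auto)
  show "set_integrable n (\<Union>i\<in>I. A i) f"
    using I A(2) int by (intro set_integrable_UN) auto
  have cell: "\<bar>(LINT p:A i|n. f p) - v i * measure n (A i)\<bar> \<le> w * measure n (A i)" if i: "i \<in> I" for i
  proof -
    have c: "set_integrable n (A i) (\<lambda>_. c)" for c :: real
      unfolding set_integrable_def using A(2,3)[OF i] by simp
    have e: "(LINT p:A i|n. c) = measure n (A i) * c" for c :: real
      using A(2,3)[OF i] set_integral_const[of "A i" n c] by auto
    have "(LINT p:A i|n. v i) \<le> (LINT p:A i|n. f p)" "(LINT p:A i|n. f p) \<le> (LINT p:A i|n. v i + w)"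
      using v[OF i] by (auto intro!: set_integral_mono c int i)
    then show ?thesis unfolding e by (simp add: algebra_simps)
  qed
  have "(LINT p:(\<Union>i\<in>I. A i)|n. f p) = (\<Sum>i\<in>I. LINT p:A i|n. f p)"
    using I A int by (intro set_integral_finite_Union) auto
  then have "\<bar>(LINT p:(\<Union>i\<in>I. A i)|n. f p) - (\<Sum>i\<in>I. v i * measure n (A i))\<bar>
      = \<bar>\<Sum>i\<in>I. (LINT p:A i|n. f p) - v i * measure n (A i)\<bar>"
    by (simp add: sum_subtractf)
  also have "\<dots> \<le> (\<Sum>i\<in>I. w * measure n (A i))"
    by (rule order_trans[OF sum_abs sum_mono]) (rule cell)
  also have "\<dots> = w * measure n (\<Union>i\<in>I. A i)"
    using I A by (subst measure_finite_Union) (auto simp: sum_distrib_left less_top[symmetric])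
  finally show "\<bar>(LINT p:(\<Union>i\<in>I. A i)|n. f p) - (\<Sum>i\<in>I. v i * measure n (A i))\<bar>
      \<le> w * measure n (\<Union>i\<in>I. A i)" .
qed

text \<open>This separates the contribution of the atoms in \<open>D0\<close> from a sum over the remaining cells,
  which depends on the measure only through finitely many counts; independence of counts of
  disjoint sets then applies.\<close>

lemma integral_large_jump:
  fixes f :: "'a \<Rightarrow> real"
  assumes f: "f \<in> borel_measurable n" and I: "finite I" and A: "disjoint_family_on A I"
    "\<And>i. i \<in> I \<Longrightarrow> A i \<in> sets n" "\<And>i. i \<in> I \<Longrightarrow> emeasure n (A i) < \<infinity>"
    and v: "\<And>i p. i \<in> I \<Longrightarrow> p \<in> A i \<Longrightarrow> v i \<le> f p \<and> f p \<le> v i + w"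
    and D: "D0 \<in> sets n" "D1 \<in> sets n" "D0 \<inter> D1 = {}"
      "D0 \<inter> (\<Union>i\<in>I. A i) = {}" "D1 \<inter> (\<Union>i\<in>I. A i) = {}"
    and D0: "\<And>p. p \<in> D0 \<Longrightarrow> a \<le> f p \<and> f p \<le> a'" and D1: "emeasure n D1 = 0"
  shows "emeasure n D0 = 0 \<Longrightarrow>
      \<bar>(LINT p:D0 \<union> D1 \<union> (\<Union>i\<in>I. A i)|n. f p) - (\<Sum>i\<in>I. v i * measure n (A i))\<bar>
        \<le> w * measure n (\<Union>i\<in>I. A i)" (is "_ \<Longrightarrow> \<bar>?L - ?V\<bar> \<le> ?W")
    and "emeasure n D0 = 1 \<Longrightarrow>
      a - w * measure n (\<Union>i\<in>I. A i)
        \<le> (LINT p:D0 \<union> D1 \<union> (\<Union>i\<in>I. A i)|n. f p) - (\<Sum>i\<in>I. v i * measure n (A i))"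
proof -
  note cells = integral_over_cells[where v = v and w = w, OF f I A v]
  have null: "set_integrable n X f \<and> (LINT p:X|n. f p) = 0" if "X \<in> sets n" "emeasure n X = 0" for X
  proof -
    have ae: "AE p in n. indicator X p *\<^sub>R f p = 0"
      by (rule AE_I[of _ _ X]) (use that in \<open>auto simp: indicator_def\<close>)
    then have "(LINT p:X|n. f p) = 0"
      unfolding set_lebesgue_integral_def by (rule integral_eq_zero_AE)
    moreover have "integrable n (\<lambda>p. indicator X p *\<^sub>R f p) \<longleftrightarrow> integrable n (\<lambda>p. 0::real)"
      using ae f that by (intro integrable_cong_AE) auto
    ultimately show ?thesis by (simp add: set_integrable_def)
  qed
  have split: "?L = (LINT p:D0|n. f p) + (LINT p:(\<Union>i\<in>I. A i)|n. f p)" if i0: "set_integrable n D0 f"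
  proof -
    have "?L = (LINT p:D0 \<union> D1|n. f p) + (LINT p:(\<Union>i\<in>I. A i)|n. f p)"
      using D null[OF D(2) D1] i0 cells(1) by (intro set_integral_Un set_integrable_Un) auto
    also have "(LINT p:D0 \<union> D1|n. f p) = (LINT p:D0|n. f p)"
      using D null[OF D(2) D1] i0 by (subst set_integral_Un) auto
    finally show ?thesis .
  qed
  show "emeasure n D0 = 0 \<Longrightarrow> \<bar>?L - ?V\<bar> \<le> ?W"
    using split null[OF D(1)] cells(2) by simp
  assume one: "emeasure n D0 = 1"
  have i0: "set_integrable n D0 f"
    unfolding set_integrable_def
  proof (rule integrableI_bounded_set_indicator[where B = "\<bar>a\<bar> + \<bar>a'\<bar>"])
    show "AE p in n. p \<in> D0 \<longrightarrow> norm (f p) \<le> \<bar>a\<bar> + \<bar>a'\<bar>"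
      using D0 by (intro always_eventually) fastforce
  qed (use D f one in auto)
  have c: "set_integrable n D0 (\<lambda>_. a)"
    unfolding set_integrable_def using D one by simp
  have "(LINT p:D0|n. a) = a"
    using D one set_integral_const[of D0 n a] by (simp add: measure_def)
  moreover have "(LINT p:D0|n. a) \<le> (LINT p:D0|n. f p)"
    using D0 by (intro set_integral_mono c i0) auto
  ultimately show "a - ?W \<le> ?L - ?V"
    using split[OF i0] cells(2) by linarith
qed

context prob_space
begin

lemma bounded_in_probability:
  assumes X[measurable]: "X \<in> borel_measurable M" and e: "0 < e"
  shows "\<exists>K>0. prob {\<omega> \<in> space M. K < \<bar>X \<omega> :: real\<bar>} < e"
proof -
  have "(\<lambda>n. prob {\<omega> \<in> space M. real n < \<bar>X \<omega>\<bar>}) \<longlonglongrightarrow> prob (\<Inter>n. {\<omega> \<in> space M. real n < \<bar>X \<omega>\<bar>})"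
    by (intro finite_Lim_measure_decseq) (auto simp: decseq_def)
  also have "(\<Inter>n. {\<omega> \<in> space M. real n < \<bar>X \<omega>\<bar>}) = {}"
  proof -
    have "\<exists>n. \<not> real n < \<bar>X \<omega>\<bar>" for \<omega>
      using reals_Archimedean2[of "\<bar>X \<omega>\<bar>"] by (auto intro: less_asym)
    then show ?thesis by blast
  qed
  finally have "(\<lambda>n. prob {\<omega> \<in> space M. real n < \<bar>X \<omega>\<bar>}) \<longlonglongrightarrow> 0" by simp
  then have "eventually (\<lambda>n. prob {\<omega> \<in> space M. real n < \<bar>X \<omega>\<bar>} < e) sequentially"
    using e by (rule order_tendstoD(2))
  then have "eventually (\<lambda>n. 0 < n \<and> prob {\<omega> \<in> space M. real n < \<bar>X \<omega>\<bar>} < e) sequentially"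
    using eventually_gt_at_top[of 0] by eventually_elim auto
  then obtain n where "0 < n" "prob {\<omega> \<in> space M. real n < \<bar>X \<omega>\<bar>} < e"
    by (auto dest: eventually_happens)
  then show ?thesis by (intro exI[of _ "real n"]) auto
qed

lemma poisson_count_finite:
  assumes prm: "poisson_random_measure M \<mu> N" and A: "A \<in> sets \<mu>" "emeasure \<mu> A < \<infinity>"
  shows "AE \<omega> in M. emeasure (N \<omega>) A < \<infinity>"
proof -
  have [measurable]: "(\<lambda>\<omega>. emeasure (N \<omega>) A) \<in> borel_measurable M"
    using prm A by (simp add: poisson_random_measure_def)
  define E where "E k = {\<omega> \<in> space M. emeasure (N \<omega>) A = of_nat k}" for k :: nat
  have E[measurable]: "E k \<in> events" for k unfolding E_def by measurable
  have "(\<lambda>k. prob (E k)) sums prob (\<Union>k. E k)"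
    by (intro finite_measure_UNION) (auto simp: disjoint_family_on_def E_def)
  moreover have "(\<lambda>k. prob (E k)) sums 1"
  proof -
    have "(\<lambda>k. (measure \<mu> A ^ k /\<^sub>R fact k) * exp (- measure \<mu> A)) sums (exp (measure \<mu> A) * exp (- measure \<mu> A))"
      by (intro sums_mult2 exp_converges)
    moreover have "prob (E k) = (measure \<mu> A ^ k /\<^sub>R fact k) * exp (- measure \<mu> A)" for k
      using prm A by (simp add: poisson_random_measure_def E_def divide_inverse mult_ac)
    ultimately show ?thesis by (simp add: exp_minus_inverse)
  qed
  ultimately have "prob (\<Union>k. E k) = 1" by (rule sums_unique2)
  then have "AE \<omega> in M. \<omega> \<in> (\<Union>k. E k)" by (rule AE_prob_1)
  then show ?thesis
    by (rule AE_mp) (auto simp: E_def of_nat_less_top)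
qed

text \<open>The increment of \<open>\<surd>\<epsilon> B\<close> is Gaussian and independent of every truncated integral, and
  adding an independent variable cannot concentrate a law. The bound survives the limit in
  probability by which the compensated integral is defined.\<close>

lemma increment_anticoncentration:
  assumes \<nu>: "sets \<nu> = sets borel" and \<epsilon>: "0 < \<epsilon>"
    and prm: "poisson_random_measure M (jump_intensity \<epsilon> \<nu>) N"
    and B: "standard_brownian_motion M B"
    and ind: "process_indep_of_random_measure M (jump_intensity \<epsilon> \<nu>) B N"
    and Z: "compensated_integral M (jump_intensity \<epsilon> \<nu>) N Z"
    and st: "0 \<le> s" "s < t" "t \<le> 1" and \<kappa>: "0 < \<kappa>"
  shows "prob {\<omega> \<in> space M. \<bar>(sqrt \<epsilon> * B t \<omega> + \<epsilon> * Z t \<omega>) - (sqrt \<epsilon> * B s \<omega> + \<epsilon> * Z s \<omega>)\<bar> \<le> \<kappa>}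
    \<le> 2 * \<kappa> / (sqrt \<epsilon> * sqrt (t - s))"
proof -
  define \<mu> where "\<mu> = jump_intensity \<epsilon> \<nu>"
  define T where "T \<delta> u \<omega> = truncated_compensated_integral \<mu> (N \<omega>) \<delta> u" for \<delta> u \<omega>
  have Nsets: "\<And>\<omega>. \<omega> \<in> space M \<Longrightarrow> sets (N \<omega>) = sets \<mu>"
    using prm by (simp add: poisson_random_measure_def \<mu>_def)
  have T_count: "T \<delta> u \<in> borel_measurable (count_events \<mu> N)" if "u \<le> 1" for \<delta> u
    unfolding T_def \<mu>_def
    by (rule measurable_truncated_compensated_integral[OF \<nu> that])
       (use Nsets measurable_count_events in \<open>auto simp: \<mu>_def\<close>)
  have T_meas[measurable]: "T \<delta> u \<in> borel_measurable M" if "u \<le> 1" for \<delta> u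
    unfolding T_def \<mu>_def
    by (rule measurable_truncated_compensated_integral[OF \<nu> that])
       (use prm Nsets in \<open>auto simp: \<mu>_def poisson_random_measure_def\<close>)
  have [measurable]: "B t \<in> borel_measurable M" "B s \<in> borel_measurable M"
    using B st by (auto simp: standard_brownian_motion_def)
  have [measurable]: "Z t \<in> borel_measurable M" "Z s \<in> borel_measurable M"
    using Z st by (auto simp: compensated_integral_def)
  have [measurable]: "T \<delta> t \<in> borel_measurable M" "T \<delta> s \<in> borel_measurable M" for \<delta>
    using st by (auto intro: T_meas)
  define err where "err u \<delta> = prob {\<omega> \<in> space M. \<kappa> / (2 * \<epsilon>) < \<bar>T \<delta> u \<omega> - Z u \<omega>\<bar>}" for u \<delta>
  have err: "(err u \<longlongrightarrow> 0) (at_right 0)" if "u \<in> {0..1}" for u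
    using Z that \<kappa> \<epsilon> unfolding err_def T_def \<mu>_def compensated_integral_def by auto
  define p where "p = prob {\<omega> \<in> space M. \<bar>(sqrt \<epsilon> * B t \<omega> + \<epsilon> * Z t \<omega>) - (sqrt \<epsilon> * B s \<omega> + \<epsilon> * Z s \<omega>)\<bar> \<le> \<kappa>}"
  have bound: "p \<le> 2 * \<kappa> / (sqrt \<epsilon> * sqrt (t - s)) + err t \<delta> + err s \<delta>" for \<delta>
  proof -
    define U where "U \<omega> = B t \<omega> - B s \<omega>" for \<omega>
    define V where "V \<omega> = \<epsilon> * (T \<delta> t \<omega> - T \<delta> s \<omega>)" for \<omega>
    have [measurable]: "U \<in> borel_measurable M" "V \<in> borel_measurable M"
      unfolding U_def V_def by measurable
    have "indep_var borel V borel U"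
    proof (rule indep_path_count)
      show "process_indep_of_random_measure M \<mu> B N" using ind by (simp add: \<mu>_def)
      show "U \<in> borel_measurable (path_events B)"
        unfolding U_def using st by (intro borel_measurable_diff measurable_path_events) auto
      show "V \<in> borel_measurable (count_events \<mu> N)"
        unfolding V_def using st
        by (intro borel_measurable_times borel_measurable_diff borel_measurable_const T_count) auto
    qed
    then have g: "prob {\<omega> \<in> space M. \<bar>sqrt \<epsilon> * U \<omega> + V \<omega>\<bar> \<le> 2 * \<kappa>} \<le> 2 * \<kappa> / (sqrt \<epsilon> * sqrt (t - s))"
      using B st \<epsilon> \<kappa>
      by (intro gaussian_anticoncentration) (auto simp: standard_brownian_motion_def U_def[abs_def])
    have "p \<le> prob ({\<omega> \<in> space M. \<bar>sqrt \<epsilon> * U \<omega> + V \<omega>\<bar> \<le> 2 * \<kappa>} \<union>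
        {\<omega> \<in> space M. \<kappa> / (2 * \<epsilon>) < \<bar>T \<delta> t \<omega> - Z t \<omega>\<bar>} \<union>
        {\<omega> \<in> space M. \<kappa> / (2 * \<epsilon>) < \<bar>T \<delta> s \<omega> - Z s \<omega>\<bar>})"
      unfolding p_def
    proof (rule finite_measure_mono)
      have "\<bar>sqrt \<epsilon> * U \<omega> + V \<omega>\<bar> \<le> 2 * \<kappa>"
        if 1: "\<bar>(sqrt \<epsilon> * B t \<omega> + \<epsilon> * Z t \<omega>) - (sqrt \<epsilon> * B s \<omega> + \<epsilon> * Z s \<omega>)\<bar> \<le> \<kappa>"
          and 2: "\<bar>T \<delta> t \<omega> - Z t \<omega>\<bar> \<le> \<kappa> / (2 * \<epsilon>)" "\<bar>T \<delta> s \<omega> - Z s \<omega>\<bar> \<le> \<kappa> / (2 * \<epsilon>)" for \<omega>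
      proof -
        have "\<epsilon> * \<bar>T \<delta> u \<omega> - Z u \<omega>\<bar> \<le> \<kappa> / 2" if "u = s \<or> u = t" for u
          using that 2 mult_left_mono[of "\<bar>T \<delta> u \<omega> - Z u \<omega>\<bar>" "\<kappa> / (2 * \<epsilon>)" \<epsilon>] \<epsilon> by auto
        then have "\<bar>\<epsilon> * (T \<delta> t \<omega> - Z t \<omega>)\<bar> \<le> \<kappa> / 2" "\<bar>\<epsilon> * (T \<delta> s \<omega> - Z s \<omega>)\<bar> \<le> \<kappa> / 2"
          using \<epsilon> by (auto simp: abs_mult)
        moreover have "sqrt \<epsilon> * U \<omega> + V \<omega> = ((sqrt \<epsilon> * B t \<omega> + \<epsilon> * Z t \<omega>) - (sqrt \<epsilon> * B s \<omega> + \<epsilon> * Z s \<omega>))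
            + \<epsilon> * (T \<delta> t \<omega> - Z t \<omega>) - \<epsilon> * (T \<delta> s \<omega> - Z s \<omega>)"
          by (simp add: U_def V_def algebra_simps)
        ultimately show ?thesis using 1 by linarith
      qed
      then show "{\<omega> \<in> space M. \<bar>(sqrt \<epsilon> * B t \<omega> + \<epsilon> * Z t \<omega>) - (sqrt \<epsilon> * B s \<omega> + \<epsilon> * Z s \<omega>)\<bar> \<le> \<kappa>}
        \<subseteq> {\<omega> \<in> space M. \<bar>sqrt \<epsilon> * U \<omega> + V \<omega>\<bar> \<le> 2 * \<kappa>} \<union>
        {\<omega> \<in> space M. \<kappa> / (2 * \<epsilon>) < \<bar>T \<delta> t \<omega> - Z t \<omega>\<bar>} \<union>
        {\<omega> \<in> space M. \<kappa> / (2 * \<epsilon>) < \<bar>T \<delta> s \<omega> - Z s \<omega>\<bar>}"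
        using not_le by blast
    qed measurable
    also have "\<dots> \<le> prob {\<omega> \<in> space M. \<bar>sqrt \<epsilon> * U \<omega> + V \<omega>\<bar> \<le> 2 * \<kappa>} + err t \<delta> + err s \<delta>"
      unfolding err_def
      by (intro order_trans[OF measure_Un_le] add_mono order_refl) measurable
    finally show ?thesis using g by linarith
  qed
  have "((\<lambda>\<delta>. 2 * \<kappa> / (sqrt \<epsilon> * sqrt (t - s)) + err t \<delta> + err s \<delta>)
      \<longlongrightarrow> 2 * \<kappa> / (sqrt \<epsilon> * sqrt (t - s)) + 0 + 0) (at_right 0)"
    using st by (intro tendsto_add tendsto_const err) auto
  then have "p \<le> 2 * \<kappa> / (sqrt \<epsilon> * sqrt (t - s)) + 0 + 0"
    by (rule tendsto_lowerbound) (auto intro: always_eventually bound)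
  then show ?thesis by (simp add: p_def)
qed

end

section \<open>A large jump moves the end point\<close>

context prob_space
begin

text \<open>Write the truncated integral as \<open>J + R\<close>, where \<open>J\<close> collects the jumps of modulus at
  least \<open>2 y\<close>. These parts are independent. If \<open>\<bar>R\<bar> < y\<close>, a jump in \<open>[2 y, 8 y)\<close> that
  is the only large one makes the sum exceed \<open>y\<close>; if \<open>\<bar>R\<bar> \<ge> y\<close>, it is enough that there is no large jump. Either way
  the conditional probability is at least \<open>min l 1 * exp (- (l + l'))\<close>, so that nothing needs to
  be known about \<open>R\<close>, in particular no moment bound uniform in the truncation \<open>\<delta>\<close>. In the
  proof, \<open>R\<close> is replaced by a Riemann sum \<open>W\<close>; the error is controlled by the number of jumps
  of modulus between \<open>\<delta>\<close> and \<open>2 y\<close>, and this is why \<open>y\<close> becomes \<open>3/4 y\<close>.\<close>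

lemma truncated_integral_lower_bound:
  assumes \<nu>: "levy_measure \<nu>" and \<epsilon>: "0 < \<epsilon>"
    and prm: "poisson_random_measure M (jump_intensity \<epsilon> \<nu>) N"
    and y: "0 < \<delta>" "\<delta> < 2 * y"
  defines "l \<equiv> measure \<nu> {2 * y..<8 * y} / \<epsilon>"
    and "l' \<equiv> measure \<nu> ({..- (2 * y)} \<union> {8 * y..}) / \<epsilon>"
  shows "min l 1 * exp (- (l + l')) \<le>
    prob {\<omega> \<in> space M. 3/4 * y \<le> \<bar>truncated_compensated_integral (jump_intensity \<epsilon> \<nu>) (N \<omega>) \<delta> 1\<bar>}"
proof (rule field_le_epsilon)
  fix e :: real assume e: "0 < e"
  define \<mu> where "\<mu> = jump_intensity \<epsilon> \<nu>"
  have y0: "0 < y" using y by simp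
  have \<nu>s: "sets \<nu> = sets borel" using \<nu> by (simp add: levy_measure_def)
  have Nsets: "\<And>\<omega>. \<omega> \<in> space M \<Longrightarrow> sets (N \<omega>) = sets \<mu>"
    using prm by (simp add: poisson_random_measure_def \<mu>_def)
  have slab: "{0<..1} \<times> A \<in> sets \<mu>" if "A \<in> sets borel" for A :: "real set"
    unfolding \<mu>_def using that by (intro slab_measurable[OF \<nu>s]) auto
  have N_meas[measurable]: "A \<in> sets \<mu> \<Longrightarrow> (\<lambda>\<omega>. emeasure (N \<omega>) A) \<in> borel_measurable M" for A
    using prm by (simp add: poisson_random_measure_def \<mu>_def)
  have slab_finite: "emeasure \<mu> ({0<..1} \<times> A) < \<infinity>"
    if "A \<in> sets borel" "A \<subseteq> {z. d < \<bar>z\<bar>}" "0 < d" for A d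
  proof -
    have "emeasure \<nu> A \<le> emeasure \<nu> {z. d < \<bar>z\<bar>}"
      using that \<nu>s by (intro emeasure_mono) auto
    then have "emeasure \<nu> A < \<infinity>"
      using levy_measure_tail_finite[OF \<nu> that(3)] by (rule le_less_trans)
    then show ?thesis
      unfolding \<mu>_def emeasure_jump_intensity_slab[OF \<nu> that(1)]
      by (simp add: ennreal_mult_less_top)
  qed
  have slab_measure: "measure \<mu> ({0<..1} \<times> A) = measure \<nu> A / \<epsilon>" if "A \<in> sets borel" for A
    unfolding measure_def \<mu>_def emeasure_jump_intensity_slab[OF \<nu> that]
    using \<epsilon> by (simp add: enn2real_mult)
  define S where "S = {0<..1::real} \<times> {z. \<delta> < \<bar>z\<bar> \<and> \<bar>z\<bar> < 2 * y}"
  have S: "S \<in> sets \<mu>" "emeasure \<mu> S < \<infinity>"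
    unfolding S_def by (rule slab, measurable) (rule slab_finite[of _ \<delta>], use y in \<open>auto\<close>)
  have NS: "AE \<omega> in M. emeasure (N \<omega>) S < \<infinity>"
    using poisson_count_finite[OF prm] S by (simp add: \<mu>_def)
  have "(\<lambda>\<omega>. measure (N \<omega>) S) \<in> borel_measurable M"
    unfolding measure_def using S by measurable
  from bounded_in_probability[OF this e] obtain K where K: "0 < K"
    "prob {\<omega> \<in> space M. K < \<bar>measure (N \<omega>) S\<bar>} < e" by auto
  \<comment> \<open>The number of cells makes the Riemann error \<open>w * K\<close> at most \<open>y / 4\<close> when there are at most \<open>K\<close> atoms in \<open>S\<close>.\<close>
  define m where "m = nat \<lceil>16 * K\<rceil> + 1"
  define w where "w = 4 * y / real m"
  have m: "0 < m" "16 * K \<le> real m" unfolding m_def by linarith+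
  have w: "0 < w" "w * K \<le> y / 4" "w * real m = 4 * y"
    using m y0 K by (auto simp: w_def field_simps)
  define v where "v i = - (2 * y) + real (i - 2) * w" for i :: nat
  \<comment> \<open>Index \<open>0\<close> is the range of the wanted jump and index \<open>1\<close> the other large jumps; the cells start at index \<open>2\<close>.\<close>
  define A where "A i = {0<..1::real} \<times>
    (if i = 0 then {2 * y..<8 * y} else if i = 1 then {..- (2 * y)} \<union> {8 * y..}
     else {z. \<delta> < \<bar>z\<bar> \<and> \<bar>z\<bar> < 2 * y} \<inter> {v i..<v i + w})" for i :: nat
  define I where "I = {2..<m + 2}"
  have A_meas: "A i \<in> sets \<mu>" for i
    unfolding A_def by (intro slab) auto
  have A_fin: "emeasure \<mu> (A i) < \<infinity>" for i
    unfolding A_def by (rule slab_finite[of _ "min \<delta> y"]) (use y in auto)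
  have v_step: "v i + w \<le> v j" if "2 \<le> i" "i < j" for i j
  proof -
    have "(real (i - 2) + 1) * w \<le> real (j - 2) * w"
      using that w(1) by (intro mult_right_mono) auto
    then show ?thesis by (simp add: v_def algebra_simps)
  qed
  have cells: "(\<Union>i\<in>I. A i) = S"
  proof (intro equalityI subsetI)
    fix p assume "p \<in> S"
    then obtain s z where p: "p = (s, z)" "s \<in> {0<..1}" "\<delta> < \<bar>z\<bar>" "\<bar>z\<bar> < 2 * y"
      by (auto simp: S_def)
    define j where "j = nat \<lfloor>(z + 2 * y) / w\<rfloor>"
    have nn: "0 \<le> (z + 2 * y) / w" using p w by auto
    have jl: "real j \<le> (z + 2 * y) / w" "(z + 2 * y) / w < real j + 1"
      using nn unfolding j_def by linarith+
    have "(z + 2 * y) / w < real m"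
      using p w by (simp add: pos_divide_less_eq mult.commute)
    then have "j < m" using jl by linarith
    moreover have "v (j + 2) \<le> z" "z < v (j + 2) + w"
      using jl w(1) by (auto simp: v_def field_simps)
    ultimately have "p \<in> A (j + 2)" "j + 2 \<in> I" using p by (auto simp: A_def I_def)
    then show "p \<in> (\<Union>i\<in>I. A i)" by blast
  qed (auto simp: A_def I_def S_def)
  have disj: "disjoint_family_on A {..<m + 2}"
    unfolding disjoint_family_on_def
  proof (intro ballI impI)
    have "A i \<inter> A j = {}" if "i < j" for i j
    proof (cases "2 \<le> i")
      case True
      then show ?thesis using v_step[OF True that] that by (auto simp: A_def)
    next
      case False
      then show ?thesis using that y0 by (auto simp: A_def)
    qed
    then show "A i \<inter> A j = {}" if "i \<noteq> j" for i j
      using that by (metis Int_commute linorder_neqE_nat)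
  qed
  define X where "X i \<omega> = emeasure (N \<omega>) (A i)" for i \<omega>
  have X[measurable]: "X i \<in> borel_measurable M" for i
    unfolding X_def using A_meas by measurable
  have indX: "indep_vars (\<lambda>_. borel) X {..<m + 2}"
    using prm A_meas disj unfolding poisson_random_measure_def X_def[abs_def] \<mu>_def[symmetric]
    by blast
  define c where "c = (LINT p:{0<..1} \<times> {z. \<delta> < \<bar>z\<bar>}|\<mu>. snd p)"
  define W where "W \<omega> = (\<Sum>i\<in>I. v i * enn2real (X i \<omega>)) - c" for \<omega>
  have [measurable]: "W \<in> borel_measurable M" unfolding W_def by measurable
  define G where "G = {\<omega> \<in> space M. \<bar>W \<omega>\<bar> < y}"
  have [measurable]: "G \<in> events" unfolding G_def by measurable
  define E where "E k = {\<omega> \<in> space M. X 0 \<omega> = of_nat k \<and> X 1 \<omega> = 0}" for k :: nat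
  have [measurable]: "E k \<in> events" for k unfolding E_def by measurable
  have X0: "prob {\<omega> \<in> space M. X 0 \<omega> = of_nat k} = l ^ k / fact k * exp (- l)" for k
  proof -
    have "measure \<mu> (A 0) = l"
      unfolding A_def l_def by (subst slab_measure) auto
    then show ?thesis
      using prm A_meas[of 0] A_fin[of 0]
      by (auto simp: poisson_random_measure_def \<mu>_def[symmetric] X_def)
  qed
  have X1: "prob {\<omega> \<in> space M. X 1 \<omega> = 0} = exp (- l')"
  proof -
    have "measure \<mu> (A 1) = l'"
      unfolding A_def l'_def by (simp, subst slab_measure) auto
    moreover have "prob {\<omega> \<in> space M. emeasure (N \<omega>) (A 1) = of_nat 0}
        = measure \<mu> (A 1) ^ 0 / fact 0 * exp (- measure \<mu> (A 1))"
      using prm A_meas[of 1] A_fin[of 1] unfolding poisson_random_measure_def \<mu>_def[symmetric] by blast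
    ultimately show ?thesis by (simp add: X_def)
  qed
  have EG: "prob (E k \<inter> H) = l ^ k / fact k * exp (- l) * exp (- l') * prob H"
    if H: "H = G \<or> H = space M - G" for k H
  proof -
    have iv: "indep_var (PiM {0, 1} (\<lambda>_. borel)) (\<lambda>\<omega>. restrict (\<lambda>i. X i \<omega>) {0, 1})
        (PiM I (\<lambda>_. borel)) (\<lambda>\<omega>. restrict (\<lambda>i. X i \<omega>) I)"
      using m by (intro indep_var_restrict[OF indX]) (auto simp: I_def)
    define Ea where "Ea = {x \<in> space (PiM {0, 1::nat} (\<lambda>_. borel :: ennreal measure)). x 0 = of_nat k \<and> x 1 = 0}"
    define Eb where "Eb = {x \<in> space (PiM I (\<lambda>_. borel :: ennreal measure)).
        \<bar>(\<Sum>i\<in>I. v i * enn2real (x i)) - c\<bar> < y}"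
    define Eb' where "Eb' = (if H = G then Eb else space (PiM I (\<lambda>_. borel)) - Eb)"
    have Ea: "Ea \<in> sets (PiM {0, 1} (\<lambda>_. borel))"
      unfolding Ea_def by measurable
    have Eb: "Eb \<in> sets (PiM I (\<lambda>_. borel))"
      unfolding Eb_def by measurable
    then have Eb': "Eb' \<in> sets (PiM I (\<lambda>_. borel))" unfolding Eb'_def by auto
    have "(\<lambda>\<omega>. restrict (\<lambda>i. X i \<omega>) {0, 1}) -` Ea \<inter> space M = E k"
      by (auto simp: Ea_def E_def space_PiM)
    moreover have b: "(\<lambda>\<omega>. restrict (\<lambda>i. X i \<omega>) I) -` Eb \<inter> space M = G"
      by (auto simp: Eb_def G_def W_def space_PiM cong: sum.cong)
    have "(\<lambda>\<omega>. restrict (\<lambda>i. X i \<omega>) I) -` Eb' \<inter> space M = H"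
    proof (cases "H = G")
      case True
      then show ?thesis using b by (simp add: Eb'_def)
    next
      case False
      have "(\<lambda>\<omega>. restrict (\<lambda>i. X i \<omega>) I) -` (space (PiM I (\<lambda>_. borel)) - Eb) \<inter> space M
          = space M - ((\<lambda>\<omega>. restrict (\<lambda>i. X i \<omega>) I) -` Eb \<inter> space M)"
        by (auto simp: space_PiM)
      then show ?thesis using False H b by (auto simp: Eb'_def)
    qed
    moreover have "(\<lambda>\<omega>. (restrict (\<lambda>i. X i \<omega>) {0, 1}, restrict (\<lambda>i. X i \<omega>) I)) -` (Ea \<times> Eb') \<inter> space M
        = ((\<lambda>\<omega>. restrict (\<lambda>i. X i \<omega>) {0, 1}) -` Ea \<inter> space M) \<inter> ((\<lambda>\<omega>. restrict (\<lambda>i. X i \<omega>) I) -` Eb' \<inter> space M)"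
      by auto
    ultimately have 1: "prob (E k \<inter> H) = prob (E k) * prob H"
      using indep_varD[OF iv Ea Eb'] by simp
    have "prob (\<Inter>i\<in>{0, 1}. X i -` (if i = 0 then {of_nat k} else {0}) \<inter> space M)
        = (\<Prod>i\<in>{0, 1}. prob (X i -` (if i = 0 then {of_nat k} else {0}) \<inter> space M))"
      using m by (intro indep_varsD[OF indX]) auto
    moreover have "(\<Inter>i\<in>{0, 1}. X i -` (if i = 0 then {of_nat k} else {0}) \<inter> space M) = E k"
      by (auto simp: E_def)
    moreover have "X 0 -` {of_nat k} \<inter> space M = {\<omega> \<in> space M. X 0 \<omega> = of_nat k}"
      "X 1 -` {0} \<inter> space M = {\<omega> \<in> space M. X 1 \<omega> = 0}" by auto
    ultimately have "prob (E k) = l ^ k / fact k * exp (- l) * exp (- l')"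
      using X1 by (simp add: X0)
    with 1 show ?thesis by simp
  qed
  define g where "g = prob G"
  have g: "0 \<le> g" "g \<le> 1" by (auto simp: g_def)
  have key: "3/4 * y \<le> \<bar>truncated_compensated_integral \<mu> (N \<omega>) \<delta> 1\<bar>"
    if elim: "emeasure (N \<omega>) S < \<infinity>" "\<omega> \<in> space M" "\<omega> \<in> (E 1 \<inter> G) \<union> (E 0 \<inter> (space M - G))"
      and K': "\<not> K < \<bar>measure (N \<omega>) S\<bar>" for \<omega>
  proof -
    have cases: "X 1 \<omega> = 0"
      "X 0 \<omega> = 1 \<and> \<bar>W \<omega>\<bar> < y \<or> X 0 \<omega> = 0 \<and> y \<le> \<bar>W \<omega>\<bar>"
      using elim by (auto simp: E_def G_def)
    have Ns: "sets (N \<omega>) = sets \<mu>" using Nsets elim by simp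
    have snd: "snd \<in> borel_measurable (N \<omega>)"
      using measurable_snd_jump_intensity[OF \<nu>s] Ns by (simp add: \<mu>_def cong: measurable_cong_sets)
    have Afin: "emeasure (N \<omega>) (A i) < \<infinity>" if "i \<in> I" for i
      using that cells S A_meas Ns elim
      by (intro le_less_trans[OF emeasure_mono[of "A i" S "N \<omega>"]]) auto
    have v: "v i \<le> snd p \<and> snd p \<le> v i + w" if "i \<in> I" "p \<in> A i" for i p
      using that by (auto simp: A_def I_def split: if_splits)
    have A01: "A 0 \<inter> A 1 = {}" "A 0 \<inter> (\<Union>i\<in>I. A i) = {}" "A 1 \<inter> (\<Union>i\<in>I. A i) = {}"
      unfolding cells using y0 by (auto simp: A_def S_def)
    have all: "A 0 \<union> A 1 \<union> (\<Union>i\<in>I. A i) = {0<..1} \<times> {z. \<delta> < \<bar>z\<bar>}"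
      unfolding cells using y by (auto simp: A_def S_def)
    have D0: "2 * y \<le> snd p \<and> snd p \<le> 8 * y" if "p \<in> A 0" for p
      using that by (auto simp: A_def)
    have dI: "disjoint_family_on A I"
      using disj by (rule disjoint_family_on_mono[rotated]) (auto simp: I_def)
    have As: "A i \<in> sets (N \<omega>)" for i using A_meas Ns by simp
    have fI: "finite I" by (simp add: I_def)
    define r where "r = (LINT p:{0<..1} \<times> {z. \<delta> < \<bar>z\<bar>}|N \<omega>. snd p)"
    have tr: "truncated_compensated_integral \<mu> (N \<omega>) \<delta> 1 = r - c"
      by (simp add: truncated_compensated_integral_def r_def c_def)
    have Ws: "W \<omega> = (\<Sum>i\<in>I. v i * measure (N \<omega>) (A i)) - c"
      by (simp add: W_def X_def measure_def)
    note J = integral_large_jump[where a = "2 * y" and a' = "8 * y", of snd "N \<omega>" I A v w "A 0" "A 1"]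
    have J0: "\<bar>r - (\<Sum>i\<in>I. v i * measure (N \<omega>) (A i))\<bar> \<le> w * measure (N \<omega>) S" if "X 0 \<omega> = 0"
      using J(1)[unfolded all, unfolded cells, folded r_def] snd fI dI As Afin v A01 D0 cases(1) that
      unfolding cells X_def by blast
    have J1: "2 * y - w * measure (N \<omega>) S \<le> r - (\<Sum>i\<in>I. v i * measure (N \<omega>) (A i))" if "X 0 \<omega> = 1"
      using J(2)[unfolded all, unfolded cells, folded r_def] snd fI dI As Afin v A01 D0 cases(1) that
      unfolding cells X_def by blast
    have "w * measure (N \<omega>) S \<le> w * K" using w K' by (intro mult_left_mono) auto
    then have ws: "w * measure (N \<omega>) S \<le> y / 4" using w by linarith
    have "3/4 * y \<le> \<bar>r - c\<bar>"
      using cases(2)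
    proof
      assume "X 0 \<omega> = 1 \<and> \<bar>W \<omega>\<bar> < y"
      then show ?thesis using J1 ws Ws by linarith
    next
      assume "X 0 \<omega> = 0 \<and> y \<le> \<bar>W \<omega>\<bar>"
      then show ?thesis using J0 ws Ws by linarith
    qed
    then show ?thesis using tr by simp
  qed
  have "min l 1 * exp (- (l + l')) \<le> (l * g + 1 * (1 - g)) * exp (- (l + l'))"
  proof (rule mult_right_mono)
    have "min l 1 = min l 1 * g + min l 1 * (1 - g)" by (simp add: algebra_simps)
    also have "\<dots> \<le> l * g + 1 * (1 - g)"
      using g by (intro add_mono mult_right_mono) auto
    finally show "min l 1 \<le> l * g + 1 * (1 - g)" .
  qed simp
  also have "\<dots> = prob (E 1 \<inter> G) + prob (E 0 \<inter> (space M - G))"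
  proof -
    have "prob (space M - G) = 1 - g" unfolding g_def by (rule prob_compl) simp
    then show ?thesis
      using EG[of G 1] EG[of "space M - G" 0]
      by (simp add: g_def exp_add[symmetric] distrib_right)
  qed
  also have "\<dots> = prob ((E 1 \<inter> G) \<union> (E 0 \<inter> (space M - G)))"
    by (rule finite_measure_Union[symmetric]) auto
  also have "\<dots> \<le> prob ({\<omega> \<in> space M. 3/4 * y \<le> \<bar>truncated_compensated_integral \<mu> (N \<omega>) \<delta> 1\<bar>}
      \<union> {\<omega> \<in> space M. K < \<bar>measure (N \<omega>) S\<bar>})"
  proof (rule finite_measure_mono_AE)
    have [measurable]: "(\<lambda>\<omega>. truncated_compensated_integral \<mu> (N \<omega>) \<delta> 1) \<in> borel_measurable M"
      unfolding \<mu>_def by (rule measurable_truncated_compensated_integral[OF \<nu>s])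
        (use Nsets N_meas in \<open>auto simp: \<mu>_def\<close>)
    have [measurable]: "(\<lambda>\<omega>. measure (N \<omega>) S) \<in> borel_measurable M"
      unfolding measure_def using S by measurable
    show "{\<omega> \<in> space M. 3/4 * y \<le> \<bar>truncated_compensated_integral \<mu> (N \<omega>) \<delta> 1\<bar>}
      \<union> {\<omega> \<in> space M. K < \<bar>measure (N \<omega>) S\<bar>} \<in> events"
      by measurable
    show "AE \<omega> in M. \<omega> \<in> (E 1 \<inter> G) \<union> (E 0 \<inter> (space M - G)) \<longrightarrow>
      \<omega> \<in> {\<omega> \<in> space M. 3/4 * y \<le> \<bar>truncated_compensated_integral \<mu> (N \<omega>) \<delta> 1\<bar>}
      \<union> {\<omega> \<in> space M. K < \<bar>measure (N \<omega>) S\<bar>}"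
      using NS
    proof eventually_elim
      case (elim \<omega>)
      show ?case
      proof
        assume *: "\<omega> \<in> (E 1 \<inter> G) \<union> (E 0 \<inter> (space M - G))"
        then have "\<omega> \<in> space M" by (auto simp: G_def)
        with key[OF elim this *] show "\<omega> \<in> {\<omega> \<in> space M. 3/4 * y
            \<le> \<bar>truncated_compensated_integral \<mu> (N \<omega>) \<delta> 1\<bar>} \<union> {\<omega> \<in> space M. K < \<bar>measure (N \<omega>) S\<bar>}"
          by blast
      qed
    qed
  qed
  also have "\<dots> \<le> prob {\<omega> \<in> space M. 3/4 * y \<le> \<bar>truncated_compensated_integral \<mu> (N \<omega>) \<delta> 1\<bar>}
      + prob {\<omega> \<in> space M. K < \<bar>measure (N \<omega>) S\<bar>}"
  proof (rule measure_Un_le)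
    have [measurable]: "(\<lambda>\<omega>. truncated_compensated_integral \<mu> (N \<omega>) \<delta> 1) \<in> borel_measurable M"
      unfolding \<mu>_def by (rule measurable_truncated_compensated_integral[OF \<nu>s])
        (use Nsets N_meas in \<open>auto simp: \<mu>_def\<close>)
    have [measurable]: "(\<lambda>\<omega>. measure (N \<omega>) S) \<in> borel_measurable M"
      unfolding measure_def using S by measurable
    show "{\<omega> \<in> space M. 3/4 * y \<le> \<bar>truncated_compensated_integral \<mu> (N \<omega>) \<delta> 1\<bar>} \<in> events"
      "{\<omega> \<in> space M. K < \<bar>measure (N \<omega>) S\<bar>} \<in> events"
      by measurable
  qed
  finally show "min l 1 * exp (- (l + l')) \<le>
    prob {\<omega> \<in> space M. 3/4 * y \<le> \<bar>truncated_compensated_integral (jump_intensity \<epsilon> \<nu>) (N \<omega>) \<delta> 1\<bar>} + e"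
    using K(2) by (simp add: \<mu>_def)
qed

text \<open>The Brownian part is independent of the jumps and stays bounded by \<open>sqrt \<epsilon> * K\<close> at the
  price of a factor \<open>1/2\<close>.\<close>

lemma endpoint_lower_bound:
  assumes \<nu>: "levy_measure \<nu>" and \<epsilon>: "0 < \<epsilon>"
    and prm: "poisson_random_measure M (jump_intensity \<epsilon> \<nu>) N"
    and B: "B 1 \<in> borel_measurable M"
    and ind: "process_indep_of_random_measure M (jump_intensity \<epsilon> \<nu>) B N"
    and Z: "compensated_integral M (jump_intensity \<epsilon> \<nu>) N Z"
    and K: "1/2 \<le> prob {\<omega> \<in> space M. \<bar>B 1 \<omega>\<bar> \<le> K}"
    and y: "0 < y"
  defines "l \<equiv> measure \<nu> {2 * y..<8 * y} / \<epsilon>"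
    and "l' \<equiv> measure \<nu> ({..- (2 * y)} \<union> {8 * y..}) / \<epsilon>"
  shows "min l 1 * exp (- (l + l')) / 2 \<le>
    prob {\<omega> \<in> space M. \<epsilon> * y / 2 - sqrt \<epsilon> * K \<le> \<bar>sqrt \<epsilon> * B 1 \<omega> + \<epsilon> * Z 1 \<omega>\<bar>}" (is "?l \<le> ?p")
proof -
  define \<mu> where "\<mu> = jump_intensity \<epsilon> \<nu>"
  define T where "T \<delta> \<omega> = truncated_compensated_integral \<mu> (N \<omega>) \<delta> 1" for \<delta> \<omega>
  have \<nu>s: "sets \<nu> = sets borel" using \<nu> by (simp add: levy_measure_def)
  have Nsets: "\<And>\<omega>. \<omega> \<in> space M \<Longrightarrow> sets (N \<omega>) = sets \<mu>"
    using prm by (simp add: poisson_random_measure_def \<mu>_def)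
  have T_count: "T \<delta> \<in> borel_measurable (count_events \<mu> N)" for \<delta>
    unfolding T_def \<mu>_def
    by (rule measurable_truncated_compensated_integral[OF \<nu>s])
       (use Nsets measurable_count_events in \<open>auto simp: \<mu>_def\<close>)
  have [measurable]: "T \<delta> \<in> borel_measurable M" for \<delta>
    unfolding T_def \<mu>_def
    by (rule measurable_truncated_compensated_integral[OF \<nu>s])
       (use prm Nsets in \<open>auto simp: \<mu>_def poisson_random_measure_def\<close>)
  have [measurable]: "Z 1 \<in> borel_measurable M" "B 1 \<in> borel_measurable M"
    using Z B by (auto simp: compensated_integral_def)
  define err where "err \<delta> = prob {\<omega> \<in> space M. y / 4 < \<bar>T \<delta> \<omega> - Z 1 \<omega>\<bar>}" for \<delta>
  have err: "(err \<longlongrightarrow> 0) (at_right 0)"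
  proof -
    have "0 < y / 4" using y by simp
    then show ?thesis
      using Z unfolding err_def T_def \<mu>_def compensated_integral_def
      by (meson atLeastAtMost_iff order_refl zero_le_one)
  qed
  have bound: "?l \<le> ?p + err \<delta>" if \<delta>: "0 < \<delta>" "\<delta> < 2 * y" for \<delta>
  proof -
    have iv: "indep_var borel (T \<delta>) borel (B 1)"
      using ind T_count measurable_path_events[of 1 B]
      by (intro indep_path_count) (auto simp: \<mu>_def)
    have "?l = min l 1 * exp (- (l + l')) * (1/2)" by simp
    also have "\<dots> \<le> prob {\<omega> \<in> space M. 3/4 * y \<le> \<bar>T \<delta> \<omega>\<bar>} * prob {\<omega> \<in> space M. \<bar>B 1 \<omega>\<bar> \<le> K}"
      using truncated_integral_lower_bound[OF \<nu> \<epsilon> prm \<delta>] K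
      by (intro mult_mono) (auto simp: l_def l'_def T_def \<mu>_def)
    also have "\<dots> = prob ((\<lambda>\<omega>. (T \<delta> \<omega>, B 1 \<omega>)) -` ({x. 3/4 * y \<le> \<bar>x\<bar>} \<times> {x. \<bar>x\<bar> \<le> K}) \<inter> space M)"
      by (subst indep_varD[OF iv]) (auto simp: vimage_def Int_def conj_commute)
    also have "\<dots> \<le> prob ({\<omega> \<in> space M. \<epsilon> * y / 2 - sqrt \<epsilon> * K \<le> \<bar>sqrt \<epsilon> * B 1 \<omega> + \<epsilon> * Z 1 \<omega>\<bar>}
        \<union> {\<omega> \<in> space M. y / 4 < \<bar>T \<delta> \<omega> - Z 1 \<omega>\<bar>})"
    proof (rule finite_measure_mono)
      have "\<epsilon> * y / 2 - sqrt \<epsilon> * K \<le> \<bar>sqrt \<epsilon> * B 1 \<omega> + \<epsilon> * Z 1 \<omega>\<bar>"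
        if "3/4 * y \<le> \<bar>T \<delta> \<omega>\<bar>" "\<bar>B 1 \<omega>\<bar> \<le> K" "\<bar>T \<delta> \<omega> - Z 1 \<omega>\<bar> \<le> y / 4" for \<omega>
      proof -
        have "y / 2 \<le> \<bar>Z 1 \<omega>\<bar>" using that by linarith
        then have "\<epsilon> * (y / 2) \<le> \<epsilon> * \<bar>Z 1 \<omega>\<bar>" using \<epsilon> by (intro mult_left_mono) auto
        moreover have "sqrt \<epsilon> * \<bar>B 1 \<omega>\<bar> \<le> sqrt \<epsilon> * K" using that \<epsilon> by (intro mult_left_mono) auto
        moreover have "\<bar>\<epsilon> * Z 1 \<omega>\<bar> = \<epsilon> * \<bar>Z 1 \<omega>\<bar>" "\<bar>sqrt \<epsilon> * B 1 \<omega>\<bar> = sqrt \<epsilon> * \<bar>B 1 \<omega>\<bar>"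
          using \<epsilon> by (auto simp: abs_mult)
        ultimately show ?thesis by linarith
      qed
      then show "(\<lambda>\<omega>. (T \<delta> \<omega>, B 1 \<omega>)) -` ({x. 3/4 * y \<le> \<bar>x\<bar>} \<times> {x. \<bar>x\<bar> \<le> K}) \<inter> space M \<subseteq>
        {\<omega> \<in> space M. \<epsilon> * y / 2 - sqrt \<epsilon> * K \<le> \<bar>sqrt \<epsilon> * B 1 \<omega> + \<epsilon> * Z 1 \<omega>\<bar>}
        \<union> {\<omega> \<in> space M. y / 4 < \<bar>T \<delta> \<omega> - Z 1 \<omega>\<bar>}"
        using not_le by blast
    qed measurable
    also have "\<dots> \<le> ?p + err \<delta>"
      unfolding err_def by (rule measure_Un_le) measurable
    finally show ?thesis .
  qed
  have "((\<lambda>\<delta>. ?p + err \<delta>) \<longlongrightarrow> ?p + 0) (at_right 0)"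
    by (intro tendsto_add tendsto_const err)
  moreover have "eventually (\<lambda>\<delta>. ?l \<le> ?p + err \<delta>) (at_right 0)"
    using eventually_at_right_real[of 0 "2 * y"] y bound by (auto elim!: eventually_mono)
  ultimately have "?l \<le> ?p + 0"
    by (rule tendsto_lowerbound) simp
  then show ?thesis by simp
qed

end

section \<open>A polynomial lower bound for the probability of the closed set\<close>

text \<open>Only the ratio of the tail at \<open>4 u\<close> and at \<open>u\<close> is used: it tends to \<open>4 powr (- a)\<close>,
  which is positive and less than \<open>1/4\<close>, so that along a geometric sequence the tail decays at
  least by the factor \<open>1/2\<close> and at most by a fixed factor \<open>q\<close>.\<close>

lemma regularly_varying_tail:
  fixes L T :: "real \<Rightarrow> real"
  assumes a: "1 < a" and L: "\<forall>x>0. 0 < L x" "slowly_varying L"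
    and T: "\<And>x. 0 < x \<Longrightarrow> T x = L x * x powr (- a)"
  shows "\<exists>c q D k0. 0 < c \<and> 0 < q \<and> q \<le> 1 \<and>
    (\<forall>k\<ge>k0. c * q ^ k \<le> T (2 * 4 ^ k) \<and> 2 ^ k * T (2 * 4 ^ k) \<le> D \<and> T (8 * 4 ^ k) \<le> T (2 * 4 ^ k) / 2)"
proof -
  define t where "t k = T (2 * 4 ^ k)" for k :: nat
  define q where "q = 4 powr (- a) / 2"
  have "4 powr (- a) \<le> 4 powr (- 1 :: real)" using a by (intro powr_mono) auto
  then have p4: "4 powr (- a) \<le> 1 / 4" by (simp add: powr_minus)
  have q: "0 < q" "q \<le> 1" using p4 by (auto simp: q_def)
  have t0: "0 < t k" for k using L(1) by (simp add: t_def T)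
  have "((\<lambda>u. L (4 * u) / L u) \<longlongrightarrow> 1) at_top"
    using L(2) by (auto simp: slowly_varying_def)
  moreover have "filterlim (\<lambda>k::nat. 2 * 4 ^ k :: real) at_top sequentially"
    by real_asymp
  ultimately have "((\<lambda>k::nat. L (4 * (2 * 4 ^ k)) / L (2 * 4 ^ k)) \<longlongrightarrow> 1) sequentially"
    by (rule filterlim_compose)
  then have "eventually (\<lambda>k::nat. 1/2 < L (4 * (2 * 4 ^ k)) / L (2 * 4 ^ k) \<and> L (4 * (2 * 4 ^ k)) / L (2 * 4 ^ k) < 2) sequentially"
    by (intro eventually_conj order_tendstoD) auto
  then obtain k0 :: nat where k0: "\<And>k. k \<ge> k0 \<Longrightarrow> 1/2 < L (4 * (2 * 4 ^ k)) / L (2 * 4 ^ k) \<and> L (4 * (2 * 4 ^ k)) / L (2 * 4 ^ k) < 2"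
    by (auto simp: eventually_sequentially)
  have Suc: "t (Suc k) = T (8 * 4 ^ k)" for k by (simp add: t_def)
  have step: "q * t k \<le> t (Suc k)" "t (Suc k) \<le> t k / 2" if "k \<ge> k0" for k
  proof -
    define u where "u = 2 * (4::real) ^ k"
    have u: "0 < u" "0 < L u" using L(1) by (auto simp: u_def)
    have "t (Suc k) = L (4 * u) * (4 * u) powr (- a)" by (simp add: t_def T u_def)
    also have "\<dots> = (L (4 * u) / L u) * 4 powr (- a) * t k"
      using u by (simp add: powr_mult t_def T u_def[symmetric])
    finally have eq: "t (Suc k) = (L (4 * u) / L u) * 4 powr (- a) * t k" .
    have r: "1/2 < L (4 * u) / L u" "L (4 * u) / L u < 2" using k0[OF that] by (auto simp: u_def)
    have "1/2 * 4 powr (- a) * t k \<le> (L (4 * u) / L u) * 4 powr (- a) * t k"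
      using r t0[of k] by (intro mult_right_mono) auto
    then show "q * t k \<le> t (Suc k)" unfolding eq q_def by simp
    have "(L (4 * u) / L u) * 4 powr (- a) * t k \<le> 2 * (1/4) * t k"
      using r t0[of k] p4 by (intro mult_right_mono mult_mono) auto
    then show "t (Suc k) \<le> t k / 2" unfolding eq by simp
  qed
  have "t k0 * q ^ k \<le> t k \<and> 2 ^ k * t k \<le> 2 ^ k0 * t k0" if "k0 \<le> k" for k
    using that
  proof (induction k rule: dec_induct)
    case base
    then show ?case using q t0[of k0] power_le_one[of q k0] by (simp add: mult_le_cancel_left1)
  next
    case (step k)
    have "t k0 * q ^ Suc k = q * (t k0 * q ^ k)" by simp
    also have "\<dots> \<le> q * t k" using step q by (intro mult_left_mono) auto
    also have "\<dots> \<le> t (Suc k)" using \<open>k0 \<le> k\<close> by (rule \<open>\<And>k. k0 \<le> k \<Longrightarrow> q * t k \<le> t (Suc k)\<close>)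
    finally have 1: "t k0 * q ^ Suc k \<le> t (Suc k)" .
    have "2 ^ Suc k * t (Suc k) \<le> 2 ^ Suc k * (t k / 2)"
      using \<open>k0 \<le> k\<close> by (intro mult_left_mono \<open>\<And>k. k0 \<le> k \<Longrightarrow> t (Suc k) \<le> t k / 2\<close>) auto
    also have "\<dots> = 2 ^ k * t k" by simp
    also have "\<dots> \<le> 2 ^ k0 * t k0" using step.IH by simp
    finally show ?case using 1 by simp
  qed
  then have "\<forall>k\<ge>k0. t k0 * q ^ k \<le> T (2 * 4 ^ k) \<and> 2 ^ k * T (2 * 4 ^ k) \<le> 2 ^ k0 * t k0 \<and>
      T (8 * 4 ^ k) \<le> T (2 * 4 ^ k) / 2"
    using step(2) by (simp add: Suc[symmetric]) (simp add: t_def)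
  with q t0[of k0] show ?thesis by blast
qed

context prob_space
begin

text \<open>For \<open>\<epsilon> = 2\<^sup>-\<^sup>k\<close> a jump of order \<open>4\<^sup>k\<close> moves the end point by the order of \<open>2\<^sup>k\<close>, far
  beyond \<open>k\<close>. The exponent \<open>s\<close> is crude; what matters is that it is fixed before the number of jumps
  in the closed set is chosen.\<close>

lemma endpoint_escapes:
  fixes B :: "real \<Rightarrow> 'a \<Rightarrow> real" and N :: "real \<Rightarrow> 'a \<Rightarrow> (real \<times> real) measure"
    and Z :: "real \<Rightarrow> real \<Rightarrow> 'a \<Rightarrow> real"
  assumes ab: "1 < \<alpha>" "1 < \<beta>" and \<nu>: "levy_measure \<nu>"
    and Lp: "\<forall>x>0. 0 < Lp x" "slowly_varying Lp" and Lm: "\<forall>x>0. 0 < Lm x" "slowly_varying Lm"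
    and tp: "\<forall>x>0. emeasure \<nu> {x..} = ennreal (Lp x * x powr (- \<alpha>))"
    and tm: "\<forall>x>0. emeasure \<nu> {..- x} = ennreal (Lm x * x powr (- \<beta>))"
    and B: "B 1 \<in> borel_measurable M"
    and prm: "\<forall>\<epsilon>>0. poisson_random_measure M (jump_intensity \<epsilon> \<nu>) (N \<epsilon>)"
    and ind: "\<forall>\<epsilon>>0. process_indep_of_random_measure M (jump_intensity \<epsilon> \<nu>) B (N \<epsilon>)"
    and Z: "\<forall>\<epsilon>>0. compensated_integral M (jump_intensity \<epsilon> \<nu>) (N \<epsilon>) (Z \<epsilon>)"
  shows "\<exists>s. eventually (\<lambda>k. 2 * ((1/2) ^ k) ^ s \<le>
    prob {\<omega> \<in> space M. real k + C \<le> \<bar>sqrt ((1/2) ^ k) * B 1 \<omega> + (1/2) ^ k * Z ((1/2) ^ k) 1 \<omega>\<bar>}) sequentially"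
proof -
  define Tp where "Tp x = measure \<nu> {x..}" for x
  define Tm where "Tm x = measure \<nu> {..- x}" for x
  have s: "sets \<nu> = sets borel" using \<nu> by (simp add: levy_measure_def)
  have Tp: "Tp x = Lp x * x powr (- \<alpha>)" and Tm: "Tm x = Lm x * x powr (- \<beta>)" if "0 < x" for x
    using tp tm Lp(1) Lm(1) that by (auto simp: Tp_def Tm_def measure_def)
  have fp: "emeasure \<nu> {x..} \<noteq> \<infinity>" and fm: "emeasure \<nu> {..- x} \<noteq> \<infinity>" if "0 < x" for x
    using tp tm that by auto
  obtain c q D1 k1 where 1: "0 < c" "0 < q" "q \<le> 1" "\<And>k. k \<ge> k1 \<Longrightarrow>
    c * q ^ k \<le> Tp (2 * 4 ^ k) \<and> 2 ^ k * Tp (2 * 4 ^ k) \<le> D1 \<and> Tp (8 * 4 ^ k) \<le> Tp (2 * 4 ^ k) / 2"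
    using regularly_varying_tail[OF ab(1) Lp Tp] by metis
  obtain D2 k2 where 2: "\<And>k. k \<ge> k2 \<Longrightarrow> 2 ^ k * Tm (2 * 4 ^ k) \<le> D2"
    using regularly_varying_tail[OF ab(2) Lm Tm] by metis
  obtain K where K: "0 < K" "prob {\<omega> \<in> space M. K < \<bar>B 1 \<omega>\<bar>} < 1/2"
    using bounded_in_probability[OF B, of "1/2"] by auto
  have "prob (space M - {\<omega> \<in> space M. K < \<bar>B 1 \<omega>\<bar>}) = 1 - prob {\<omega> \<in> space M. K < \<bar>B 1 \<omega>\<bar>}"
    using B by (intro prob_compl) measurable
  moreover have "space M - {\<omega> \<in> space M. K < \<bar>B 1 \<omega>\<bar>} = {\<omega> \<in> space M. \<bar>B 1 \<omega>\<bar> \<le> K}" by auto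
  ultimately have KB: "1/2 \<le> prob {\<omega> \<in> space M. \<bar>B 1 \<omega>\<bar> \<le> K}" using K(2) by simp
  define c' where "c' = min (c / 2) 1 * exp (- (2 * D1 + D2)) / 2"
  have c': "0 < c'" using 1(1) by (simp add: c'_def)
  have lower: "c' * q ^ k \<le> prob {\<omega> \<in> space M. (2 ^ k) / 2 - K \<le>
      \<bar>sqrt ((1/2) ^ k) * B 1 \<omega> + (1/2) ^ k * Z ((1/2) ^ k) 1 \<omega>\<bar>}" if k: "k \<ge> k1" "k \<ge> k2" for k
  proof -
    define \<epsilon> :: real where "\<epsilon> = (1/2) ^ k"
    define y :: real where "y = 4 ^ k"
    have \<epsilon>: "0 < \<epsilon>" "\<epsilon> \<le> 1" "1 / \<epsilon> = 2 ^ k"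
      by (auto simp: \<epsilon>_def power_one_over power_le_one)
    have y: "0 < y" by (simp add: y_def)
    have div: "x / \<epsilon> = 2 ^ k * x" for x using \<epsilon>(3) by (metis mult.commute mult.right_neutral times_divide_eq_right)
    define l where "l = measure \<nu> {2 * y..<8 * y} / \<epsilon>"
    define l' where "l' = measure \<nu> ({..- (2 * y)} \<union> {8 * y..}) / \<epsilon>"
    have Tp0: "0 \<le> Tp x" for x by (simp add: Tp_def)
    have m: "measure \<nu> {2 * y..<8 * y} = Tp (2 * y) - Tp (8 * y)"
    proof -
      have "{2 * y..<8 * y} = {2 * y..} - {8 * y..}" by auto
      then show ?thesis
        using fp[of "2 * y"] y s by (simp add: measure_Diff Tp_def)
    qed
    have "c * q ^ k / 2 \<le> measure \<nu> {2 * y..<8 * y}"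
      using 1(4)[OF k(1)] m by (simp add: y_def)
    also have "\<dots> \<le> l"
      unfolding l_def div by (simp add: mult_le_cancel_right1)
    finally have l_ge: "c * q ^ k / 2 \<le> l" .
    have "2 ^ k * measure \<nu> {2 * y..<8 * y} \<le> 2 ^ k * Tp (2 * y)"
      using m Tp0 by (intro mult_left_mono) auto
    moreover have "2 ^ k * Tp (2 * y) \<le> D1" using 1(4)[OF k(1)] by (simp add: y_def)
    ultimately have l_le: "l \<le> D1" unfolding l_def div by linarith
    have "measure \<nu> ({..- (2 * y)} \<union> {8 * y..}) \<le> Tm (2 * y) + Tp (8 * y)"
      unfolding Tm_def Tp_def by (rule measure_Un_le) (auto simp: s)
    also have "\<dots> \<le> Tm (2 * y) + Tp (2 * y)"
      using 1(4)[OF k(1)] Tp0[of "2 * y"] by (simp add: y_def)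
    finally have "2 ^ k * measure \<nu> ({..- (2 * y)} \<union> {8 * y..}) \<le> 2 ^ k * (Tm (2 * y) + Tp (2 * y))"
      by (rule mult_left_mono) simp
    then have l'_le: "l' \<le> D2 + D1"
      using 1(4)[OF k(1)] 2[OF k(2)] unfolding l'_def div by (simp add: y_def distrib_left)
    have qk: "0 \<le> q ^ k" "q ^ k \<le> 1" using 1 by (auto intro: power_le_one)
    have "min (c / 2) 1 * q ^ k \<le> min l 1"
    proof (rule min.boundedI)
      have "min (c / 2) 1 * q ^ k \<le> c / 2 * q ^ k" using qk by (intro mult_right_mono) auto
      then show "min (c / 2) 1 * q ^ k \<le> l" using l_ge by simp
      have "min (c / 2) 1 * q ^ k \<le> 1 * 1" using qk 1 by (intro mult_mono) auto
      then show "min (c / 2) 1 * q ^ k \<le> 1" by simp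
    qed
    moreover have "exp (- (2 * D1 + D2)) \<le> exp (- (l + l'))" using l_le l'_le by simp
    ultimately have "min (c / 2) 1 * q ^ k * exp (- (2 * D1 + D2)) \<le> min l 1 * exp (- (l + l'))"
      using l_ge 1(1) qk by (intro mult_mono) (auto intro: order_trans[rotated])
    then have "c' * q ^ k \<le> min l 1 * exp (- (l + l')) / 2"
      by (simp add: c'_def mult_ac)
    also have "\<dots> \<le> prob {\<omega> \<in> space M. \<epsilon> * y / 2 - sqrt \<epsilon> * K \<le> \<bar>sqrt \<epsilon> * B 1 \<omega> + \<epsilon> * Z \<epsilon> 1 \<omega>\<bar>}"
      unfolding l_def l'_def using prm ind Z \<epsilon>(1) \<nu> B KB y
      by (intro endpoint_lower_bound[where B = B and N = "N \<epsilon>" and Z = "Z \<epsilon>" and K = K]) auto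
    also have "\<dots> \<le> prob {\<omega> \<in> space M. (2 ^ k) / 2 - K \<le> \<bar>sqrt \<epsilon> * B 1 \<omega> + \<epsilon> * Z \<epsilon> 1 \<omega>\<bar>}"
    proof (rule finite_measure_mono)
      have "\<epsilon> * y = 2 ^ k" by (simp add: \<epsilon>_def y_def power_mult_distrib[symmetric])
      moreover have "sqrt \<epsilon> * K \<le> 1 * K" using \<epsilon> K by (intro mult_right_mono) auto
      ultimately show "{\<omega> \<in> space M. \<epsilon> * y / 2 - sqrt \<epsilon> * K \<le> \<bar>sqrt \<epsilon> * B 1 \<omega> + \<epsilon> * Z \<epsilon> 1 \<omega>\<bar>}
        \<subseteq> {\<omega> \<in> space M. (2 ^ k) / 2 - K \<le> \<bar>sqrt \<epsilon> * B 1 \<omega> + \<epsilon> * Z \<epsilon> 1 \<omega>\<bar>}"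
        by auto
      have [measurable]: "Z \<epsilon> 1 \<in> borel_measurable M" "B 1 \<in> borel_measurable M"
        using Z B \<epsilon>(1) by (auto simp: compensated_integral_def)
      show "{\<omega> \<in> space M. (2 ^ k) / 2 - K \<le> \<bar>sqrt \<epsilon> * B 1 \<omega> + \<epsilon> * Z \<epsilon> 1 \<omega>\<bar>} \<in> events"
        by measurable
    qed
    finally show ?thesis by (simp add: \<epsilon>_def)
  qed
  obtain s where s_le: "(1/2::real) ^ s < q / 2" using real_arch_pow_inv[of "q / 2" "1/2"] 1(2) by auto
  have "eventually (\<lambda>k::nat. real k + (C + K) \<le> 2 ^ k / 2) sequentially" by real_asymp
  moreover have "eventually (\<lambda>k::nat. 2 * (1/2) ^ k \<le> c') sequentially"
  proof -
    have "(\<lambda>k::nat. 2 * (1/2) ^ k :: real) \<longlonglongrightarrow> 0" by real_asymp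
    from order_tendstoD(2)[OF this c'] show ?thesis by (auto elim: eventually_mono)
  qed
  ultimately have "eventually (\<lambda>k. 2 * ((1/2) ^ k) ^ s \<le>
    prob {\<omega> \<in> space M. real k + C \<le> \<bar>sqrt ((1/2) ^ k) * B 1 \<omega> + (1/2) ^ k * Z ((1/2) ^ k) 1 \<omega>\<bar>}) sequentially"
    using eventually_ge_at_top[of k1] eventually_ge_at_top[of k2]
  proof eventually_elim
    case (elim k)
    have "2 * ((1/2) ^ k) ^ s = 2 * ((1/2::real) ^ s) ^ k"
      by (simp add: power_mult[symmetric] mult.commute)
    also have "\<dots> \<le> 2 * (q / 2) ^ k" using s_le by (intro mult_left_mono power_mono) auto
    also have "\<dots> = (2 * (1/2) ^ k) * q ^ k" by (simp add: power_divide power_one_over)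
    also have "\<dots> \<le> c' * q ^ k" using elim 1(2) by (intro mult_right_mono) auto
    also have "\<dots> \<le> prob {\<omega> \<in> space M. (2 ^ k) / 2 - K \<le>
      \<bar>sqrt ((1/2) ^ k) * B 1 \<omega> + (1/2) ^ k * Z ((1/2) ^ k) 1 \<omega>\<bar>}"
      by (rule lower) (use elim in auto)
    also have "\<dots> \<le> prob {\<omega> \<in> space M. real k + C \<le>
      \<bar>sqrt ((1/2) ^ k) * B 1 \<omega> + (1/2) ^ k * Z ((1/2) ^ k) 1 \<omega>\<bar>}"
    proof (rule finite_measure_mono)
      have [measurable]: "Z ((1/2) ^ k) 1 \<in> borel_measurable M" "B 1 \<in> borel_measurable M"
        using Z B by (auto simp: compensated_integral_def)
      show "{\<omega> \<in> space M. real k + C \<le>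
        \<bar>sqrt ((1/2) ^ k) * B 1 \<omega> + (1/2) ^ k * Z ((1/2) ^ k) 1 \<omega>\<bar>} \<in> events" by measurable
    qed (use elim in auto)
    finally show ?case .
  qed
  then show ?thesis by blast
qed

text \<open>On a time mesh \<open>h\<close> the noise must move by more than \<open>(2 C + 1) h\<close> in each step: then the
  solution moves by more than \<open>(C + 1) h\<close>, which is a chain of excess \<open>h\<close>. By anti-concentration
  a step fails with probability of order \<open>sqrt (h / \<epsilon>)\<close>, so a small mesh costs at most half of
  the probability that the end point is large.\<close>

lemma rough_event:
  fixes B :: "real \<Rightarrow> 'a \<Rightarrow> real" and b :: "real \<Rightarrow> real"
  assumes \<nu>: "levy_measure \<nu>" and \<epsilon>: "0 < \<epsilon>"
    and B: "standard_brownian_motion M B"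
    and prm: "poisson_random_measure M (jump_intensity \<epsilon> \<nu>) N"
    and ind: "process_indep_of_random_measure M (jump_intensity \<epsilon> \<nu>) B N"
    and Z: "compensated_integral M (jump_intensity \<epsilon> \<nu>) N Z"
    and b: "L-lipschitz_on UNIV b" "\<And>y. \<bar>b y\<bar> \<le> C"
  defines "X \<equiv> (\<lambda>t \<omega>. sqrt \<epsilon> * B t \<omega> + \<epsilon> * Z t \<omega>)"
  assumes Y: "solves_additive_sde M b X Y"
    and p: "0 < p" "2 * p \<le> prob {\<omega> \<in> space M. a + C \<le> \<bar>X 1 \<omega>\<bar>}"
  shows "\<exists>r>0. \<exists>E\<in>events. p \<le> prob E \<and> (AE \<omega> in M. \<omega> \<in> E \<longrightarrow>
    (\<lambda>t\<in>{0..1}. Y t \<omega>) \<in> {x \<in> skorokhod_space. a \<le> \<bar>x 1\<bar> \<and> rough n C r x})"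
proof -
  have \<nu>s: "sets \<nu> = sets borel" using \<nu> by (simp add: levy_measure_def)
  have C: "0 \<le> C" using b(2)[of 0] by simp
  \<comment> \<open>With \<open>sqrt h \<le> d\<close> each step fails with probability at most \<open>p / (n + 1)\<close>.\<close>
  define d where "d = p * sqrt \<epsilon> / (2 * (2 * C + 1) * (real n + 1))"
  define h where "h = min (1 / (real n + 1)) (d\<^sup>2)"
  have d: "0 < d" using p \<epsilon> C by (simp add: d_def)
  have h: "0 < h" "(real n + 1) * h \<le> 1" "sqrt h \<le> d"
  proof -
    show "0 < h" using d by (simp add: h_def)
    have "(real n + 1) * h \<le> (real n + 1) * (1 / (real n + 1))"
      unfolding h_def by (intro mult_left_mono) auto
    then show "(real n + 1) * h \<le> 1" by simp
    have "sqrt h \<le> sqrt (d\<^sup>2)" unfolding h_def by (intro real_sqrt_le_mono) auto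
    then show "sqrt h \<le> d" using d by simp
  qed
  \<comment> \<open>The mesh starts at \<open>h\<close> and not at \<open>0\<close>, where the equation for \<open>Y\<close> is not imposed.\<close>
  define u where "u i = (real i + 1) * h" for i :: nat
  have u01: "u i \<in> {0<..1}" if "i \<le> n" for i
  proof -
    have "u i \<le> (real n + 1) * h" using that h by (auto simp: u_def intro!: mult_right_mono)
    also note h(2)
    finally show ?thesis using h(1) by (auto simp: u_def)
  qed
  have u_step: "u (Suc i) - u i = h" for i by (simp add: u_def algebra_simps)
  have X[measurable]: "X t \<in> borel_measurable M" if "t \<in> {0..1}" for t
  proof -
    have [measurable]: "B t \<in> borel_measurable M" "Z t \<in> borel_measurable M"
      using B Z that by (auto simp: standard_brownian_motion_def compensated_integral_def)
    show ?thesis unfolding X_def by measurable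
  qed
  define Bad where "Bad i = {\<omega> \<in> space M. \<bar>X (u (Suc i)) \<omega> - X (u i) \<omega>\<bar> \<le> (2 * C + 1) * h}" for i
  have Bad[measurable]: "Bad i \<in> events" if "i < n" for i
  proof -
    have [measurable]: "X (u (Suc i)) \<in> borel_measurable M" "X (u i) \<in> borel_measurable M"
      using u01[of i] u01[of "Suc i"] that by (auto intro!: X)
    show ?thesis unfolding Bad_def by measurable
  qed
  have bad_prob: "prob (Bad i) \<le> p / (real n + 1)" if i: "i < n" for i
  proof -
    have "prob (Bad i) \<le> 2 * ((2 * C + 1) * h) / (sqrt \<epsilon> * sqrt (u (Suc i) - u i))"
      unfolding Bad_def X_def
      using u01[of i] u01[of "Suc i"] u_step[of i] i h C
      by (intro increment_anticoncentration[OF \<nu>s \<epsilon> prm B ind Z]) auto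
    also have "\<dots> = 2 * (2 * C + 1) * sqrt h / sqrt \<epsilon>"
    proof -
      have "2 * ((2 * C + 1) * h) / (sqrt \<epsilon> * sqrt h) = 2 * (2 * C + 1) * (h / sqrt h) / sqrt \<epsilon>"
        by (simp add: mult_ac)
      then show ?thesis unfolding u_step using h by (simp only: real_div_sqrt less_imp_le)
    qed
    also have "\<dots> \<le> 2 * (2 * C + 1) * d / sqrt \<epsilon>"
      using h C \<epsilon> by (intro divide_right_mono mult_left_mono) auto
    also have "\<dots> = p / (real n + 1)"
      using C \<epsilon> by (simp add: d_def)
    finally show ?thesis .
  qed
  define E0 where "E0 = {\<omega> \<in> space M. a + C \<le> \<bar>X 1 \<omega>\<bar>}"
  define E where "E = E0 - (\<Union>i\<in>{..<n}. Bad i)"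
  have E0: "E0 \<in> events"
  proof -
    have [measurable]: "X 1 \<in> borel_measurable M" by (intro X) auto
    show ?thesis unfolding E0_def by measurable
  qed
  have Bads: "(\<Union>i\<in>{..<n}. Bad i) \<in> events" using Bad by auto
  have E: "E \<in> events" unfolding E_def using E0 Bads by auto
  have "prob (\<Union>i\<in>{..<n}. Bad i) \<le> (\<Sum>i\<in>{..<n}. prob (Bad i))"
    using Bad by (intro finite_measure_subadditive_finite) auto
  also have "\<dots> \<le> (\<Sum>i\<in>{..<n}. p / (real n + 1))" by (intro sum_mono bad_prob) auto
  also have "\<dots> \<le> p" using p by (simp add: field_simps)
  finally have bads: "prob (\<Union>i\<in>{..<n}. Bad i) \<le> p" .
  have "prob E0 \<le> prob (E \<union> (\<Union>i\<in>{..<n}. Bad i))"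
    by (rule finite_measure_mono[OF _ sets.Un[OF E Bads]]) (auto simp: E_def)
  also have "\<dots> \<le> prob E + prob (\<Union>i\<in>{..<n}. Bad i)" by (rule measure_Un_le[OF E Bads])
  finally have "p \<le> prob E" using bads p(2) by (simp add: E0_def)
  moreover have "AE \<omega> in M. \<omega> \<in> E \<longrightarrow>
    (\<lambda>t\<in>{0..1}. Y t \<omega>) \<in> {x \<in> skorokhod_space. a \<le> \<bar>x 1\<bar> \<and> rough n C h x}"
  proof -
    have "AE \<omega> in M. (\<lambda>t\<in>{0..1}. Y t \<omega>) \<in> skorokhod_space \<and> Y 0 \<omega> = 0 \<and>
        (\<forall>t\<in>{0<..1}. Y t \<omega> = (LBINT s:{0..t}. b (Y s \<omega>)) + X t \<omega>)"
      using Y by (simp add: solves_additive_sde_def)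
    then show ?thesis
    proof eventually_elim
      case (elim \<omega>)
      define x where "x = (\<lambda>t\<in>{0..1}. Y t \<omega>)"
      define J where "J t = (LBINT s:{0..t}. b (x s))" for t
      have x: "x \<in> skorokhod_space" using elim by (simp add: x_def)
      have x_eq: "x t = J t + X t \<omega>" if t: "t \<in> {0<..1}" for t
      proof -
        have "J t = (LBINT s:{0..t}. b (Y s \<omega>))"
          unfolding J_def using t by (intro set_lebesgue_integral_cong) (auto simp: x_def)
        then show ?thesis using elim t by (simp add: x_def)
      qed
      have J: "\<bar>J t - J s\<bar> \<le> C * (t - s)" if "0 \<le> s" "s \<le> t" "t \<le> 1" for s t
        unfolding J_def using that b(2)
        by (intro set_integral_increment_bound(2)[OF measurable_drift[OF x b(1)]]) auto
      have J0: "J 0 = 0"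
        unfolding J_def set_lebesgue_integral_def
        by (rule integral_eq_zero_AE) (rule eventually_mono[OF AE_lborel_singleton[of 0]], simp)
      show ?case
      proof
        assume \<omega>: "\<omega> \<in> E"
        have "a + C \<le> \<bar>X 1 \<omega>\<bar>" using \<omega> by (simp add: E_def E0_def)
        then have "a \<le> \<bar>x 1\<bar>" using x_eq[of 1] J[of 0 1] J0 by simp
        moreover have "rough n C h x"
          unfolding rough_def
        proof (intro allI impI exI conjI)
          fix e :: real assume e: "0 < e"
          show "u \<in> {..n} \<rightarrow> {0..1}" using u01 by fastforce
          show "steep_chain n C (h - e) x u"
            unfolding steep_chain_def
          proof (intro allI impI conjI)
            fix i assume i: "i < n"
            show "u i < u (Suc i)" using u_step[of i] h by simp
            have ui: "u i \<in> {0<..1}" "u (Suc i) \<in> {0<..1}" using u01 i by auto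
            have "\<bar>X (u (Suc i)) \<omega> - X (u i) \<omega>\<bar> > (2 * C + 1) * h"
              using \<omega> i by (auto simp: E_def E0_def Bad_def not_le)
            moreover have "\<bar>J (u (Suc i)) - J (u i)\<bar> \<le> C * h"
              using J[of "u i" "u (Suc i)"] ui u_step[of i] h by auto
            ultimately have "(2 * C + 1) * h - C * h < \<bar>x (u (Suc i)) - x (u i)\<bar>"
              unfolding x_eq[OF ui(1)] x_eq[OF ui(2)] by linarith
            then show "h - e + C * (u (Suc i) - u i) < \<bar>x (u (Suc i)) - x (u i)\<bar>"
              unfolding u_step using e by (simp add: algebra_simps)
          qed
        qed
        ultimately show "(\<lambda>t\<in>{0..1}. Y t \<omega>) \<in> {x \<in> skorokhod_space. a \<le> \<bar>x 1\<bar> \<and> rough n C h x}"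
          using x by (simp add: x_def[symmetric])
      qed
    qed
  qed
  ultimately show ?thesis using h(1) E by blast
qed

end

theorem mainTheorem3:
  fixes P :: "'w measure"
    and \<alpha> \<beta> :: real
    and L\<^sub>p L\<^sub>m :: "real \<Rightarrow> real"
    and \<nu> :: "real measure"
    and B :: "real \<Rightarrow> 'w \<Rightarrow> real"
    and N :: "real \<Rightarrow> 'w \<Rightarrow> (real \<times> real) measure"
    and Z Y :: "real \<Rightarrow> real \<Rightarrow> 'w \<Rightarrow> real"
    and b :: "real \<Rightarrow> real"
  assumes "prob_space P" "complete_measure P"
    and "\<alpha> > 1" "\<beta> > 1"
    and "levy_measure \<nu>"
    and "\<forall>x>0. L\<^sub>p x > 0" "slowly_varying L\<^sub>p"
    and "\<forall>x>0. L\<^sub>m x > 0" "slowly_varying L\<^sub>m"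
    and "\<forall>x>0. emeasure \<nu> {x..} = ennreal (L\<^sub>p x * x powr (- \<alpha>))"
    and "\<forall>x>0. emeasure \<nu> {..- x} = ennreal (L\<^sub>m x * x powr (- \<beta>))"
    and "standard_brownian_motion P B"
    and "\<forall>\<epsilon>>0. poisson_random_measure P (jump_intensity \<epsilon> \<nu>) (N \<epsilon>)"
    and "\<forall>\<epsilon>>0. process_indep_of_random_measure P (jump_intensity \<epsilon> \<nu>) B (N \<epsilon>)"
    and "\<forall>\<epsilon>>0. compensated_integral P (jump_intensity \<epsilon> \<nu>) (N \<epsilon>) (Z \<epsilon>)"
    and "bounded (range b)" "\<exists>C. C-lipschitz_on UNIV b"
    and "\<forall>\<epsilon>>0. solves_additive_sde P b (\<lambda>t \<omega>. sqrt \<epsilon> * B t \<omega> + \<epsilon> * Z \<epsilon> t \<omega>) (Y \<epsilon>)"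
  shows "\<not> (\<forall>K. closedin skorokhod_topology K \<longrightarrow>
           Limsup (at_right 0) (\<lambda>\<epsilon>.
             log_prob (measure P {\<omega> \<in> space P. (\<lambda>t\<in>{0..1}. Y \<epsilon> t \<omega>) \<in> K}) / ereal (ln (1 / \<epsilon>)))
           \<le> - enn2ereal (INF \<xi>\<in>K. rate_function \<alpha> \<beta> b \<xi>))"
proof
  assume LDP: "\<forall>K. closedin skorokhod_topology K \<longrightarrow>
           Limsup (at_right 0) (\<lambda>\<epsilon>.
             log_prob (measure P {\<omega> \<in> space P. (\<lambda>t\<in>{0..1}. Y \<epsilon> t \<omega>) \<in> K}) / ereal (ln (1 / \<epsilon>)))
           \<le> - enn2ereal (INF \<xi>\<in>K. rate_function \<alpha> \<beta> b \<xi>)"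
  interpret prob_space P by fact
  obtain L where L: "L-lipschitz_on UNIV b" using assms by blast
  obtain C where C: "\<And>y. \<bar>b y\<bar> \<le> C"
    using \<open>bounded (range b)\<close> unfolding bounded_iff by auto
  have C0: "0 \<le> C" using C[of 0] by simp
  define \<epsilon> where "\<epsilon> k = (1/2::real) ^ k" for k :: nat
  have \<epsilon>: "0 < \<epsilon> k" for k by (simp add: \<epsilon>_def)
  define X where "X \<epsilon> t \<omega> = sqrt \<epsilon> * B t \<omega> + \<epsilon> * Z \<epsilon> t \<omega>" for \<epsilon> t \<omega>
  have B1: "B 1 \<in> borel_measurable P"
    using \<open>standard_brownian_motion P B\<close> by (simp add: standard_brownian_motion_def)
  obtain s where "eventually (\<lambda>k. 2 * (\<epsilon> k) ^ s \<le>
      prob {\<omega> \<in> space P. real k + C \<le> \<bar>X (\<epsilon> k) 1 \<omega>\<bar>}) sequentially"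
    using endpoint_escapes[OF assms(3-11) B1 assms(13-15), of C] unfolding \<epsilon>_def X_def by blast
  then obtain k0 where k0: "\<And>k. k0 \<le> k \<Longrightarrow> 2 * (\<epsilon> k) ^ s \<le>
      prob {\<omega> \<in> space P. real k + C \<le> \<bar>X (\<epsilon> k) 1 \<omega>\<bar>}"
    by (auto simp: eventually_sequentially)
  define c where "c = min (\<alpha> - 1) (\<beta> - 1)"
  have c: "0 < c" "c \<le> \<alpha> - 1" "c \<le> \<beta> - 1" using assms(3,4) by (auto simp: c_def)
  \<comment> \<open>The exponent \<open>s\<close> does not depend on \<open>n\<close>, so the rate can be made larger than \<open>s\<close>.\<close>
  obtain n :: nat where "real s / c < real n" using reals_Archimedean2 by blast
  then have n: "real s < c * real n" using c(1) by (simp add: pos_divide_less_eq mult.commute)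
  define good where "good k r \<longleftrightarrow> (\<exists>E\<in>events. (\<epsilon> k) ^ s \<le> prob E \<and> (AE \<omega> in P. \<omega> \<in> E \<longrightarrow>
      (\<lambda>t\<in>{0..1}. Y (\<epsilon> k) t \<omega>) \<in> {x \<in> skorokhod_space. real k \<le> \<bar>x 1\<bar> \<and> rough n C r x}))" for k r
  have "\<exists>r>0. k0 \<le> k \<longrightarrow> good k r" for k
  proof (cases "k0 \<le> k")
    case True
    have inst: "poisson_random_measure P (jump_intensity (\<epsilon> k) \<nu>) (N (\<epsilon> k))"
      "process_indep_of_random_measure P (jump_intensity (\<epsilon> k) \<nu>) B (N (\<epsilon> k))"
      "compensated_integral P (jump_intensity (\<epsilon> k) \<nu>) (N (\<epsilon> k)) (Z (\<epsilon> k))"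
      "solves_additive_sde P b (\<lambda>t \<omega>. sqrt (\<epsilon> k) * B t \<omega> + \<epsilon> k * Z (\<epsilon> k) t \<omega>) (Y (\<epsilon> k))"
      using assms(13-15,18) \<epsilon> by blast+
    have "0 < (\<epsilon> k) ^ s" using \<epsilon> by simp
    from rough_event[OF assms(5) \<epsilon> assms(12) inst(1-3) L C inst(4) this k0[OF True, unfolded X_def], of n]
    show ?thesis unfolding good_def by blast
  next
    case False
    then show ?thesis by (intro exI[of _ 1]) auto
  qed
  then obtain r where r: "\<And>k. 0 < r k" "\<And>k. k0 \<le> k \<Longrightarrow> good k (r k)"
    by metis
  define K where "K = escape_set n C k0 r"
  define p where "p e = prob {\<omega> \<in> space P. (\<lambda>t\<in>{0..1}. Y e t \<omega>) \<in> K}" for e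
  have p_ge: "(\<epsilon> k) ^ s \<le> p (\<epsilon> k)" if k: "k0 \<le> k" for k
  proof -
    obtain E where E: "E \<in> events" "(\<epsilon> k) ^ s \<le> prob E" "AE \<omega> in P. \<omega> \<in> E \<longrightarrow>
      (\<lambda>t\<in>{0..1}. Y (\<epsilon> k) t \<omega>) \<in> {x \<in> skorokhod_space. real k \<le> \<bar>x 1\<bar> \<and> rough n C (r k) x}"
      using r(2)[OF k] unfolding good_def by blast
    have sol: "solves_additive_sde P b (\<lambda>t \<omega>. sqrt (\<epsilon> k) * B t \<omega> + \<epsilon> k * Z (\<epsilon> k) t \<omega>) (Y (\<epsilon> k))"
      using assms(18) \<epsilon> by blast
    have "prob E \<le> p (\<epsilon> k)"
      unfolding p_def
    proof (rule finite_measure_mono_AE)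
      show "{\<omega> \<in> space P. (\<lambda>t\<in>{0..1}. Y (\<epsilon> k) t \<omega>) \<in> K} \<in> events"
        unfolding K_def using sol
        by (intro escape_event_measurable[OF assms(2) C0]) (auto simp: solves_additive_sde_def)
      show "AE \<omega> in P. \<omega> \<in> E \<longrightarrow> \<omega> \<in> {\<omega> \<in> space P. (\<lambda>t\<in>{0..1}. Y (\<epsilon> k) t \<omega>) \<in> K}"
        using E(3)
      proof eventually_elim
        case (elim \<omega>)
        show ?case
          using elim k sets.sets_into_space[OF E(1)] unfolding K_def escape_set_def by blast
      qed
    qed
    with E(2) show ?thesis by simp
  qed
  have "ennreal (c * real n) \<le> (INF \<xi>\<in>K. rate_function \<alpha> \<beta> b \<xi>)"
    unfolding K_def using L c r(1) C
    by (intro INF_greatest escape_set_rate[of b C r c \<alpha> \<beta> _ n k0]) auto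
  then have "enn2ereal (ennreal (c * real n)) \<le> enn2ereal (INF \<xi>\<in>K. rate_function \<alpha> \<beta> b \<xi>)"
    by (simp add: less_eq_ennreal.rep_eq)
  then have "- enn2ereal (INF \<xi>\<in>K. rate_function \<alpha> \<beta> b \<xi>) \<le> ereal (- (c * real n))"
    using c by (simp add: enn2ereal_ennreal ereal_uminus_le_reorder)
  also have "\<dots> < ereal (- real s)" using n by simp
  finally have "- enn2ereal (INF \<xi>\<in>K. rate_function \<alpha> \<beta> b \<xi>) < ereal (- real s)" .
  moreover have "closedin skorokhod_topology K"
    unfolding K_def by (rule closedin_escape_set[OF C0])
  ultimately have "Limsup (at_right 0) (\<lambda>e. log_prob (p e) / ereal (ln (1 / e))) < ereal (- real s)"
    using LDP unfolding p_def by (meson le_less_trans)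
  then have "eventually (\<lambda>e. log_prob (p e) / ereal (ln (1 / e)) < ereal (- real s)) (at_right 0)"
    by (rule Limsup_lessD)
  moreover have "filterlim \<epsilon> (at_right 0) sequentially"
    unfolding \<epsilon>_def by real_asymp
  ultimately have "eventually (\<lambda>k. log_prob (p (\<epsilon> k)) / ereal (ln (1 / \<epsilon> k)) < ereal (- real s)) sequentially"
    by (rule eventually_compose_filterlim)
  then have "eventually (\<lambda>k. log_prob (p (\<epsilon> k)) / ereal (ln (1 / \<epsilon> k)) < ereal (- real s) \<and> k0 \<le> k \<and> 1 \<le> k) sequentially"
    by (intro eventually_conj eventually_ge_at_top)
  then obtain k where k: "log_prob (p (\<epsilon> k)) / ereal (ln (1 / \<epsilon> k)) < ereal (- real s)" "k0 \<le> k" "1 \<le> k"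
    by (auto dest: eventually_happens)
  define l where "l = ln (1 / \<epsilon> k)"
  have l: "0 < l" using k(3) unfolding l_def \<epsilon>_def by (intro ln_gt_zero) (simp add: power_one_over)
  have pos: "0 < p (\<epsilon> k)" using p_ge[OF k(2)] \<epsilon>[of k] by (meson less_le_trans zero_less_power)
  have "ln ((\<epsilon> k) ^ s) \<le> ln (p (\<epsilon> k))"
    using p_ge[OF k(2)] \<epsilon>[of k] pos by (subst ln_le_cancel_iff) auto
  then have "- real s * l \<le> ln (p (\<epsilon> k))"
    using \<epsilon>[of k] by (simp add: l_def ln_realpow ln_div)
  then have "- real s \<le> ln (p (\<epsilon> k)) / l" using l by (simp add: pos_le_divide_eq)
  with k(1) pos l show False by (simp add: log_prob_def l_def[symmetric])
qed

end
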